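(* Let $\lambda\in\mathbb{R}^n$ be weakly decreasing with at least three distinct entries, and let $N\in\mathfrak{u}_n$. Then the gradient flow on $\mathcal{O}_\lambda$ with respect to $N$ in the Kähler metric weakly preserves positivity if and only if $\mathrm{i}N\in\mathfrak{gl}_n^{\ge0}$, and it strictly preserves positivity if and only if $\mathrm{i}N\in\mathfrak{gl}_n^{>0}$.
   Context: Here $\mathrm{i}=\sqrt{-1}$. $\mathfrak{gl}_n^{>0}$ (resp. $\mathfrak{gl}_n^{\ge0}$) is the set of real tridiagonal $n\times n$ matrices whose entries immediately above and below the diagonal are all positive (resp. nonnegative). $\mathrm{U}_n$ is the unitary group and $\mathfrak{u}_n$ the Lie algebra of skew-Hermitian $n\times n$ matrices. $\mathcal{O}_\lambda=\{g(\mathrm{i}\,\mathrm{Diag}(\lambda))g^{-1}:g\in\mathrm{U}_n\}$. $\mathrm{U}_n^{>0}$ (resp. $\mathrm{U}_n^{\ge 0}$) is the set of $g\in\mathrm{U}_n$ all of whose left-justified minors (row set $I$, column set $\{1,\dots,|I|\}$) are positive (resp. nonnegative) real numbers; $\mathcal{O}_\lambda^{>0}=\{g(\mathrm{i}\,\mathrm{Diag}(\lambda))g^{-1}:g\in\mathrm{U}_n^{>0}\}$, and $\mathcal{O}_\lambda^{\ge 0}$ is its closure, equal to $\{g(\mathrm{i}\,\mathrm{Diag}(\lambda))g^{-1}:g\in\mathrm{U}_n^{\ge 0}\}$. Let $\kappa(L,M)=2n\,\mathrm{tr}(LM)-2\,\mathrm{tr}(L)\mathrm{tr}(M)$ and $\mathrm{ad}_L(X)=[L,X]=LX-XL$.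 The tangent space of $\mathcal{O}_\lambda$ at $L$ is $\{[L,X]:X\in\mathfrak{u}_n\}$. For $X\in\mathfrak{u}_n$ write $X=X^L+X_L$ with $X^L\in\mathrm{im}(\mathrm{ad}_L)$, $X_L\in\ker(\mathrm{ad}_L)$ (uniquely). The normal metric is $\langle[L,X],[L,Y]\rangle_{\mathrm{normal}}=-\kappa(X^L,Y^L)$, and the Kähler metric is $\langle[L,X],[L,Y]\rangle_{\mathrm{K\ddot ahler}}=\langle\sqrt{-\mathrm{ad}_L^2}\,([L,X]),[L,Y]\rangle_{\mathrm{normal}}$, with $\sqrt{-\mathrm{ad}_L^2}$ the positive square root. The gradient flow with respect to $N$ is $\dot L(t)=\mathrm{grad}(H)(L(t))$ with $H(M)=\kappa(M,N)$ (steepest ascent), defined for all $t\in\mathbb{R}$. A flow on $\mathcal{O}_\lambda$ weakly preserves positivity if $L(t)\in\mathcal{O}_\lambda^{\ge0}$ for all $L(0)\in\mathcal{O}_\lambda^{\ge0}$ and $t\ge0$; it strictly preserves positivity if $L(t)\in\mathcal{O}_\lambda^{>0}$ for all $L(0)\in\mathcal{O}_\lambda^{\ge 0}$ and $t>0$. *)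

theory Defs
  imports "HOL-Analysis.Analysis" "Jordan_Normal_Form.Determinant"
begin

(* Square matrices are complex^'n^'n for an index type 'n of class {finite, linorder}, in the
   role of {1, ..., n} with n = CARD('n).  The determinant of a minor, whose size varies, is the
   one of Jordan_Normal_Form; the notations $ and \<bullet> below are always
   those of HOL-Analysis. *)

no_notation Matrix.vec_index (infixl \<open>$\<close> 100)
no_notation Matrix.scalar_prod (infix \<open>\<bullet>\<close> 70)

section \<open>Matrices, the unitary group and adjoint orbits\<close>

definition cscale :: "complex \<Rightarrow> complex^'n^'n \<Rightarrow> complex^'n^'n" where
  "cscale c A = (\<chi> i j. c * A $ i $ j)"

definition conj_transpose :: "complex^'n^'n \<Rightarrow> complex^'n^'n" where
  "conj_transpose A = (\<chi> i j. cnj (A $ j $ i))"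

definition Diag :: "real^'n \<Rightarrow> complex^'n^'n" where
  "Diag lam = (\<chi> i j. if i = j then complex_of_real (lam $ i) else 0)"

definition unitary_group :: "(complex^'n^'n) set" where
  "unitary_group = {g. g ** conj_transpose g = Finite_Cartesian_Product.mat 1 \<and>
                       conj_transpose g ** g = Finite_Cartesian_Product.mat 1}"

definition unitary_algebra :: "(complex^'n^'n) set" where
  "unitary_algebra = {X. conj_transpose X = - X}"

definition adj_act :: "real^'n \<Rightarrow> complex^'n^'n \<Rightarrow> complex^'n^'n" where
  "adj_act lam g = g ** cscale \<i> (Diag lam) ** matrix_inv g"

definition orbit :: "real^'n \<Rightarrow> (complex^'n^'n) set" where
  "orbit lam = adj_act lam ` unitary_group"


section \<open>Positivity\<close>

definition minor ::
    "'n::{finite,linorder} set \<Rightarrow> 'n::{finite,linorder} set \<Rightarrow>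
     complex^'n::{finite,linorder}^'n::{finite,linorder} \<Rightarrow> complex" where
  "minor I J A =
     Determinant.det (Matrix.mat (card I) (card J)
       (\<lambda>(a, b). A $ (sorted_list_of_set I ! a) $ (sorted_list_of_set J ! b)))"

definition first_indices :: "nat \<Rightarrow> 'n::{finite,linorder} set" where
  "first_indices k = {j. card {..<j} < k}"

definition left_minor ::
    "'n::{finite,linorder} set \<Rightarrow> complex^'n::{finite,linorder}^'n::{finite,linorder} \<Rightarrow> complex" where
  "left_minor I g = minor I (first_indices (card I)) g"

definition unitary_pos :: "(complex^'n::{finite,linorder}^'n::{finite,linorder}) set" where
  "unitary_pos = {g \<in> unitary_group. \<forall>I. left_minor I g \<in> \<real> \<and> 0 < Re (left_minor I g)}"

definition orbit_pos ::
    "real^'n::{finite,linorder} \<Rightarrow> (complex^'n::{finite,linorder}^'n::{finite,linorder}) set" where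
  "orbit_pos lam = adj_act lam ` unitary_pos"

definition orbit_nonneg ::
    "real^'n::{finite,linorder} \<Rightarrow> (complex^'n::{finite,linorder}^'n::{finite,linorder}) set" where
  "orbit_nonneg lam = closure (orbit_pos lam)"

definition next_index :: "'n::linorder \<Rightarrow> 'n \<Rightarrow> bool" where
  "next_index i j \<longleftrightarrow> i < j \<and> {i<..<j} = {}"

definition tridiagonal :: "real^'n::{finite,linorder}^'n::{finite,linorder} \<Rightarrow> bool" where
  "tridiagonal M \<longleftrightarrow>
     (\<forall>i j. i \<noteq> j \<longrightarrow> \<not> next_index i j \<longrightarrow> \<not> next_index j i \<longrightarrow> M $ i $ j = 0)"

definition gl_pos :: "(real^'n::{finite,linorder}^'n::{finite,linorder}) set" where
  "gl_pos = {M. tridiagonal M \<and> (\<forall>i j. next_index i j \<longrightarrow> 0 < M $ i $ j \<and> 0 < M $ j $ i)}"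

definition gl_nonneg :: "(real^'n::{finite,linorder}^'n::{finite,linorder}) set" where
  "gl_nonneg = {M. tridiagonal M \<and> (\<forall>i j. next_index i j \<longrightarrow> 0 \<le> M $ i $ j \<and> 0 \<le> M $ j $ i)}"

definition complexify :: "real^'n^'n \<Rightarrow> complex^'n^'n" where
  "complexify M = (\<chi> i j. complex_of_real (M $ i $ j))"


section \<open>The normal and Kaehler metrics\<close>

(* kappa is real-valued on skew-Hermitian matrices (kappa_in_Reals below), so taking its real
   part in the definitions below loses nothing. *)
definition kappa :: "complex^'n^'n \<Rightarrow> complex^'n^'n \<Rightarrow> complex" where
  "kappa L M = 2 * of_nat CARD('n) * trace (L ** M) - 2 * trace L * trace M"

definition ad :: "complex^'n^'n \<Rightarrow> complex^'n^'n \<Rightarrow> complex^'n^'n" where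
  "ad L X = L ** X - X ** L"

(* The image of ad L on skew-Hermitian matrices is also the tangent space at L of the orbit
   through L. *)
definition im_ad :: "complex^'n^'n \<Rightarrow> (complex^'n^'n) set" where
  "im_ad L = ad L ` unitary_algebra"

definition ker_ad :: "complex^'n^'n \<Rightarrow> (complex^'n^'n) set" where
  "ker_ad L = {X \<in> unitary_algebra. ad L X = 0}"

(* The component X^L of X = X^L + X_L; see ex1_im_ad_part below. *)
definition im_ad_part :: "complex^'n^'n \<Rightarrow> complex^'n^'n \<Rightarrow> complex^'n^'n" where
  "im_ad_part L X = (THE A. A \<in> im_ad L \<and> X - A \<in> ker_ad L)"

(* The metric as a form on the tangent vectors V = [L, X], W = [L, Y] themselves; it does not
   depend on the choice of X and Y, see normal_metric_ad below. *)
definition normal_metric ::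
    "complex^'n^'n \<Rightarrow> complex^'n^'n \<Rightarrow> complex^'n^'n \<Rightarrow> real" where
  "normal_metric L V W =
     (THE r. \<forall>X\<in>unitary_algebra. \<forall>Y\<in>unitary_algebra. ad L X = V \<longrightarrow> ad L Y = W \<longrightarrow>
        r = - Re (kappa (im_ad_part L X) (im_ad_part L Y)))"

(* S restricts on the subspace T to the positive square root of P with respect to the
   inner product B on T. *)
definition is_pos_sqrt ::
    "'a::real_vector set \<Rightarrow> ('a \<Rightarrow> 'a \<Rightarrow> real) \<Rightarrow> ('a \<Rightarrow> 'a) \<Rightarrow> ('a \<Rightarrow> 'a) \<Rightarrow> bool" where
  "is_pos_sqrt T B P S \<longleftrightarrow>
     linear S \<and>
     (\<forall>V\<in>T. S V \<in> T \<and> S (S V) = P V) \<and>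
     (\<forall>V\<in>T. \<forall>W\<in>T. B (S V) W = B V (S W)) \<and>
     (\<forall>V\<in>T. 0 \<le> B (S V) V)"

(* Only the values on im_ad L, where the positive square root is unique, matter. *)
definition sqrt_neg_ad_sq :: "complex^'n^'n \<Rightarrow> complex^'n^'n \<Rightarrow> complex^'n^'n" where
  "sqrt_neg_ad_sq L =
     (SOME S. is_pos_sqrt (im_ad L) (normal_metric L) (\<lambda>V. - ad L (ad L V)) S)"

definition kaehler_metric ::
    "complex^'n^'n \<Rightarrow> complex^'n^'n \<Rightarrow> complex^'n^'n \<Rightarrow> real" where
  "kaehler_metric L V W = normal_metric L (sqrt_neg_ad_sq L V) W"


section \<open>Gradient flows\<close>

definition is_kaehler_gradient ::
    "(complex^'n^'n \<Rightarrow> real) \<Rightarrow> complex^'n^'n \<Rightarrow> complex^'n^'n \<Rightarrow> bool" where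
  "is_kaehler_gradient H L V \<longleftrightarrow>
     V \<in> im_ad L \<and>
     (\<forall>W\<in>im_ad L. kaehler_metric L V W = frechet_derivative H (at L) W)"

definition kaehler_gradient_flow_line ::
    "real^'n \<Rightarrow> complex^'n^'n \<Rightarrow> (real \<Rightarrow> complex^'n^'n) \<Rightarrow> bool" where
  "kaehler_gradient_flow_line lam N L \<longleftrightarrow>
     (\<forall>t. L t \<in> orbit lam) \<and>
     (\<forall>t. \<exists>V. is_kaehler_gradient (\<lambda>M. Re (kappa M N)) (L t) V \<and>
              (L has_vector_derivative V) (at t))"

(* A flow is given by the set of its trajectories, each defined for all real times. *)

definition weakly_preserves_positivity ::
    "real^'n::{finite,linorder} \<Rightarrow>
     ((real \<Rightarrow> complex^'n::{finite,linorder}^'n::{finite,linorder}) \<Rightarrow> bool) \<Rightarrow> bool" where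
  "weakly_preserves_positivity lam flow_line \<longleftrightarrow>
     (\<forall>L. flow_line L \<longrightarrow> L 0 \<in> orbit_nonneg lam \<longrightarrow> (\<forall>t\<ge>0. L t \<in> orbit_nonneg lam))"

definition strictly_preserves_positivity ::
    "real^'n::{finite,linorder} \<Rightarrow>
     ((real \<Rightarrow> complex^'n::{finite,linorder}^'n::{finite,linorder}) \<Rightarrow> bool) \<Rightarrow> bool" where
  "strictly_preserves_positivity lam flow_line \<longleftrightarrow>
     (\<forall>L. flow_line L \<longrightarrow> L 0 \<in> orbit_nonneg lam \<longrightarrow> (\<forall>t>0. L t \<in> orbit_pos lam))"


section \<open>Well-definedness\<close>

lemma diff_matrix_mult: "(A - B) ** C = A ** C - B ** (C::complex^'n^'n)"
  and mult_matrix_diff: "C ** (A - B) = C ** A - C ** (B::complex^'n^'n)"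
  by (simp_all add: matrix_matrix_mult_def Finite_Cartesian_Product.vec_eq_iff algebra_simps
      sum_subtractf)

lemma unitary_algebra_entry:
  "X \<in> unitary_algebra \<longleftrightarrow> (\<forall>i j. cnj (X $ j $ i) = - X $ i $ j)"
  by (simp add: unitary_algebra_def conj_transpose_def Finite_Cartesian_Product.vec_eq_iff)

lemma subspace_unitary_algebra: "subspace (unitary_algebra :: (complex^'n^'n) set)"
  by (auto simp: subspace_def unitary_algebra_entry)

lemma linear_ad: "linear (ad L)"
  unfolding ad_def
  by (rule linearI)
    (auto simp: matrix_matrix_mult_def Finite_Cartesian_Product.vec_eq_iff sum.distrib sum_subtractf scaleR_sum_right
      algebra_simps)

lemma unitary_algebra_inner:
  assumes "Y \<in> unitary_algebra"
  shows "X \<bullet> Y = - Re (trace (X ** Y))"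
proof -
  have "X \<bullet> Y = (\<Sum>i\<in>UNIV. \<Sum>j\<in>UNIV. Re (X $ i $ j * cnj (Y $ i $ j)))"
    by (simp add: inner_vec_def inner_complex_def)
  also have "\<dots> = (\<Sum>i\<in>UNIV. \<Sum>j\<in>UNIV. - Re (X $ i $ j * Y $ j $ i))"
  proof (intro sum.cong refl)
    fix i j
    have "cnj (Y $ i $ j) = - Y $ j $ i" using assms by (simp add: unitary_algebra_entry)
    thus "Re (X $ i $ j * cnj (Y $ i $ j)) = - Re (X $ i $ j * Y $ j $ i)" by simp
  qed
  also have "\<dots> = - Re (trace (X ** Y))"
    by (simp add: trace_def matrix_matrix_mult_def sum_negf del: times_complex.sel)
  finally show ?thesis .
qed

lemma ad_in_unitary_algebra:
  assumes L: "L \<in> unitary_algebra" and X: "X \<in> unitary_algebra"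
  shows "ad L X \<in> unitary_algebra"
proof -
  have "cnj (ad L X $ j $ i) = - ad L X $ i $ j" for i j
  proof -
    have "cnj (L $ j $ k) * cnj (X $ k $ i) = X $ i $ k * L $ k $ j"
      and "cnj (X $ j $ k) * cnj (L $ k $ i) = L $ i $ k * X $ k $ j" for k
      using L X by (simp_all add: unitary_algebra_entry)
    thus ?thesis by (simp add: ad_def matrix_matrix_mult_def)
  qed
  thus ?thesis by (simp add: unitary_algebra_entry)
qed

lemma inner_ad:
  assumes L: "L \<in> unitary_algebra" and X: "X \<in> unitary_algebra" and Y: "Y \<in> unitary_algebra"
  shows "ad L X \<bullet> Y = - (X \<bullet> ad L Y)"
proof -
  have "trace (ad L X ** Y) = trace (L ** X ** Y) - trace (X ** L ** Y)"
    by (simp add: ad_def diff_matrix_mult trace_sub)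
  also have "trace (L ** X ** Y) = trace (X ** Y ** L)"
    by (metis matrix_mul_assoc trace_mul_sym)
  finally have "trace (ad L X ** Y) = - trace (X ** ad L Y)"
    by (simp add: ad_def mult_matrix_diff trace_sub matrix_mul_assoc)
  thus ?thesis
    by (simp add: unitary_algebra_inner Y ad_in_unitary_algebra[OF L Y])
qed

lemma subspace_im_ad: "subspace (im_ad L)"
  unfolding im_ad_def by (rule linear_subspace_image[OF linear_ad subspace_unitary_algebra])

lemma im_ad_ker_ad_orthogonal:
  assumes L: "L \<in> unitary_algebra" and "A \<in> im_ad L" "B \<in> ker_ad L"
  shows "A \<bullet> B = 0"
  using assms inner_ad[OF L] by (auto simp: im_ad_def ker_ad_def)

lemma ex1_im_ad_part:
  assumes L: "L \<in> unitary_algebra" and X: "X \<in> unitary_algebra"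
  shows "\<exists>!A. A \<in> im_ad L \<and> X - A \<in> ker_ad L"
proof -
  obtain y z where y: "y \<in> span (im_ad L)"
    and z: "\<And>w. w \<in> span (im_ad L) \<Longrightarrow> Linear_Algebra.orthogonal z w" and Xyz: "X = y + z"
    using orthogonal_subspace_decomp_exists by blast
  have y': "y \<in> im_ad L" using y subspace_im_ad by (metis span_eq_iff)
  have yu: "y \<in> unitary_algebra"
    using y' ad_in_unitary_algebra[OF L] by (auto simp: im_ad_def)
  have zu: "z \<in> unitary_algebra"
    using subspace_diff[OF subspace_unitary_algebra X yu] Xyz by simp
  have "ad L (ad L z) \<in> span (im_ad L)"
    using ad_in_unitary_algebra[OF L zu] by (auto intro!: span_base simp: im_ad_def)
  hence "ad L z \<bullet> ad L z = 0"
    using z inner_ad[OF L zu ad_in_unitary_algebra[OF L zu]] by (simp add: Linear_Algebra.orthogonal_def)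
  hence "z \<in> ker_ad L" using zu by (simp add: ker_ad_def)
  hence ex: "y \<in> im_ad L \<and> X - y \<in> ker_ad L" using y' Xyz by simp
  show ?thesis
  proof (rule ex1I[where a = y], rule ex)
    fix A assume A: "A \<in> im_ad L \<and> X - A \<in> ker_ad L"
    have im: "A - y \<in> im_ad L" using A y' subspace_im_ad subspace_diff by blast
    have "(A - y) \<bullet> (X - y) = 0" "(A - y) \<bullet> (X - A) = 0"
      using im_ad_ker_ad_orthogonal[OF L im] A ex by auto
    hence "(A - y) \<bullet> (A - y) = 0" by (simp add: inner_diff_right)
    thus "A = y" by simp
  qed
qed

lemma im_ad_part_cong:
  assumes L: "L \<in> unitary_algebra" and X: "X \<in> unitary_algebra" and X': "X' \<in> unitary_algebra"
    and eq: "ad L X = ad L X'"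
  shows "im_ad_part L X = im_ad_part L X'"
proof -
  have "X - A \<in> ker_ad L \<longleftrightarrow> X' - A \<in> ker_ad L" if "A \<in> im_ad L" for A
  proof -
    have "A \<in> unitary_algebra" using that ad_in_unitary_algebra[OF L] by (auto simp: im_ad_def)
    thus ?thesis
      using X X' eq subspace_diff[OF subspace_unitary_algebra]
      by (auto simp: ker_ad_def linear_diff[OF linear_ad])
  qed
  thus ?thesis unfolding im_ad_part_def by (metis (mono_tags, lifting))
qed

lemma kappa_in_Reals:
  assumes X: "X \<in> unitary_algebra" and Y: "Y \<in> unitary_algebra"
  shows "kappa X Y \<in> \<real>"
proof -
  have tr: "cnj (trace Z) = - trace Z" if "Z \<in> unitary_algebra" for Z :: "complex^'n^'n"
    using that by (simp add: trace_def unitary_algebra_entry sum_negf)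
  have "cnj (trace (X ** Y)) = trace (Y ** X)"
  proof -
    have "cnj (X $ i $ k) * cnj (Y $ k $ i) = X $ k $ i * Y $ i $ k" for i k
      using X Y by (simp add: unitary_algebra_entry)
    thus ?thesis by (simp add: trace_def matrix_matrix_mult_def mult.commute)
  qed
  hence "cnj (kappa X Y) = kappa X Y"
    by (simp add: kappa_def tr X Y trace_mul_sym[of Y X])
  thus ?thesis by (simp add: Reals_cnj_iff)
qed

lemma normal_metric_ad:
  assumes L: "L \<in> unitary_algebra" and X: "X \<in> unitary_algebra" and Y: "Y \<in> unitary_algebra"
  shows "normal_metric L (ad L X) (ad L Y) = - Re (kappa (im_ad_part L X) (im_ad_part L Y))"
  unfolding normal_metric_def
proof (rule the_equality)
  show "\<forall>X'\<in>unitary_algebra. \<forall>Y'\<in>unitary_algebra. ad L X' = ad L X \<longrightarrow> ad L Y' = ad L Y \<longrightarrow>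
      - Re (kappa (im_ad_part L X) (im_ad_part L Y)) =
      - Re (kappa (im_ad_part L X') (im_ad_part L Y'))"
    using im_ad_part_cong[OF L _ X] im_ad_part_cong[OF L _ Y] by simp
qed (use X Y in blast)

end

theory Submission
  imports Defs
begin

text \<open>
  In an eigenbasis of \<open>L\<close> the operator \<open>ad L\<close> multiplies the entry \<open>(j, k)\<close> by \<open>\<i> (\<lambda>\<^sub>j - \<lambda>\<^sub>k)\<close>, so
  the Kaehler gradient multiplies the entries of \<open>- N\<close> by \<open>\<bar>\<lambda>\<^sub>j - \<lambda>\<^sub>k\<bar>\<close>. Consequently the flow moves
  flags by the one-parameter group \<open>exp (t \<i> N)\<close>: the trajectory through \<open>g\<close> is given by the unitary
  factor in the QR decomposition of \<open>exp (t \<i> N) g\<close>.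

  If \<open>\<i> N\<close> is tridiagonal with nonnegative off-diagonal entries, the minors of \<open>exp (t \<i> N) g\<close> solve a
  linear system with nonnegative off-diagonal coefficients, and therefore stay nonnegative; for
  positive off-diagonal entries the system is irreducible, and they become positive at once.

  Conversely, flow lines that start at coordinate flags show to first order that \<open>\<i> N\<close> has nonnegative
  entries next to the diagonal. For an entry \<open>(j, i)\<close> further away take two descents \<open>k < k'\<close> of
  \<open>\<lambda>\<close>. On totally nonnegative flags the incidence relation between the minors of orders \<open>k\<close> and
  \<open>k'\<close>, an alternating sum, has partial sums of alternating signs. At a suitable coordinate flag the
  partial sums cut off at \<open>i\<close> and at its successor are equal to first order, up to sign, to the entry
  \<open>(j, i)\<close>, which must therefore vanish.
\<close>

section \<open>Pluecker relations for left-justified minors\<close>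

text \<open>One descent of \<open>lam\<close> would not suffice. If the only descent is at 1, an
  orbit point determines the coordinates of one vector up to a factor, and any hermitian matrix with
  nonnegative off-diagonal entries generates a flow that keeps such vectors nonnegative. Only the
  incidence between two orders of minors excludes entries far from the diagonal. A unitary
  representative of an orbit point is never unique, since at least phases are free, so the flow is
  not studied by differentiating representatives. Two points \<open>adj_act lam g\<close> and
  \<open>adj_act lam h\<close> are compared in a mixed frame instead, with
  \<open>conj_transpose g\<close> on the left of their difference and \<open>h\<close> on the right.
  This gives the commutator of the diagonal matrix with \<open>conj_transpose g ** h\<close>. Both
  the uniqueness of flow lines and the derivative of the QR flow rest on it. The nonnegative part of
  the orbit is a closure. By compactness its points lift to \<open>closure unitary_pos\<close>,
  where inequalities between positive minors persist.\<close>

lemma insort_eq_take_drop: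
  fixes r :: "'a::linorder"
  assumes "sorted_wrt (<) ys" "r \<notin> set ys"
  shows "insort r ys = take (card {s\<in>set ys. s < r}) ys @ r # drop (card {s\<in>set ys. s < r}) ys"
  using assms
proof (induction ys)
  case (Cons y ys)
  show ?case
  proof (cases "r < y")
    case True
    then have "{s\<in>set (y # ys). s < r} = {}" using Cons.prems by force
    then have "card {s\<in>set (y # ys). s < r} = 0" by (metis card.empty)
    then show ?thesis unfolding \<open>card _ = 0\<close> using True by (simp add: less_imp_le)
  next
    case False
    then have "y < r" using Cons.prems by auto
    then have "{s\<in>set (y # ys). s < r} = insert y {s\<in>set ys. s < r}" by auto
    moreover have "y \<notin> {s\<in>set ys. s < r}" using Cons.prems by auto
    ultimately have "card {s\<in>set (y # ys). s < r} = Suc (card {s\<in>set ys. s < r})" by simp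
    then show ?thesis using Cons \<open>y < r\<close> by simp
  qed
qed simp

text \<open>The shift \<open>if i < p then i else Suc i\<close> is the one of
  \<open>mat_delete\<close>. It identifies the submatrix left by deleting the row of
  \<open>r\<close> in a Laplace expansion as the one with rows \<open>S\<close>.\<close>

lemma sorted_list_of_set_insert_nth:
  fixes r :: "'a::linorder"
  assumes "finite S" "r \<notin> S"
  defines "p \<equiv> card {s\<in>S. s < r}"
  shows "p \<le> card S"
    and "sorted_list_of_set (insert r S) ! p = r"
    and "i < card S \<Longrightarrow> sorted_list_of_set S ! i =
           sorted_list_of_set (insert r S) ! (if i < p then i else Suc i)"
proof -
  let ?l = "sorted_list_of_set S"
  show p: "p \<le> card S" unfolding p_def using assms(1) by (intro card_mono) auto
  have "sorted_list_of_set (insert r S) = insort r ?l" using assms by simp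
  also have "\<dots> = take p ?l @ r # drop p ?l"
    using insort_eq_take_drop[of ?l r] assms by (simp add: strict_sorted_list_of_set)
  finally have eq: "sorted_list_of_set (insert r S) = take p ?l @ r # drop p ?l" .
  show "sorted_list_of_set (insert r S) ! p = r"
    unfolding eq using p by (simp add: nth_append)
  show "sorted_list_of_set S ! i =
      sorted_list_of_set (insert r S) ! (if i < p then i else Suc i)" if "i < card S"
    unfolding eq using p that by (auto simp: nth_append)
qed

text \<open>The rows form a list and not a set because differentiating a minor replaces a row in
  place, which may leave the list unsorted or with a repetition. The columns are always the first
  ones, so numbers index them.\<close>

definition rdet :: "('i \<Rightarrow> nat \<Rightarrow> 'a::comm_ring_1) \<Rightarrow> 'i list \<Rightarrow> 'a" where
  "rdet G xs = Determinant.det (Matrix.mat (length xs) (length xs) (\<lambda>(a, b). G (xs ! a) b))"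

abbreviation sdet :: "('i::linorder \<Rightarrow> nat \<Rightarrow> 'a::comm_ring_1) \<Rightarrow> 'i set \<Rightarrow> 'a" where
  "sdet G X \<equiv> rdet G (sorted_list_of_set X)"

lemma rdet_not_distinct:
  assumes "\<not> distinct xs"
  shows "rdet G xs = 0"
proof -
  obtain a b where "a < length xs" "b < length xs" "a \<noteq> b" "xs ! a = xs ! b"
    using assms distinct_conv_nth by blast
  then show ?thesis unfolding rdet_def
    by (intro det_identical_rows[of _ "length xs" a b]) (auto intro!: eq_vecI)
qed

text \<open>Laplace expansion along the row of \<open>r\<close>, put in front of the rows
  \<open>S\<close>: the cofactors \<open>c\<close> involve only \<open>S\<close>, so one linear
  functional of the row \<open>G r\<close> serves all \<open>r\<close>. For \<open>r\<close> in
  \<open>S\<close> two rows coincide. Otherwise the sign counts the rows that \<open>r\<close> has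
  to pass to reach its sorted position.\<close>

lemma sdet_insert_linear:
  fixes G :: "'i::linorder \<Rightarrow> nat \<Rightarrow> 'a::comm_ring_1"
  assumes S: "finite S"
  shows "\<exists>c. (\<forall>r\<in>S. (\<Sum>b\<le>card S. G r b * c b) = 0) \<and>
    (\<forall>r. r \<notin> S \<longrightarrow>
      (\<Sum>b\<le>card S. G r b * c b) = (-1) ^ card {s\<in>S. s < r} * sdet G (insert r S))"
proof -
  let ?k = "card S" and ?l = "sorted_list_of_set S"
  define c where "c b = (-1) ^ b * Determinant.det (Matrix.mat ?k ?k
      (\<lambda>(a, j). G (?l ! a) (if j < b then j else Suc j)))" for b
  have expand: "(\<Sum>b\<le>?k. G (xs ! p) b * c b) = (-1) ^ p * rdet G xs"
    if xs: "length xs = Suc ?k" "p \<le> ?k"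
      and nth: "\<And>i. i < ?k \<Longrightarrow> ?l ! i = xs ! (if i < p then i else Suc i)" for xs p
  proof -
    let ?A = "Matrix.mat (Suc ?k) (Suc ?k) (\<lambda>(a, b). G (xs ! a) b)"
    have "cofactor ?A p b = (-1) ^ p * c b" if "b < Suc ?k" for b
    proof -
      have "mat_delete ?A p b = Matrix.mat ?k ?k
          (\<lambda>(a, j). G (?l ! a) (if j < b then j else Suc j))"
        unfolding mat_delete_def using that xs(2) nth by (intro eq_matI) auto
      then show ?thesis by (simp add: cofactor_def c_def power_add)
    qed
    moreover have "rdet G xs = (\<Sum>b<Suc ?k. ?A $$ (p, b) * cofactor ?A p b)"
      unfolding rdet_def xs(1) using xs(2) by (intro laplace_expansion_row) auto
    ultimately have "rdet G xs = (-1) ^ p * (\<Sum>b<Suc ?k. G (xs ! p) b * c b)"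
      using xs(2) by (simp add: sum_distrib_left mult.left_commute del: sum.lessThan_Suc)
    then show ?thesis by (simp add: lessThan_Suc_atMost del: sum.lessThan_Suc)
  qed
  show ?thesis
  proof (intro exI[of _ c] conjI ballI allI impI)
    fix r assume "r \<in> S"
    then have "\<not> distinct (r # ?l)" using S by simp
    then have "rdet G (r # ?l) = 0" by (rule rdet_not_distinct)
    with expand[of "r # ?l" 0] show "(\<Sum>b\<le>card S. G r b * c b) = 0" using S by simp
  next
    fix r assume r: "r \<notin> S"
    then show "(\<Sum>b\<le>card S. G r b * c b) = (-1) ^ card {s\<in>S. s < r} * sdet G (insert r S)"
      using expand[of "sorted_list_of_set (insert r S)" "card {s\<in>S. s < r}"]
        sorted_list_of_set_insert_nth[OF S r] S
      by simp
  qed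
qed

text \<open>Border the rows \<open>S \<union> C\<close> of the first \<open>m\<close> columns by the
  column \<open>\<phi>\<close>, the functional of \<open>sdet_insert_linear\<close>. Since
  \<open>card S < m\<close>, this column is a combination of earlier ones and the determinant is 0.
  Expanding along it gives the relation, because \<open>\<phi>\<close> vanishes on
  \<open>S\<close>.\<close>

lemma pluecker:
  fixes G :: "'i::linorder \<Rightarrow> nat \<Rightarrow> 'a::comm_ring_1"
  assumes S: "finite S" and C: "finite C" "S \<inter> C = {}" "2 \<le> card C"
  shows "(\<Sum>y\<in>C. (-1) ^ card {z\<in>C. z < y} * sdet G (insert y S) * sdet G (S \<union> C - {y})) = 0"
proof -
  obtain c where c0: "\<And>r. r \<in> S \<Longrightarrow> (\<Sum>b\<le>card S. G r b * c b) = 0"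
    and c1: "\<And>r. r \<notin> S \<Longrightarrow>
      (\<Sum>b\<le>card S. G r b * c b) = (-1) ^ card {s\<in>S. s < r} * sdet G (insert r S)"
    using sdet_insert_linear[OF S, of G] by blast
  define Y where "Y = S \<union> C"
  define ys where "ys = sorted_list_of_set Y"
  define m where "m = card Y - 1"
  have Y: "finite Y" "card Y = card S + card C" using S C by (auto simp: Y_def card_Un_disjoint)
  have m: "card Y = Suc m" "card S < m" using Y(2) C(3) by (auto simp: m_def)
  have len: "length ys = Suc m" and set: "set ys = Y" "distinct ys" using Y m by (auto simp: ys_def)
  define \<phi> where "\<phi> r = (\<Sum>b\<le>card S. G r b * c b)" for r
  define A where "A f = Matrix.mat (Suc m) (Suc m)
      (\<lambda>(a, b). if b = m then f (ys ! a) else G (ys ! a) b)" for f :: "'i \<Rightarrow> 'a"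
  have cof: "cofactor (A f) (card {z\<in>Y. z < y}) m =
      (-1) ^ (card {z\<in>Y. z < y} + m) * sdet G (Y - {y})" if y: "y \<in> Y" for f y
  proof -
    let ?p = "card {z\<in>Y - {y}. z < y}"
    have p: "?p = card {z\<in>Y. z < y}" by (rule arg_cong[where f = card]) auto
    have l: "card (Y - {y}) = m" and i: "insert y (Y - {y}) = Y" using y Y m by auto
    have nth: "ys ! (if a < ?p then a else Suc a) = sorted_list_of_set (Y - {y}) ! a"
      if "a < m" for a
      using sorted_list_of_set_insert_nth(3)[of "Y - {y}" y, unfolded i l, OF _ _ that] Y
      by (simp add: ys_def)
    have "mat_delete (A f) ?p m = Matrix.mat m m (\<lambda>(a, b). G (sorted_list_of_set (Y - {y}) ! a) b)"
      unfolding mat_delete_def A_def by (intro eq_matI) (auto simp flip: nth)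
    then show ?thesis using l Y unfolding p by (simp add: cofactor_def rdet_def)
  qed
  have reindex: "(\<Sum>a<Suc m. h a (ys ! a)) = (\<Sum>y\<in>Y. h (card {z\<in>Y. z < y}) y)"
    for h :: "nat \<Rightarrow> 'i \<Rightarrow> 'a"
  proof (rule sum.reindex_bij_witness[where i = "\<lambda>y. card {z\<in>Y. z < y}" and j = "\<lambda>a. ys ! a"])
    fix y assume y: "y \<in> Y"
    let ?p = "card {z\<in>Y - {y}. z < y}"
    have p: "?p = card {z\<in>Y. z < y}" by (rule arg_cong[where f = card]) auto
    have i: "insert y (Y - {y}) = Y" using y by auto
    note idx = sorted_list_of_set_insert_nth[of "Y - {y}" y, unfolded i, folded ys_def]
    show *: "ys ! card {z\<in>Y. z < y} = y" using idx(2) Y p by simp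
    show "card {z\<in>Y. z < y} \<in> {..<Suc m}"
      using idx(1) Y p y m by simp
  next
    fix a assume a: "a \<in> {..<Suc m}"
    then show "ys ! a \<in> Y" using len set by auto
    let ?y = "ys ! a"
    let ?p = "card {z\<in>Y - {?y}. z < ?y}"
    have p: "?p = card {z\<in>Y. z < ?y}" by (rule arg_cong[where f = card]) auto
    have y: "?y \<in> Y" using len set a by auto
    then have i: "insert ?y (Y - {?y}) = Y" by auto
    note idx = sorted_list_of_set_insert_nth[of "Y - {?y}" ?y, unfolded i, folded ys_def]
    have "ys ! card {z\<in>Y. z < ?y} = ?y" "card {z\<in>Y. z < ?y} < Suc m"
      using idx(1,2) Y p y m by auto
    then show "card {z\<in>Y. z < ?y} = a" 
      using nth_eq_iff_index_eq[OF set(2)] len a by (metis lessThan_iff)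
    then show "h (card {z\<in>Y. z < ?y}) ?y = h a ?y" by simp
  qed
  have expand: "Determinant.det (A f) =
      (\<Sum>y\<in>Y. f y * ((-1) ^ (card {z\<in>Y. z < y} + m) * sdet G (Y - {y})))" for f
  proof -
    have "Determinant.det (A f) = (\<Sum>a<Suc m. A f $$ (a, m) * cofactor (A f) a m)"
      by (rule laplace_expansion_column) (auto simp: A_def)
    also have "\<dots> = (\<Sum>a<Suc m. f (ys ! a) * cofactor (A f) a m)"
      by (intro sum.cong) (auto simp: A_def)
    also have "\<dots> = (\<Sum>y\<in>Y. f y * cofactor (A f) (card {z\<in>Y. z < y}) m)"
      by (rule reindex)
    finally show ?thesis by (simp add: cof)
  qed
  have "(\<Sum>y\<in>Y. \<phi> y * ((-1) ^ (card {z\<in>Y. z < y} + m) * sdet G (Y - {y}))) =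
      (\<Sum>b\<le>card S. c b * Determinant.det (A (\<lambda>r. G r b)))"
    unfolding expand \<phi>_def sum_distrib_left sum_distrib_right
    by (subst sum.swap) (simp add: mult_ac)
  also have "\<dots> = 0"
  proof (intro sum.neutral ballI)
    fix b assume "b \<in> {..card S}"
    then have "b < m" using m by simp
    then have "Determinant.det (A (\<lambda>r. G r b)) = 0"
      by (intro det_identical_columns[of _ "Suc m" b m]) (auto simp: A_def intro!: eq_vecI)
    then show "c b * Determinant.det (A (\<lambda>r. G r b)) = 0" by simp
  qed
  finally have "(\<Sum>y\<in>Y. \<phi> y * ((-1) ^ (card {z\<in>Y. z < y} + m) * sdet G (Y - {y}))) = 0" .
  moreover have "(\<Sum>y\<in>Y. \<phi> y * ((-1) ^ (card {z\<in>Y. z < y} + m) * sdet G (Y - {y}))) =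
      (\<Sum>y\<in>C. \<phi> y * ((-1) ^ (card {z\<in>Y. z < y} + m) * sdet G (Y - {y})))"
    using Y by (intro sum.mono_neutral_right) (auto simp: Y_def \<phi>_def c0)
  moreover have "\<phi> y * ((-1) ^ (card {z\<in>Y. z < y} + m) * sdet G (Y - {y})) =
      (-1) ^ m * ((-1) ^ card {z\<in>C. z < y} * sdet G (insert y S) * sdet G (S \<union> C - {y}))"
    if y: "y \<in> C" for y
  proof -
    \<comment> \<open>The cofactor sign counts the elements of \<open>Y\<close> below
      \<open>y\<close>. Those in \<open>S\<close> cancel against the sign in \<open>c1\<close>, and
      the count within \<open>C\<close> remains.\<close>
    have "{z\<in>Y. z < y} = {s\<in>S. s < y} \<union> {z\<in>C. z < y}" by (auto simp: Y_def)
    then have "card {z\<in>Y. z < y} = card {s\<in>S. s < y} + card {z\<in>C. z < y}"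
      using S C by (simp add: card_Un_disjoint disjoint_iff)
    moreover have "\<phi> y = (-1) ^ card {s\<in>S. s < y} * sdet G (insert y S)"
      using y C by (auto simp: \<phi>_def intro!: c1)
    ultimately show ?thesis by (simp add: power_add Y_def mult_ac)
  qed
  ultimately have "(-1) ^ m * (\<Sum>y\<in>C. (-1) ^ card {z\<in>C. z < y} * sdet G (insert y S) *
      sdet G (S \<union> C - {y})) = 0" (is "_ * ?x = 0")
    by (simp add: sum_distrib_left)
  then have "(-1) ^ m * ((-1) ^ m * ?x) = 0" by (simp only: mult_zero_right)
  then show ?thesis by (simp only: left_minus_one_mult_self)
qed

text \<open>The alternating sum of a Pluecker relation, cut off after the indices \<open>\<le> x\<close>, has a definite
  sign. Induction on \<open>C\<close>: for \<open>a = Min C \<le> x < b = Max C\<close> the three-term relations for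
  \<open>a < y < b\<close> express the cut-off sum of \<open>C\<close> through those of \<open>C - {a}\<close> and \<open>C - {b}\<close>.\<close>

lemma truncated_pluecker_sign:
  fixes d :: "'i::{finite,linorder} set \<Rightarrow> real" and x :: 'i
  assumes rel: "\<And>S C. S \<inter> C = {} \<Longrightarrow> 2 \<le> card C \<Longrightarrow>
      (\<Sum>y\<in>C. (-1) ^ card {z\<in>C. z < y} * d (insert y S) * d (S \<union> C - {y})) = 0"
    and pos: "\<And>X. 0 < d X"
    and "S \<inter> C = {}" "2 \<le> card C" "C \<inter> {..x} \<noteq> {}"
  defines "T \<equiv> \<lambda>C. \<Sum>y\<in>C \<inter> {..x}. (-1) ^ card {z\<in>C. z < y} * d (insert y S) * d (S \<union> C - {y})"
  shows "0 \<le> - ((-1) ^ card (C \<inter> {..x})) * T C"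
  using assms(3-5)
proof (induction "card C" arbitrary: C rule: less_induct)
  case less
  note C = less.prems
  show ?case
  proof (cases "C \<subseteq> {..x}")
    case True
    then have "C \<inter> {..x} = C" by auto
    then show ?thesis using rel[OF C(1,2)] by (simp add: T_def)
  next
    case False
    define a where "a = Min C"
    define b where "b = Max C"
    have ne: "C \<noteq> {}" "finite C" using C by auto
    have ab: "a \<in> C" "b \<in> C" "\<And>y. y \<in> C \<Longrightarrow> a \<le> y" "\<And>y. y \<in> C \<Longrightarrow> y \<le> b"
      using ne by (auto simp: a_def b_def)
    have ax: "a \<le> x" using C(3) ab(3) by fastforce
    have xb: "x < b" using False ab(4) by fastforce
    have aS: "a \<notin> S" "b \<notin> S" using ab C(1) by auto
    have Ca: "C \<inter> {..x} = insert a ((C - {a}) \<inter> {..x})" using ab ax by auto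
    have Cb: "(C - {b}) \<inter> {..x} = C \<inter> {..x}" using xb by auto
    have pa: "card (C \<inter> {..x}) = Suc (card ((C - {a}) \<inter> {..x}))"
      unfolding Ca by (subst card_insert_disjoint) auto
    have Ta: "(-1) ^ card {z\<in>C. z < a} = (1::real)"
    proof -
      have "{z\<in>C. z < a} = {}" using ab by force
      then show ?thesis by (metis card.empty power_0)
    qed
    show ?thesis
    proof (cases "card C = 2")
      case True
      have "C = {a, b}" using True ab ax xb
        by (metis card_2_iff insertE insert_commute less_irrefl order_le_less_trans singletonD)
      then have *: "C \<inter> {..x} = {a}" using ax xb by auto
      show ?thesis unfolding T_def * using pos[of "insert a S"] pos[of "S \<union> C - {a}"]
        by (simp add: Ta)
    next
      case False
      let ?Y = "S \<union> C"
      \<comment> \<open>After multiplication by \<open>d (?Y - {a, b})\<close> the relation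
        \<open>three\<close> splits every summand with \<open>y \<noteq> a\<close>; the summand for
        \<open>a\<close> already belongs to \<open>T (C - {b})\<close>. Removing \<open>b\<close>,
        which lies beyond the cut-off, keeps all signs, whereas removing the minimum
        \<open>a\<close> flips them, hence the minus.\<close>
      have id: "T C * d (?Y - {a, b}) = T (C - {b}) * d (?Y - {a}) - T (C - {a}) * d (?Y - {b})"
      proof -
        let ?f = "\<lambda>y. (-1) ^ card {z\<in>C. z < y} * d (insert y S)"
        have three: "d (?Y - {y}) * d (?Y - {a, b}) =
            d (?Y - {a}) * d (?Y - {b} - {y}) + d (?Y - {b}) * d (?Y - {a} - {y})"
          if y: "y \<in> (C - {a}) \<inter> {..x}" for y
        proof -
          have o: "a < y" "y < b" "a < b" using y ab(3)[of y] xb by auto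
          have neq: "a \<noteq> y" "y \<noteq> b" "a \<noteq> b" using o by auto
          then have card: "card {a, y, b} = 3" by simp
          have sum3: "sum h {a, y, b} = h a + h y + h b" for h :: "'i \<Rightarrow> real"
            using neq by simp
          have below: "{z\<in>{a, y, b}. z < a} = {}" "{z\<in>{a, y, b}. z < y} = {a}"
            "{z\<in>{a, y, b}. z < b} = {a, y}" and "card {a, y} = 2" using o by auto
          have sets: "?Y - {a, y, b} \<union> {a, y, b} = ?Y"
            "insert a (?Y - {a, y, b}) = ?Y - {b} - {y}"
            "insert b (?Y - {a, y, b}) = ?Y - {a} - {y}"
            "insert y (?Y - {a, y, b}) = ?Y - {a, b}" using o y ab by auto
          have "(\<Sum>u\<in>{a, y, b}. (-1) ^ card {z\<in>{a, y, b}. z < u} *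
              d (insert u (?Y - {a, y, b})) * d (?Y - {a, y, b} \<union> {a, y, b} - {u})) = 0"
            using o card by (intro rel) auto
          from this[unfolded sum3 below sets \<open>card {a, y} = 2\<close>]
          show ?thesis by (simp add: mult.commute)
        qed
        have Tb: "T (C - {b}) = (\<Sum>y\<in>C \<inter> {..x}. ?f y * d (?Y - {b} - {y}))"
          unfolding T_def Cb
        proof (rule sum.cong)
          fix y assume y: "y \<in> C \<inter> {..x}"
          then have "{z \<in> C - {b}. z < y} = {z\<in>C. z < y}" using xb by auto
          moreover have "S \<union> (C - {b}) - {y} = ?Y - {b} - {y}" using aS by auto
          ultimately show "(-1) ^ card {z \<in> C - {b}. z < y} * d (insert y S) *
              d (S \<union> (C - {b}) - {y}) = ?f y * d (?Y - {b} - {y})" by simp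
        qed simp
        have Ta': "T (C - {a}) = - (\<Sum>y\<in>(C - {a}) \<inter> {..x}. ?f y * d (?Y - {a} - {y}))"
          unfolding T_def sum_negf[symmetric]
        proof (rule sum.cong)
          fix y assume y: "y \<in> (C - {a}) \<inter> {..x}"
          then have "a < y" using ab(3)[of y] by auto
          then have "{z\<in>C. z < y} = insert a {z \<in> C - {a}. z < y}" using ab by auto
          then have "card {z\<in>C. z < y} = Suc (card {z \<in> C - {a}. z < y})" by simp
          moreover have "S \<union> (C - {a}) - {y} = ?Y - {a} - {y}" using aS by auto
          ultimately show "(-1) ^ card {z \<in> C - {a}. z < y} * d (insert y S) *
              d (S \<union> (C - {a}) - {y}) = - (?f y * d (?Y - {a} - {y}))" by simp
        qed simp
        have "T C * d (?Y - {a, b}) = ?f a * d (?Y - {a}) * d (?Y - {a, b}) +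
            (\<Sum>y\<in>(C - {a}) \<inter> {..x}. ?f y * d (?Y - {y})) * d (?Y - {a, b})"
          unfolding T_def Ca by (subst sum.insert) (auto simp: algebra_simps)
        also have "\<dots> = ?f a * d (?Y - {b} - {a}) * d (?Y - {a}) +
            (\<Sum>y\<in>(C - {a}) \<inter> {..x}. ?f y * (d (?Y - {a}) * d (?Y - {b} - {y}) +
                d (?Y - {b}) * d (?Y - {a} - {y})))"
          by (simp add: sum_distrib_right three mult.assoc insert_commute Diff_insert2[symmetric]
              del: insert_Diff_single)
        also have "\<dots> = (?f a * d (?Y - {b} - {a}) +
             (\<Sum>y\<in>(C - {a}) \<inter> {..x}. ?f y * d (?Y - {b} - {y}))) * d (?Y - {a}) +
            (\<Sum>y\<in>(C - {a}) \<inter> {..x}. ?f y * d (?Y - {a} - {y})) * d (?Y - {b})"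
          by (simp add: sum_distrib_right sum_distrib_left sum.distrib algebra_simps)
        also have "?f a * d (?Y - {b} - {a}) +
             (\<Sum>y\<in>(C - {a}) \<inter> {..x}. ?f y * d (?Y - {b} - {y})) = T (C - {b})"
          unfolding Tb Ca by (subst sum.insert) auto
        finally show ?thesis by (simp add: Ta')
      qed
      let ?p = "card (C \<inter> {..x})"
      have c: "card (C - {a}) < card C" "card (C - {b}) < card C" using ab ne
        by (meson card_Diff1_less)+
      have c2: "2 \<le> card (C - {a})" "2 \<le> card (C - {b})" using ab ne C False by auto
      have 1: "0 \<le> - ((-1) ^ ?p) * T (C - {b})"
        using less.hyps[OF c(2) _ c2(2)] C unfolding Cb by blast
      have 2: "0 \<le> (-1) ^ ?p * T (C - {a})"
      proof (cases "(C - {a}) \<inter> {..x} = {}")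
        case True
        then show ?thesis by (simp add: T_def)
      next
        case False
        have "S \<inter> (C - {a}) = {}" using C by auto
        from less.hyps[OF c(1) this c2(1) False] show ?thesis unfolding pa by simp
      qed
      \<comment> \<open>Dropping \<open>a\<close> also changes the parity of the cut-off set. This
        compensates the minus in \<open>id\<close>, so both products on the right are
        nonnegative.\<close>
      have "- ((-1) ^ ?p) * T C * d (?Y - {a, b}) =
          (- ((-1) ^ ?p) * T (C - {b})) * d (?Y - {a}) + ((-1) ^ ?p * T (C - {a})) * d (?Y - {b})"
        using arg_cong[OF id, of "\<lambda>t. - ((-1) ^ ?p) * t"] by (simp add: algebra_simps)
      also have "\<dots> \<ge> 0"
        by (intro add_nonneg_nonneg mult_nonneg_nonneg 1 2 less_imp_le[OF pos])
      finally have "0 \<le> - ((-1) ^ ?p) * T C * d (?Y - {a, b})" .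
      then show ?thesis using pos[of "?Y - {a, b}"] mult_neg_pos by (meson not_le)
    qed
  qed
qed

subsection \<open>Minors of a matrix as functions of its rows\<close>

definition nth_index :: "nat \<Rightarrow> 'n::{finite,linorder}" where
  "nth_index b = sorted_list_of_set UNIV ! b"

lemma nth_index_less:
  "a < b \<Longrightarrow> b < CARD('n) \<Longrightarrow> nth_index a < (nth_index b :: 'n::{finite,linorder})"
  unfolding nth_index_def
  by (rule sorted_wrt_nth_less[OF strict_sorted_list_of_set]) simp_all

lemma nth_index_less_iff:
  "a < CARD('n) \<Longrightarrow> b < CARD('n) \<Longrightarrow>
     nth_index a < (nth_index b :: 'n::{finite,linorder}) \<longleftrightarrow> a < b"
  by (metis nth_index_less linorder_neqE_nat order_less_asym order_less_irrefl)

lemma nth_index_eq_iff: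
  "a < CARD('n) \<Longrightarrow> b < CARD('n) \<Longrightarrow>
     nth_index a = (nth_index b :: 'n::{finite,linorder}) \<longleftrightarrow> a = b"
  by (metis nth_index_less_iff linorder_neqE_nat order_less_irrefl)

lemma bij_betw_nth_index: "bij_betw nth_index {..<CARD('n)} (UNIV :: 'n::{finite,linorder} set)"
  unfolding nth_index_def by (rule bij_betw_nth) simp_all

lemma nth_index_cases:
  obtains b where "b < CARD('n)" "i = (nth_index b :: 'n::{finite,linorder})"
  using bij_betw_nth_index[where 'n='n] unfolding bij_betw_def by blast

lemma sum_nth_index:
  "(\<Sum>b<CARD('n). f (nth_index b)) = (\<Sum>i\<in>(UNIV :: 'n::{finite,linorder} set). f i)"
  by (rule sum.reindex_bij_betw[OF bij_betw_nth_index])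

lemma card_lessThan_nth_index:
  assumes "b < CARD('n)"
  shows "card {..< (nth_index b :: 'n::{finite,linorder})} = b"
proof -
  have "{..< (nth_index b :: 'n)} = nth_index ` {..<b}"
  proof (intro equalityI subsetI)
    fix i :: 'n assume "i \<in> {..<nth_index b}"
    then show "i \<in> nth_index ` {..<b}"
      by (metis assms imageI lessThan_iff nth_index_cases nth_index_less_iff)
  qed (use assms nth_index_less in auto)
  moreover have "inj_on (nth_index :: nat \<Rightarrow> 'n) {..<b}"
    using assms by (intro inj_onI) (simp add: nth_index_eq_iff)
  ultimately show ?thesis by (simp add: card_image)
qed

lemma sorted_list_of_first_indices:
  assumes "k \<le> CARD('n)"
  shows "sorted_list_of_set (first_indices k :: 'n::{finite,linorder} set) = map nth_index [0..<k]"
proof (rule sym, rule sorted_distinct_set_unique)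
  show "sorted (map nth_index [0..<k] :: 'n list)"
    using assms by (auto simp: sorted_iff_nth_mono_less nth_index_less intro: less_imp_le)
  show "distinct (map nth_index [0..<k] :: 'n list)"
    using assms by (auto simp: distinct_map inj_on_def nth_index_eq_iff)
  have "i \<in> first_indices k \<longleftrightarrow> i \<in> nth_index ` {..<k}" for i :: 'n
  proof -
    obtain b where "b < CARD('n)" "i = nth_index b" by (rule nth_index_cases)
    then show ?thesis using assms
      by (auto simp: first_indices_def card_lessThan_nth_index nth_index_eq_iff)
  qed
  then show "set (map nth_index [0..<k]) = set (sorted_list_of_set (first_indices k :: 'n set))"
    by (auto simp: atLeast0LessThan)
qed (simp_all)

definition entries :: "'a^'n::{finite,linorder}^'m \<Rightarrow> 'm \<Rightarrow> nat \<Rightarrow> 'a" where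
  "entries g r b = g $ r $ nth_index b"

lemma left_minor_eq_sdet:
  fixes I :: "'n::{finite,linorder} set"
  shows "left_minor I g = sdet (entries g) I"
proof -
  have l: "card I \<le> CARD('n)" by (rule card_mono) auto
  then have "length (sorted_list_of_set (first_indices (card I) :: 'n set)) = card I"
    by (simp add: sorted_list_of_first_indices)
  then have [simp]: "card (first_indices (card I) :: 'n set) = card I"
    by simp
  show ?thesis unfolding left_minor_def minor_def rdet_def entries_def
    by (rule arg_cong[where f = Determinant.det], rule eq_matI)
      (use l in \<open>auto simp: sorted_list_of_first_indices\<close>)
qed

text \<open>By hypothesis \<open>R\<close> preserves the span of the first \<open>k\<close>
  coordinate vectors, so the first \<open>k\<close> columns of \<open>B ** R\<close> are those of
  \<open>B\<close> times the leading block of \<open>R\<close>. Block triangular matrices are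
  allowed because equal eigenvalues in \<open>lam\<close> leave a unitary block
  undetermined.\<close>

lemma rdet_mult:
  fixes B R :: "complex^'n::{finite,linorder}^'n::{finite,linorder}"
  assumes k: "length xs = k" "k \<le> CARD('n)"
    and R: "\<And>a b. k \<le> a \<Longrightarrow> a < CARD('n) \<Longrightarrow> b < k \<Longrightarrow> R $ nth_index a $ nth_index b = 0"
  shows "rdet (entries (B ** R)) xs =
    rdet (entries B) xs * Determinant.det (Matrix.mat k k (\<lambda>(a, b). R $ nth_index a $ nth_index b))"
proof -
  let ?n = "CARD('n)"
  have "Matrix.mat k k (\<lambda>(a, b). entries (B ** R) (xs ! a) b) =
      Matrix.mat k k (\<lambda>(a, b). entries B (xs ! a) b) *
      Matrix.mat k k (\<lambda>(a, b). R $ nth_index a $ nth_index b)"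
  proof (rule eq_matI)
    fix a b assume "a < dim_row (Matrix.mat k k (\<lambda>(a, b). entries B (xs ! a) b) *
        Matrix.mat k k (\<lambda>(a, b). R $ nth_index a $ nth_index b))"
      "b < dim_col (Matrix.mat k k (\<lambda>(a, b). entries B (xs ! a) b) *
        Matrix.mat k k (\<lambda>(a, b). R $ nth_index a $ nth_index b))"
    then have ab: "a < k" "b < k" by auto
    have "entries (B ** R) (xs ! a) b =
        (\<Sum>c<?n. B $ (xs ! a) $ nth_index c * R $ nth_index c $ nth_index b)"
      by (simp add: entries_def matrix_matrix_mult_def
          flip: sum_nth_index[of "\<lambda>i. B $ (xs ! a) $ i * R $ i $ nth_index b"])
    also have "\<dots> = (\<Sum>c<k. B $ (xs ! a) $ nth_index c * R $ nth_index c $ nth_index b)"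
      using k(2) ab R by (intro sum.mono_neutral_right) auto
    finally show "Matrix.mat k k (\<lambda>(a, b). entries (B ** R) (xs ! a) b) $$ (a, b) =
      (Matrix.mat k k (\<lambda>(a, b). entries B (xs ! a) b) *
      Matrix.mat k k (\<lambda>(a, b). R $ nth_index a $ nth_index b)) $$ (a, b)"
      using ab by (simp add: entries_def Matrix.scalar_prod_def atLeast0LessThan)
  qed auto
  then show ?thesis unfolding rdet_def k(1) by (simp add: det_mult[of _ k])
qed

lemma rdet_mult_upper_triangular:
  fixes B R :: "complex^'n::{finite,linorder}^'n::{finite,linorder}"
  assumes k: "length xs \<le> CARD('n)" and R: "\<And>i j. j < i \<Longrightarrow> R $ i $ j = 0"
  shows "rdet (entries (B ** R)) xs =
    rdet (entries B) xs * (\<Prod>b<length xs. R $ nth_index b $ nth_index b)"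
proof -
  let ?k = "length xs"
  let ?U = "Matrix.mat ?k ?k (\<lambda>(a, b). R $ nth_index a $ nth_index b)"
  have "rdet (entries (B ** R)) xs = rdet (entries B) xs * Determinant.det ?U"
    by (rule rdet_mult) (use k in \<open>auto intro!: R nth_index_less\<close>)
  also have "Determinant.det ?U = prod_list (diag_mat ?U)"
    by (rule det_upper_triangular[of _ ?k])
      (use k in \<open>auto intro!: R nth_index_less simp: upper_triangular_def\<close>)
  also have "\<dots> = (\<Prod>b<?k. R $ nth_index b $ nth_index b)"
    by (simp add: prod.list_conv_set_nth diag_mat_def atLeast0LessThan)
  finally show ?thesis .
qed

text \<open>Descending induction on \<open>k\<close>. The full determinant is invertible, and
  expanding a nonzero minor along its last column exhibits a nonzero minor with one column
  fewer.\<close>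

lemma exists_left_minor_nonzero:
  fixes g :: "complex^'n::{finite,linorder}^'n::{finite,linorder}"
  assumes g: "g ** g' = Finite_Cartesian_Product.mat 1" and "k \<le> CARD('n)"
  obtains X :: "'n set" where "card X = k" "left_minor X g \<noteq> 0"
proof -
  have "\<exists>X. card X = k \<and> left_minor X g \<noteq> 0"
    using assms(2)
  proof (induction rule: inc_induct)
    case base
    let ?xs = "sorted_list_of_set (UNIV :: 'n set)"
    have "rdet (entries (g ** g')) ?xs = 1"
    proof -
      have "Matrix.mat CARD('n) CARD('n) (\<lambda>(a, b). entries (g ** g') (?xs ! a) b) = 1\<^sub>m CARD('n)"
        unfolding g by (rule eq_matI)
          (auto simp: entries_def Finite_Cartesian_Product.mat_def nth_index_eq_iff
            simp flip: nth_index_def)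
      then show ?thesis by (simp add: rdet_def)
    qed
    then have "rdet (entries g) ?xs \<noteq> 0"
      using rdet_mult[of ?xs "CARD('n)" g' g] by auto
    then show ?case by (intro exI[of _ UNIV]) (simp add: left_minor_eq_sdet)
  next
    case (step k)
    then obtain X :: "'n set" where X: "card X = Suc k" "left_minor X g \<noteq> 0" by blast
    let ?xs = "sorted_list_of_set X"
    have fX: "finite X" by simp
    have len: "length ?xs = Suc k" using X by simp
    define A where "A = Matrix.mat (Suc k) (Suc k) (\<lambda>(a, b). entries g (?xs ! a) b)"
    have "left_minor X g = (\<Sum>a<Suc k. A $$ (a, k) * cofactor A a k)"
      unfolding left_minor_eq_sdet rdet_def len A_def[symmetric]
      by (rule laplace_expansion_column) (auto simp: A_def)
    with X(2) obtain a where a: "a < Suc k" "cofactor A a k \<noteq> 0"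
      by (metis (no_types, lifting) lessThan_iff mult_zero_right sum.neutral)
    let ?x = "?xs ! a"
    have x: "?x \<in> X" using a len fX by (metis nth_mem set_sorted_list_of_set)
    have i: "insert ?x (X - {?x}) = X" using x by auto
    let ?p = "card {s\<in>X - {?x}. s < ?x}"
    have c: "card (X - {?x}) = k" using X x by simp
    have p: "?p \<le> k" using sorted_list_of_set_insert_nth(1)[of "X - {?x}" ?x] c by simp
    have "?xs ! ?p = ?x" using sorted_list_of_set_insert_nth(2)[of "X - {?x}" ?x, unfolded i] by simp
    then have pa: "?p = a"
      using nth_eq_iff_index_eq[of ?xs ?p a] len a(1) p by simp
    have nth: "sorted_list_of_set (X - {?x}) ! j = ?xs ! (if j < a then j else Suc j)"
      if "j < k" for j
      using sorted_list_of_set_insert_nth(3)[of "X - {?x}" ?x j, unfolded i pa c] that by simp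
    have "mat_delete A a k = Matrix.mat k k (\<lambda>(i, b). entries g (sorted_list_of_set (X - {?x}) ! i) b)"
      unfolding mat_delete_def A_def by (intro eq_matI) (auto simp: nth)
    then have "left_minor (X - {?x}) g \<noteq> 0"
      using a(2) c by (auto simp: cofactor_def left_minor_eq_sdet rdet_def)
    then show ?case using c by blast
  qed
  then show ?thesis using that by blast
qed

lemma continuous_rdet:
  fixes G :: "'t::topological_space \<Rightarrow> 'i \<Rightarrow> nat \<Rightarrow> complex"
  assumes "\<And>r b. continuous_on S (\<lambda>t. G t r b)"
  shows "continuous_on S (\<lambda>t. rdet (G t) xs)"
proof -
  have "continuous_on S (\<lambda>t. \<Sum>p | p permutes {0..<length xs}.
      signof p * (\<Prod>i = 0..<length xs. G t (xs ! i) (p i)))"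
    by (intro continuous_intros assms)
  moreover have "rdet (G t) xs = (\<Sum>p | p permutes {0..<length xs}.
      signof p * (\<Prod>i = 0..<length xs. G t (xs ! i) (p i)))" for t
    unfolding rdet_def Determinant.det_def
    by (auto intro!: sum.cong prod.cong arg_cong2[where f = "(*)"] simp: permutes_in_image)
  ultimately show ?thesis by simp
qed

text \<open>The product rule differentiates one row at a time. As the rows solve a linear system,
  that row becomes a combination of all rows \<open>l\<close>, and multilinearity pulls the
  coefficients out.\<close>

lemma rdet_has_vector_derivative:
  fixes G :: "real \<Rightarrow> 'i::finite \<Rightarrow> nat \<Rightarrow> complex"
  assumes G: "\<And>r b. ((\<lambda>t. G t r b) has_vector_derivative (\<Sum>l\<in>UNIV. M r l * G t l b)) (at t)"
  shows "((\<lambda>t. rdet (G t) xs) has_vector_derivative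
     (\<Sum>a<length xs. \<Sum>l\<in>UNIV. M (xs ! a) l * rdet (G t) (xs[a := l]))) (at t)"
proof -
  let ?k = "length xs" and ?P = "{p. p permutes {0..<length xs}}"
  let ?G' = "\<lambda>r b. \<Sum>l\<in>UNIV. M r l * G t l b"
  have leib: "rdet (G t) ys = (\<Sum>p\<in>?P. signof p * (\<Prod>i\<in>{0..<?k}. G t (ys ! i) (p i)))"
    if "length ys = ?k" for t ys
    unfolding rdet_def Determinant.det_def that
    by (auto intro!: sum.cong prod.cong arg_cong2[where f = "(*)"] simp: permutes_in_image)
  have prod: "((\<lambda>t. \<Prod>i\<in>I. f i t) has_vector_derivative
      (\<Sum>a\<in>I. D a * (\<Prod>i\<in>I - {a}. f i t))) (at t)"
    if "\<And>i. (f i has_vector_derivative D i) (at t)" for f :: "nat \<Rightarrow> real \<Rightarrow> complex" and D I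
    using has_derivative_prod[of I f "\<lambda>i y. y *\<^sub>R D i" t UNIV] that
    unfolding has_vector_derivative_def by (simp add: scaleR_sum_right)
  have "((\<lambda>t. \<Prod>i\<in>{0..<?k}. G t (xs ! i) (p i)) has_vector_derivative
      (\<Sum>a\<in>{0..<?k}. ?G' (xs ! a) (p a) * (\<Prod>i\<in>{0..<?k} - {a}. G t (xs ! i) (p i)))) (at t)" for p
    by (rule prod) (rule G)
  then have "((\<lambda>t. rdet (G t) xs) has_vector_derivative
    (\<Sum>p\<in>?P. signof p *
      (\<Sum>a\<in>{0..<?k}. ?G' (xs ! a) (p a) * (\<Prod>i\<in>{0..<?k} - {a}. G t (xs ! i) (p i))))) (at t)"
    unfolding leib[OF refl] by (intro derivative_intros)
  also have "(\<Sum>p\<in>?P. signof p *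
      (\<Sum>a\<in>{0..<?k}. ?G' (xs ! a) (p a) * (\<Prod>i\<in>{0..<?k} - {a}. G t (xs ! i) (p i)))) =
    (\<Sum>a\<in>{0..<?k}. \<Sum>l\<in>UNIV. M (xs ! a) l *
      (\<Sum>p\<in>?P. signof p * (G t l (p a) * (\<Prod>i\<in>{0..<?k} - {a}. G t (xs ! i) (p i)))))"
    unfolding sum_distrib_left sum_distrib_right
    by (subst sum.swap, intro sum.cong refl, subst sum.swap) (simp add: mult_ac)
  also have "\<dots> = (\<Sum>a\<in>{0..<?k}. \<Sum>l\<in>UNIV. M (xs ! a) l * rdet (G t) (xs[a := l]))"
  proof (intro sum.cong refl arg_cong2[where f = "(*)"])
    fix a l assume a: "a \<in> {0..<?k}"
    have "(\<Prod>i\<in>{0..<?k}. G t (xs[a := l] ! i) (p i)) =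
        G t l (p a) * (\<Prod>i\<in>{0..<?k} - {a}. G t (xs ! i) (p i))" for p
      using a by (subst prod.remove[of _ a]) (auto intro!: prod.cong)
    then show "(\<Sum>p\<in>?P. signof p * (G t l (p a) * (\<Prod>i\<in>{0..<?k} - {a}. G t (xs ! i) (p i)))) =
        rdet (G t) (xs[a := l])"
      by (subst leib) simp_all
  qed
  finally show ?thesis by (simp add: atLeast0LessThan)
qed

section \<open>Linear systems with nonnegative off-diagonal coefficients\<close>

lemma gronwall_nonpos:
  fixes \<phi> :: "real \<Rightarrow> real"
  assumes d: "\<And>t. 0 \<le> t \<Longrightarrow> (\<phi> has_real_derivative \<phi>' t) (at t)"
    and le: "\<And>t. 0 \<le> t \<Longrightarrow> \<phi>' t \<le> c * \<phi> t"
    and "\<phi> 0 \<le> 0" "0 \<le> t"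
  shows "\<phi> t \<le> 0"
proof -
  have "exp (- c * t) * \<phi> t \<le> exp (- c * 0) * \<phi> 0"
  proof (rule DERIV_nonpos_imp_nonincreasing[OF \<open>0 \<le> t\<close>])
    fix s :: real assume s: "0 \<le> s"
    have "((\<lambda>t. exp (- c * t) * \<phi> t) has_real_derivative exp (- c * s) * (\<phi>' s - c * \<phi> s)) (at s)"
      by (auto intro!: derivative_eq_intros d[OF s] simp: algebra_simps)
    moreover have "exp (- c * s) * (\<phi>' s - c * \<phi> s) \<le> 0"
      using le[OF s] by (simp add: mult_nonneg_nonpos)
    ultimately show "\<exists>y. ((\<lambda>t. exp (- c * t) * \<phi> t) has_real_derivative y) (at s) \<and> y \<le> 0" by blast
  qed
  also have "\<dots> \<le> 0" using assms(3) by simp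
  finally show ?thesis by (simp add: mult_le_0_iff)
qed

text \<open>Squaring removes the kink of the negative part at 0. This makes the energy in
  \<open>metzler_nonneg\<close> differentiable.\<close>

lemma min_zero_square_has_derivative:
  "((\<lambda>u::real. (min u 0)\<^sup>2) has_real_derivative 2 * min u 0) (at u)"
proof (cases u "0 :: real" rule: linorder_cases)
  case less
  have "((\<lambda>u::real. u\<^sup>2) has_real_derivative 2 * min u 0) (at u)"
    using less by (auto intro!: derivative_eq_intros)
  then show ?thesis
    by (rule has_field_derivative_transform_within_open[of _ _ _ "{..<0}"]) (use less in auto)
next
  case greater
  have "((\<lambda>u::real. 0) has_real_derivative 2 * min u 0) (at u)"
    using greater by auto
  then show ?thesis
    by (rule has_field_derivative_transform_within_open[of _ _ _ "{0<..}"]) (use greater in auto)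
next
  case equal
  have "((\<lambda>h::real. (min h 0)\<^sup>2 / h) \<longlongrightarrow> 0) (at 0)"
  proof (rule Lim_null_comparison[where g = "\<lambda>h. \<bar>h\<bar>"])
    show "\<forall>\<^sub>F h in at 0. norm ((min h 0)\<^sup>2 / h) \<le> \<bar>h::real\<bar>"
      by (rule always_eventually) (auto simp: min_def power2_eq_square)
    show "((\<lambda>h::real. \<bar>h\<bar>) \<longlongrightarrow> 0) (at 0)"
      by (intro tendsto_eq_intros) auto
  qed
  then show ?thesis using equal by (simp add: has_field_derivative_iff)
qed

text \<open>The energy \<open>\<phi>\<close>, the sum of the squared negative parts, starts at 0 and
  satisfies a Gronwall inequality. In its derivative a positive \<open>x J t\<close> can only help,
  as it is multiplied by a nonpositive number and a nonnegative coefficient, so \<open>x J t\<close>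
  may be replaced by its negative part.\<close>

lemma metzler_nonneg:
  fixes x :: "'k \<Rightarrow> real \<Rightarrow> real" and B :: "'k \<Rightarrow> 'k \<Rightarrow> real"
  assumes X: "finite X"
    and d: "\<And>I t. I \<in> X \<Longrightarrow> (x I has_real_derivative (\<Sum>J\<in>X. B I J * x J t)) (at t)"
    and B: "\<And>I J. I \<in> X \<Longrightarrow> J \<in> X \<Longrightarrow> I \<noteq> J \<Longrightarrow> 0 \<le> B I J"
    and x0: "\<And>I. I \<in> X \<Longrightarrow> 0 \<le> x I 0"
    and "I \<in> X" "0 \<le> t"
  shows "0 \<le> x I t"
proof -
  let ?n = "\<lambda>I t. min (x I t) 0"
  define \<phi> where "\<phi> t = (\<Sum>I\<in>X. (?n I t)\<^sup>2)" for t
  \<comment> \<open>The 2 comes from differentiating a square. Each product of two negative parts is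
    at most \<open>\<phi>\<close>, which leaves the sum of all coefficients.\<close>
  define c where "c = 2 * (\<Sum>I\<in>X. \<Sum>J\<in>X. \<bar>B I J\<bar>)"
  have le_phi: "(?n I t)\<^sup>2 \<le> \<phi> t" if "I \<in> X" for I t
    unfolding \<phi>_def by (rule member_le_sum[OF that]) (use X in auto)
  have "\<phi> t \<le> 0"
  proof (rule gronwall_nonpos[OF _ _ _ \<open>0 \<le> t\<close>])
    fix t :: real
    show "(\<phi> has_real_derivative (\<Sum>I\<in>X. 2 * ?n I t * (\<Sum>J\<in>X. B I J * x J t))) (at t)"
      unfolding \<phi>_def by (intro DERIV_sum DERIV_chain2[OF min_zero_square_has_derivative] d)
    have "?n I t * (B I J * x J t) \<le> \<bar>B I J\<bar> * \<phi> t" if I: "I \<in> X" and J: "J \<in> X" for I J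
    proof -
      have "?n I t * (B I J * x J t) \<le> \<bar>B I J\<bar> * (\<bar>?n I t\<bar> * \<bar>?n J t\<bar>)"
      proof (cases "I = J")
        case True
        have "?n I t * x I t = \<bar>?n I t\<bar> * \<bar>?n I t\<bar>" by (auto simp: min_def)
        then have "?n I t * (B I J * x J t) = B I J * (\<bar>?n I t\<bar> * \<bar>?n J t\<bar>)"
          using True by (simp add: mult.left_commute)
        also have "\<dots> \<le> \<bar>B I J\<bar> * (\<bar>?n I t\<bar> * \<bar>?n J t\<bar>)"
          by (intro mult_right_mono mult_nonneg_nonneg abs_ge_zero abs_ge_self)
        finally show ?thesis .
      next
        case False
        then have b: "0 \<le> B I J" using B I J by auto
        have "?n I t * x J t \<le> \<bar>?n I t\<bar> * \<bar>?n J t\<bar>"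
          by (auto simp: min_def mult_le_0_iff)
        then have "B I J * (?n I t * x J t) \<le> B I J * (\<bar>?n I t\<bar> * \<bar>?n J t\<bar>)"
          using b by (rule mult_left_mono)
        then show ?thesis using b by (simp add: mult.left_commute)
      qed
      also have "\<bar>?n I t\<bar> * \<bar>?n J t\<bar> \<le> \<phi> t"
      proof -
        have "2 * (\<bar>?n I t\<bar> * \<bar>?n J t\<bar>) \<le> (?n I t)\<^sup>2 + (?n J t)\<^sup>2"
          using sum_squares_bound[of "\<bar>?n I t\<bar>" "\<bar>?n J t\<bar>"] by simp
        then show ?thesis using le_phi[OF I, of t] le_phi[OF J, of t] by linarith
      qed
      finally show ?thesis by (simp add: mult_left_mono)
    qed
    then have "(\<Sum>I\<in>X. \<Sum>J\<in>X. ?n I t * (B I J * x J t)) \<le> (\<Sum>I\<in>X. \<Sum>J\<in>X. \<bar>B I J\<bar> * \<phi> t)"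
      by (intro sum_mono)
    moreover have "(\<Sum>I\<in>X. 2 * ?n I t * (\<Sum>J\<in>X. B I J * x J t)) =
        2 * (\<Sum>I\<in>X. \<Sum>J\<in>X. ?n I t * (B I J * x J t))"
      by (simp only: sum_distrib_left mult.assoc)
    moreover have "c * \<phi> t = 2 * (\<Sum>I\<in>X. \<Sum>J\<in>X. \<bar>B I J\<bar> * \<phi> t)"
      by (simp only: c_def sum_distrib_right mult.assoc)
    ultimately show "(\<Sum>I\<in>X. 2 * ?n I t * (\<Sum>J\<in>X. B I J * x J t)) \<le> c * \<phi> t"
      by simp
  next
    show "\<phi> 0 \<le> 0" unfolding \<phi>_def using x0 by (simp add: min_absorb2)
  qed
  then have "(?n I t)\<^sup>2 \<le> 0" using le_phi[OF \<open>I \<in> X\<close>, of t] by linarith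
  then show ?thesis by (simp add: min_def split: if_splits)
qed

text \<open>The integrating factor \<open>exp (- B I I * t)\<close> removes the diagonal term. What
  remains has a nonnegative derivative, so a positive start stays positive, and the derivative is
  strictly positive as soon as some \<open>J\<close> with \<open>0 < B I J\<close> is.\<close>

lemma metzler_positive:
  fixes x :: "'k \<Rightarrow> real \<Rightarrow> real" and B :: "'k \<Rightarrow> 'k \<Rightarrow> real"
  assumes X: "finite X"
    and d: "\<And>I t. I \<in> X \<Longrightarrow> (x I has_real_derivative (\<Sum>J\<in>X. B I J * x J t)) (at t)"
    and B: "\<And>I J. I \<in> X \<Longrightarrow> J \<in> X \<Longrightarrow> I \<noteq> J \<Longrightarrow> 0 \<le> B I J"
    and x0: "\<And>I. I \<in> X \<Longrightarrow> 0 \<le> x I 0"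
    and I: "I \<in> X" and t: "0 < t"
    and cases: "0 < x I 0 \<or> (\<exists>J\<in>X. J \<noteq> I \<and> 0 < B I J \<and> (\<forall>t>0. 0 < x J t))"
  shows "0 < x I t"
proof -
  have nonneg: "0 \<le> x J s" if "J \<in> X" "0 \<le> s" for J s
    by (rule metzler_nonneg[OF X d B x0 that])
  define y where "y t = exp (- B I I * t) * x I t" for t
  define y' where "y' t = exp (- B I I * t) * (\<Sum>J\<in>X - {I}. B I J * x J t)" for t
  have y: "(y has_real_derivative y' s) (at s)" for s
  proof -
    have "(y has_real_derivative exp (- B I I * s) * ((\<Sum>J\<in>X. B I J * x J s) - B I I * x I s)) (at s)"
      unfolding y_def by (auto intro!: derivative_eq_intros d[OF I] simp: algebra_simps)
    then show ?thesis using X I by (simp add: y'_def sum_diff1)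
  qed
  have "0 < y t"
  proof (cases "0 < x I 0")
    case True
    have "y 0 \<le> y t"
    proof (rule DERIV_nonneg_imp_nondecreasing[OF less_imp_le[OF t]])
      fix s :: real assume s: "0 \<le> s"
      have "0 \<le> y' s" unfolding y'_def
        using nonneg[OF _ s] B I by (auto intro!: mult_nonneg_nonneg sum_nonneg)
      then show "\<exists>z. (y has_real_derivative z) (at s) \<and> 0 \<le> z" using y by blast
    qed
    then show ?thesis using True by (simp add: y_def)
  next
    case False
    then obtain J where J: "J \<in> X" "J \<noteq> I" "0 < B I J" "\<And>t. 0 < t \<Longrightarrow> 0 < x J t"
      using cases by blast
    have "y 0 < y t"
    proof (rule DERIV_pos_imp_increasing_open[OF t])
      fix s :: real assume s: "0 < s"
      have "0 < (\<Sum>J\<in>X - {I}. B I J * x J s)"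
      proof (rule sum_pos2[of _ J])
        show "0 < B I J * x J s" using J s by simp
        show "0 \<le> B I K * x K s" if "K \<in> X - {I}" for K
          using nonneg[of K s] s B I that by auto
      qed (use X J in auto)
      then show "\<exists>z. (y has_real_derivative z) (at s) \<and> 0 < z"
        using y[of s] unfolding y'_def by auto
    qed (use y in \<open>auto intro: DERIV_isCont continuous_at_imp_continuous_on\<close>)
    then show ?thesis using x0[OF I] by (simp add: y_def)
  qed
  then show ?thesis by (simp add: y_def zero_less_mult_iff)
qed


section \<open>Minors along linear flows with tridiagonal generators\<close>

lemma next_index_less:
  assumes "next_index i l"
  shows "i < c \<Longrightarrow> c \<noteq> l \<Longrightarrow> l < c" and "b < l \<Longrightarrow> b \<noteq> i \<Longrightarrow> b < i"
  using assms unfolding next_index_def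
  by (metis emptyE greaterThanLessThan_iff linorder_neqE)+

text \<open>Nothing lies strictly between neighbours, so an entry on one side of the replaced index
  and different from \<open>l\<close> is on the same side of \<open>l\<close>. The list therefore
  stays sorted without moving any position, and no sign arises.\<close>

lemma sorted_list_update_neighbour:
  fixes J :: "'n::{finite,linorder} set"
  assumes J: "a < card J"
    and l: "l = sorted_list_of_set J ! a \<or> next_index l (sorted_list_of_set J ! a) \<or>
      next_index (sorted_list_of_set J ! a) l"
    and nl: "l \<notin> J - {sorted_list_of_set J ! a}"
  shows "(sorted_list_of_set J)[a := l] =
    sorted_list_of_set (insert l (J - {sorted_list_of_set J ! a}))"
proof -
  let ?xs = "sorted_list_of_set J"
  let ?i = "?xs ! a"
  have lt: "?xs ! b < ?xs ! c" if "b < c" "c < card J" for b c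
    by (rule sorted_wrt_nth_less[OF strict_sorted_list_of_set]) (use that in simp_all)
  have mem: "?xs ! b \<in> J - {?i}" if "b < card J" "b \<noteq> a" for b
    using that J by (metis DiffI empty_iff finite insert_iff length_sorted_list_of_set lt
        nat_neq_iff nth_mem order_less_irrefl set_sorted_list_of_set)
  have "sorted_wrt (<) (?xs[a := l])"
    unfolding sorted_wrt_iff_nth_less
  proof (intro allI impI)
    fix b c assume bc: "b < c" "c < length (?xs[a := l])"
    then have c: "c < card J" by simp
    consider "b \<noteq> a" "c \<noteq> a" | "b = a" | "c = a" by auto
    then show "?xs[a := l] ! b < ?xs[a := l] ! c"
    proof cases
      case 1
      then show ?thesis using lt[OF bc(1) c] by simp
    next
      case 2
      then have "?i < ?xs ! c" "?xs ! c \<noteq> l" using lt[OF bc(1) c] mem[of c] nl c bc by auto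
      then have "l < ?xs ! c" using l next_index_less(1)
        by (metis next_index_def order.strict_trans)
      then show ?thesis using 2 bc J by simp
    next
      case 3
      then have "?xs ! b < ?i" "?xs ! b \<noteq> l" using lt[OF bc(1) c] mem[of b] nl c bc by auto
      then have "?xs ! b < l" using l next_index_less(2)
        by (metis next_index_def order.strict_trans)
      then show ?thesis using 3 bc J by simp
    qed
  qed
  moreover have "set (?xs[a := l]) = insert l (J - {?i})"
    using J by (subst set_update_distinct) auto
  ultimately show ?thesis
    by (metis sorted_list_of_set.idem_if_sorted_distinct strict_sorted_iff)
qed

text \<open>The off-diagonal coefficients of the derived system for the minors carry no sign: replacing a row
  by a neighbouring one keeps the rows sorted, or makes two of them equal.\<close>

definition compound_gen :: "real^'n::{finite,linorder}^'n::{finite,linorder} \<Rightarrow> 'n set \<Rightarrow> 'n set \<Rightarrow> real"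
  where "compound_gen T J J' =
    (\<Sum>i\<in>J. \<Sum>l\<in>- (J - {i}). if J' = insert l (J - {i}) then T $ i $ l else 0)"

lemma compound_gen_nonneg:
  assumes T: "T \<in> gl_nonneg" and "J \<noteq> J'"
  shows "0 \<le> compound_gen T J J'"
  unfolding compound_gen_def
proof (intro sum_nonneg)
  fix i l assume i: "i \<in> J" and l: "l \<in> - (J - {i})"
  show "0 \<le> (if J' = insert l (J - {i}) then T $ i $ l else 0)"
  proof (cases "J' = insert l (J - {i})")
    case True
    then have "i \<noteq> l" using assms(2) i by auto
    then show ?thesis using T True
      by (cases "next_index i l \<or> next_index l i") (auto simp: gl_nonneg_def tridiagonal_def)
  qed simp
qed

lemma compound_gen_pos:
  assumes T: "T \<in> gl_pos" and i: "i \<in> J" and l: "l \<notin> J" and n: "next_index i l \<or> next_index l i"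
  shows "0 < compound_gen T J (insert l (J - {i}))"
proof -
  have nn: "T \<in> gl_nonneg" using T by (auto simp: gl_pos_def gl_nonneg_def intro: less_imp_le)
  let ?J' = "insert l (J - {i})"
  let ?t = "\<lambda>a b. if ?J' = insert b (J - {a}) then T $ a $ b else 0"
  have J: "?J' \<noteq> J" using l by blast
  have t: "0 \<le> ?t a b" if "a \<in> J" for a b
  proof (cases "a = b")
    case True
    then have "?J' \<noteq> insert b (J - {a})" using J that by (simp add: insert_absorb)
    then show ?thesis by simp
  next
    case False
    then show ?thesis using nn
      by (cases "next_index a b \<or> next_index b a") (auto simp: gl_nonneg_def tridiagonal_def)
  qed
  have "0 < ?t i l" using T n by (auto simp: gl_pos_def)
  then have "0 < (\<Sum>b\<in>- (J - {i}). ?t i b)"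
    by (rule sum_pos2[rotated 2]) (use t i l in simp_all)
  moreover have "0 \<le> (\<Sum>b\<in>- (J - {a}). ?t a b)" if "a \<in> J" for a
    using t[OF that] by (rule sum_nonneg)
  ultimately show ?thesis unfolding compound_gen_def using i by (intro sum_pos2[of J i]) simp_all
qed

text \<open>The minors of each order solve a linear system whose matrix is the additive compound of
  \<open>T\<close>. Replacing a row by one already present gives 0, and replacing it by one that is
  not a neighbour has coefficient 0.\<close>

lemma sdet_has_vector_derivative:
  fixes G :: "real \<Rightarrow> 'n::{finite,linorder} \<Rightarrow> nat \<Rightarrow> complex"
  assumes T: "tridiagonal T"
    and G: "\<And>r b. ((\<lambda>t. G t r b) has_vector_derivative (\<Sum>l\<in>UNIV. of_real (T $ r $ l) * G t l b)) (at t)"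
  shows "((\<lambda>t. sdet (G t) J) has_vector_derivative
    (\<Sum>J'\<in>UNIV. of_real (compound_gen T J J') * sdet (G t) J')) (at t)"
proof -
  let ?xs = "sorted_list_of_set J"
  have bij: "bij_betw (\<lambda>a. ?xs ! a) {..<length ?xs} J"
    by (rule bij_betw_nth) simp_all
  have "(\<Sum>a<length ?xs. \<Sum>l\<in>UNIV. of_real (T $ (?xs ! a) $ l) * rdet (G t) (?xs[a := l])) =
      (\<Sum>a<length ?xs. \<Sum>l\<in>- (J - {?xs ! a}).
        of_real (T $ (?xs ! a) $ l) * sdet (G t) (insert l (J - {?xs ! a})))"
  proof (intro sum.cong[OF refl])
    fix a assume "a \<in> {..<length ?xs}"
    then have a: "a < card J" by simp
    have 0: "rdet (G t) (?xs[a := l]) = 0" if "l \<in> J - {?xs ! a}" for l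
    proof (rule rdet_not_distinct)
      have "l \<in> set ?xs" using that by simp
      then obtain b where b: "b < length ?xs" "?xs ! b = l" by (auto simp only: in_set_conv_nth)
      then have "b \<noteq> a" using that by auto
      then have "?xs[a := l] ! a = ?xs[a := l] ! b" using b a by simp
      then show "\<not> distinct (?xs[a := l])"
        using nth_eq_iff_index_eq[of "?xs[a := l]" a b] b(1) a \<open>b \<noteq> a\<close> by auto
    qed
    have "(\<Sum>l\<in>UNIV. of_real (T $ (?xs ! a) $ l) * rdet (G t) (?xs[a := l])) =
        (\<Sum>l\<in>- (J - {?xs ! a}). of_real (T $ (?xs ! a) $ l) * rdet (G t) (?xs[a := l]))"
      by (intro sum.mono_neutral_right) (auto simp: 0)
    also have "\<dots> = (\<Sum>l\<in>- (J - {?xs ! a}).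
        of_real (T $ (?xs ! a) $ l) * sdet (G t) (insert l (J - {?xs ! a})))"
    proof (intro sum.cong refl)
      fix l assume l: "l \<in> - (J - {?xs ! a})"
      show "of_real (T $ (?xs ! a) $ l) * rdet (G t) (?xs[a := l]) =
        of_real (T $ (?xs ! a) $ l) * sdet (G t) (insert l (J - {?xs ! a}))"
      proof (cases "l = ?xs ! a \<or> next_index l (?xs ! a) \<or> next_index (?xs ! a) l")
        case True
        have "l \<notin> J - {?xs ! a}" using l by blast
        then show ?thesis by (simp only: sorted_list_update_neighbour[OF a True] not_False_eq_True)
      next
        case False
        then have "T $ (?xs ! a) $ l = 0" using T by (auto simp: tridiagonal_def)
        then show ?thesis by simp
      qed
    qed
    finally show "(\<Sum>l\<in>UNIV. of_real (T $ (?xs ! a) $ l) * rdet (G t) (?xs[a := l])) =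
      (\<Sum>l\<in>- (J - {?xs ! a}).
        of_real (T $ (?xs ! a) $ l) * sdet (G t) (insert l (J - {?xs ! a})))" .
  qed
  also have "\<dots> = (\<Sum>i\<in>J. \<Sum>l\<in>- (J - {i}). of_real (T $ i $ l) * sdet (G t) (insert l (J - {i})))"
    by (rule sum.reindex_bij_betw[OF bij, of "\<lambda>i. \<Sum>l\<in>- (J - {i}).
          of_real (T $ i $ l) * sdet (G t) (insert l (J - {i}))"])
  also have "\<dots> = (\<Sum>i\<in>J. \<Sum>l\<in>- (J - {i}). \<Sum>J'\<in>UNIV.
      if J' = insert l (J - {i}) then of_real (T $ i $ l) * sdet (G t) J' else 0)"
    by simp
  also have "\<dots> = (\<Sum>J'\<in>UNIV. \<Sum>i\<in>J. \<Sum>l\<in>- (J - {i}).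
      if J' = insert l (J - {i}) then of_real (T $ i $ l) * sdet (G t) J' else 0)"
    by (subst (2) sum.swap, subst sum.swap) (rule refl)
  also have "\<dots> = (\<Sum>J'\<in>UNIV. of_real (compound_gen T J J') * sdet (G t) J')"
    unfolding compound_gen_def of_real_sum sum_distrib_right by (intro sum.cong refl) simp
  finally show ?thesis
    using rdet_has_vector_derivative[where G = G, OF G, where xs = ?xs] by simp
qed

text \<open>The comparison theorem is about real functions. The factor \<open>\<omega>\<close> runs
  through 1, -1, \<open>\<i>\<close> and \<open>- \<i>\<close> later on, so real and imaginary parts
  of the minors are controlled alike. The family \<open>X\<close>, which the system does not leave,
  allows the vanishing of only some minors to be propagated.\<close>

lemma minor_flow_nonneg:
  fixes G :: "real \<Rightarrow> 'n::{finite,linorder} \<Rightarrow> nat \<Rightarrow> complex"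
  assumes T: "T \<in> gl_nonneg"
    and G: "\<And>r b t. ((\<lambda>t. G t r b) has_vector_derivative
      (\<Sum>l\<in>UNIV. of_real (T $ r $ l) * G t l b)) (at t)"
    and closed: "\<And>J J'. J \<in> X \<Longrightarrow> compound_gen T J J' \<noteq> 0 \<Longrightarrow> J' \<in> X"
    and 0: "\<And>J. J \<in> X \<Longrightarrow> 0 \<le> Re (\<omega> * sdet (G 0) J)"
    and "J \<in> X" "0 \<le> t"
  shows "0 \<le> Re (\<omega> * sdet (G t) J)"
proof (rule metzler_nonneg[of X "\<lambda>J t. Re (\<omega> * sdet (G t) J)" "compound_gen T"])
  fix J t assume J: "J \<in> X"
  have Re: "Re (of_real c * z) = c * Re z" for c z by simp
  have "((\<lambda>t. Re (\<omega> * sdet (G t) J)) has_vector_derivative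
      Re (\<omega> * (\<Sum>J'\<in>UNIV. of_real (compound_gen T J J') * sdet (G t) J'))) (at t)"
    using T by (intro bounded_linear.has_vector_derivative[OF bounded_linear_Re] has_vector_derivative_mult_right
        sdet_has_vector_derivative G) (auto simp: gl_nonneg_def)
  also have "Re (\<omega> * (\<Sum>J'\<in>UNIV. of_real (compound_gen T J J') * sdet (G t) J')) =
      (\<Sum>J'\<in>UNIV. compound_gen T J J' * Re (\<omega> * sdet (G t) J'))"
    by (simp add: sum_distrib_left mult.left_commute[of \<omega>] Re del: times_complex.sel)
  also have "\<dots> = (\<Sum>J'\<in>X. compound_gen T J J' * Re (\<omega> * sdet (G t) J'))"
    using closed[OF J] by (intro sum.mono_neutral_right) auto
  finally show "((\<lambda>t. Re (\<omega> * sdet (G t) J)) has_real_derivative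
      (\<Sum>J'\<in>X. compound_gen T J J' * Re (\<omega> * sdet (G t) J'))) (at t)"
    by (simp only: has_real_derivative_iff_has_vector_derivative)
qed (use assms in \<open>auto intro: compound_gen_nonneg\<close>)

lemma minor_flow_totally_nonneg:
  fixes G :: "real \<Rightarrow> 'n::{finite,linorder} \<Rightarrow> nat \<Rightarrow> complex"
  assumes T: "T \<in> gl_nonneg"
    and G: "\<And>r b t. ((\<lambda>t. G t r b) has_vector_derivative
      (\<Sum>l\<in>UNIV. of_real (T $ r $ l) * G t l b)) (at t)"
    and 0: "\<And>J. sdet (G 0) J \<in> \<real> \<and> 0 \<le> Re (sdet (G 0) J)"
    and t: "0 \<le> t"
  shows "sdet (G t) J \<in> \<real> \<and> 0 \<le> Re (sdet (G t) J)"
proof -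
  note flow = minor_flow_nonneg[OF T G, where X = UNIV and t = t and J = J, OF _ _ _ t]
  have "0 \<le> Re (1 * sdet (G t) J)" using 0 by (intro flow) auto
  moreover have "0 \<le> Re (\<i> * sdet (G t) J)" using 0 by (intro flow) (auto simp: complex_is_Real_iff)
  moreover have "0 \<le> Re (- \<i> * sdet (G t) J)" using 0 by (intro flow) (auto simp: complex_is_Real_iff)
  ultimately show ?thesis by (simp add: complex_is_Real_iff)
qed

lemma minor_flow_zero:
  fixes G :: "real \<Rightarrow> 'n::{finite,linorder} \<Rightarrow> nat \<Rightarrow> complex"
  assumes T: "T \<in> gl_nonneg"
    and G: "\<And>r b t. ((\<lambda>t. G t r b) has_vector_derivative
      (\<Sum>l\<in>UNIV. of_real (T $ r $ l) * G t l b)) (at t)"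
    and closed: "\<And>J J'. J \<in> X \<Longrightarrow> compound_gen T J J' \<noteq> 0 \<Longrightarrow> J' \<in> X"
    and 0: "\<And>J. J \<in> X \<Longrightarrow> sdet (G 0) J = 0"
    and J: "J \<in> X" and t: "0 \<le> t"
  shows "sdet (G t) J = 0"
proof -
  have flow: "0 \<le> Re (\<omega> * sdet (G t) J)" for \<omega>
    by (rule minor_flow_nonneg[OF T G closed _ J t]) (simp_all add: 0)
  show ?thesis using flow[of 1] flow[of "-1"] flow[of \<i>] flow[of "-\<i>"]
    by (simp add: complex_eq_iff)
qed

section \<open>Irreducibility: index sets of equal size are connected by neighbour moves\<close>

definition neighbour_sets :: "'n::linorder set \<Rightarrow> 'n set \<Rightarrow> bool" where
  "neighbour_sets J J' \<longleftrightarrow>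
     (\<exists>i\<in>J. \<exists>l. l \<notin> J \<and> (next_index i l \<or> next_index l i) \<and> J' = insert l (J - {i}))"

lemma neighbour_sets_sym: "neighbour_sets J J' \<Longrightarrow> neighbour_sets J' J"
  unfolding neighbour_sets_def
proof (elim bexE exE conjE)
  fix i l assume "i \<in> J" "l \<notin> J" "next_index i l \<or> next_index l i" "J' = insert l (J - {i})"
  then show "\<exists>i\<in>J'. \<exists>l. l \<notin> J' \<and> (next_index i l \<or> next_index l i) \<and> J = insert l (J' - {i})"
    by (intro bexI[of _ l] exI[of _ i]) auto
qed

lemma neighbour_sets_card: "neighbour_sets J J' \<Longrightarrow> card J' = card (J :: 'n::{finite,linorder} set)"
  unfolding neighbour_sets_def
  by (metis DiffD1 card.remove card_insert_disjoint finite)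

text \<open>View \<open>J\<close> as particles on a line. Moving one of them down into an adjacent
  vacancy lowers the sum of all positions, and no such move is left only when the particles fill an
  initial segment.\<close>

lemma neighbour_sets_down_closed:
  fixes J :: "'n::{finite,linorder} set"
  shows "\<exists>D. (\<forall>i\<in>D. {..<i} \<subseteq> D) \<and> card D = card J \<and> neighbour_sets\<^sup>*\<^sup>* J D"
proof (induction "\<Sum>j\<in>J. card {..<j}" arbitrary: J rule: less_induct)
  case less
  show ?case
  proof (cases "\<forall>i\<in>J. {..<i} \<subseteq> J")
    case True
    then show ?thesis by (intro exI[of _ J]) simp
  next
    case False
    then obtain i0 l0 where il0: "i0 \<in> J" "l0 < i0" "l0 \<notin> J" by auto
    \<comment> \<open>The lowest particle above the vacancy \<open>l0\<close> and then the highest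
      vacancy below that particle: an index strictly between them would contradict one of the two
      choices, so they are adjacent.\<close>
    define i where "i = Min {y\<in>J. l0 < y}"
    have "i \<in> {y\<in>J. l0 < y}" unfolding i_def by (rule Min_in) (use il0 in auto)
    then have i: "i \<in> J" "l0 < i" by auto
    have i_le: "i \<le> y" if "y \<in> J" "l0 < y" for y unfolding i_def using that by (intro Min_le) auto
    define l where "l = Max {y. y \<notin> J \<and> y < i}"
    have "l \<in> {y. y \<notin> J \<and> y < i}" unfolding l_def by (rule Max_in) (use il0 i in auto)
    then have l: "l \<notin> J" "l < i" by auto
    have l_ge: "y \<le> l" if "y \<notin> J" "y < i" for y unfolding l_def using that by (intro Max_ge) auto
    have "next_index l i"
      unfolding next_index_def
    proof (intro conjI l equals0I)
      fix z assume z: "z \<in> {l<..<i}"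
      then have "z \<in> J" using l_ge[of z] by (meson greaterThanLessThan_iff leD)
      moreover have "l0 < z" using l_ge[of l0] il0(3) i(2) z by auto
      ultimately show False using i_le[of z] z by auto
    qed
    let ?J' = "insert l (J - {i})"
    have n: "neighbour_sets J ?J'" unfolding neighbour_sets_def using i l \<open>next_index l i\<close> by blast
    have "card {..<l} < card {..<i}" using l(2) by (intro psubset_card_mono) auto
    moreover have "(\<Sum>j\<in>J. card {..<j}) = card {..<i} + (\<Sum>j\<in>J - {i}. card {..<j})"
      using i by (intro sum.remove) auto
    moreover have "(\<Sum>j\<in>?J'. card {..<j}) = card {..<l} + (\<Sum>j\<in>J - {i}. card {..<j})"
      using l by (intro sum.insert) auto
    ultimately have "(\<Sum>j\<in>?J'. card {..<j}) < (\<Sum>j\<in>J. card {..<j})" by simp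
    from less[OF this] neighbour_sets_card[OF n] n show ?thesis
      by (metis converse_rtranclp_into_rtranclp)
  qed
qed

text \<open>Both sets can be moved to initial segments. These are nested and of equal size, hence
  equal, and moves are reversible.\<close>

lemma neighbour_sets_connected:
  fixes I J :: "'n::{finite,linorder} set"
  assumes "card I = card J"
  shows "neighbour_sets\<^sup>*\<^sup>* I J"
proof -
  obtain D where D: "\<forall>i\<in>D. {..<i} \<subseteq> D" "card D = card I" "neighbour_sets\<^sup>*\<^sup>* I D"
    using neighbour_sets_down_closed by blast
  obtain D' where D': "\<forall>i\<in>D'. {..<i} \<subseteq> D'" "card D' = card J" "neighbour_sets\<^sup>*\<^sup>* J D'"
    using neighbour_sets_down_closed by blast
  have "D \<subseteq> D' \<or> D' \<subseteq> D"
  proof (rule disjCI, rule subsetI)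
    fix x assume n: "\<not> D' \<subseteq> D" and x: "x \<in> D"
    then obtain y where y: "y \<in> D'" "y \<notin> D" by auto
    then have "x < y" using D(1) x by (metis lessThan_iff linorder_neqE subsetD)
    then show "x \<in> D'" using D'(1) y by auto
  qed
  then have "D = D'" using D(2) D'(2) assms by (metis card_subset_eq finite)
  moreover have "neighbour_sets\<^sup>*\<^sup>* D' J"
    using D'(3) by (induction rule: rtranclp_induct)
      (auto intro: converse_rtranclp_into_rtranclp neighbour_sets_sym)
  ultimately show ?thesis using D(3) by auto
qed

text \<open>In each order one minor is positive at time 0. Positivity for all \<open>t > 0\<close>
  then spreads along neighbour moves, each of which has a positive coefficient in the
  system.\<close>

lemma minor_flow_totally_positive:
  fixes G :: "real \<Rightarrow> 'n::{finite,linorder} \<Rightarrow> nat \<Rightarrow> complex"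
  assumes T: "T \<in> gl_pos"
    and G: "\<And>r b t. ((\<lambda>t. G t r b) has_vector_derivative
      (\<Sum>l\<in>UNIV. of_real (T $ r $ l) * G t l b)) (at t)"
    and 0: "\<And>J. sdet (G 0) J \<in> \<real> \<and> 0 \<le> Re (sdet (G 0) J)"
    and ne: "\<And>k. k \<le> CARD('n) \<Longrightarrow> \<exists>J::'n set. card J = k \<and> sdet (G 0) J \<noteq> 0"
    and t: "0 < t"
  shows "sdet (G t) J \<in> \<real> \<and> 0 < Re (sdet (G t) J)"
proof -
  have nn: "T \<in> gl_nonneg" using T by (auto simp: gl_pos_def gl_nonneg_def intro: less_imp_le)
  let ?x = "\<lambda>J t. Re (sdet (G t) J)"
  have d: "(?x I has_real_derivative (\<Sum>J\<in>UNIV. compound_gen T I J * ?x J t)) (at t)" for I t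
  proof -
    have "(?x I has_vector_derivative
        Re (\<Sum>J\<in>UNIV. of_real (compound_gen T I J) * sdet (G t) J)) (at t)"
      using T by (intro bounded_linear.has_vector_derivative[OF bounded_linear_Re] sdet_has_vector_derivative G) (auto simp: gl_pos_def)
    then show ?thesis by (simp add: has_real_derivative_iff_has_vector_derivative)
  qed
  note pos = metzler_positive[of UNIV ?x "compound_gen T", OF _ d compound_gen_nonneg[OF nn] conjunct2[OF 0]]
  have "card J \<le> CARD('n)" by (rule card_mono) auto
  then obtain J0 :: "'n set" where J0: "card J0 = card J" "sdet (G 0) J0 \<noteq> 0" using ne by blast
  have "0 < ?x J0 0" using 0[of J0] J0(2)
    by (metis Reals_0 complex_is_Real_iff complex_eqI order_le_less zero_complex.sel)
  then have start: "\<forall>t>0. 0 < ?x J0 t" using pos by simp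
  have "neighbour_sets\<^sup>*\<^sup>* J0 J" by (rule neighbour_sets_connected[OF J0(1)])
  then have "\<forall>t>0. 0 < ?x J t"
  proof (induction rule: rtranclp_induct)
    case (step I I')
    from step(2) have "neighbour_sets I' I" by (rule neighbour_sets_sym)
    then obtain i l where il: "i \<in> I'" "l \<notin> I'" "next_index i l \<or> next_index l i"
      "I = insert l (I' - {i})" by (auto simp: neighbour_sets_def)
    then have "0 < compound_gen T I' I" using compound_gen_pos[OF T] by simp
    moreover have "I \<noteq> I'" using il by auto
    ultimately show ?case using step(3) by (intro allI impI pos) auto
  qed (rule start)
  then show ?thesis using minor_flow_totally_nonneg[OF nn G 0, of t J] t by auto
qed

section \<open>The matrix exponential and the QR decomposition\<close>

abbreviation idm :: "complex^'n^'n" where "idm \<equiv> Finite_Cartesian_Product.mat 1"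

lemma idm_entry: "idm $ i $ j = (if i = j then 1 else 0)"
  by (simp add: Finite_Cartesian_Product.mat_def)

lemma matrix_mult_entry: "(A ** B) $ i $ j = (\<Sum>k\<in>UNIV. A $ i $ k * B $ k $ j)"
  by (simp add: matrix_matrix_mult_def)

lemma matrix_eqI: "(\<And>i j. A $ i $ j = B $ i $ j) \<Longrightarrow> A = B"
  by (simp add: Finite_Cartesian_Product.vec_eq_iff)

lemma bounded_bilinear_matrix_mult:
  "bounded_bilinear ((**) :: complex^'n^'n \<Rightarrow> complex^'n^'n \<Rightarrow> complex^'n^'n)"
proof -
  have "bilinear ((**) :: complex^'n^'n \<Rightarrow> complex^'n^'n \<Rightarrow> complex^'n^'n)"
    unfolding bilinear_def
    by (intro conjI allI linearI)
      (auto intro!: matrix_eqI simp: matrix_mult_entry sum.distrib scaleR_sum_right algebra_simps)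
  then show ?thesis by (simp add: bilinear_conv_bounded_bilinear)
qed

lemmas matrix_continuous_on_mult = bounded_bilinear.continuous_on[OF bounded_bilinear_matrix_mult]

lemma matrix_has_vector_derivative_mult:
  fixes A B :: "real \<Rightarrow> complex^'n^'n"
  assumes "(A has_vector_derivative A') (at t)" "(B has_vector_derivative B') (at t)"
  shows "((\<lambda>t. A t ** B t) has_vector_derivative A t ** B' + A' ** B t) (at t)"
  by (rule bounded_bilinear.has_vector_derivative[OF bounded_bilinear_matrix_mult assms])

lemma matrix_has_vector_derivativeI:
  fixes A :: "real \<Rightarrow> complex^'n^'n"
  assumes "\<And>i j. ((\<lambda>t. A t $ i $ j) has_vector_derivative A' $ i $ j) (at t)"
  shows "(A has_vector_derivative A') (at t)"
  unfolding has_vector_derivative_def Deriv.has_derivative_within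
proof (intro conjI vec_tendstoI bounded_linear_scaleR_left)
  fix i j
  show "((\<lambda>y. ((1 / norm (y - t)) *\<^sub>R (A y - (A t + (y - t) *\<^sub>R A'))) $ i $ j) \<longlongrightarrow> 0 $ i $ j) (at t)"
    using assms[of i j] unfolding has_vector_derivative_def Deriv.has_derivative_within by simp
qed

lemma matrix_has_vector_derivative_entry:
  fixes A :: "real \<Rightarrow> complex^'n^'n"
  assumes "(A has_vector_derivative A') (at t)"
  shows "((\<lambda>t. A t $ i $ j) has_vector_derivative A' $ i $ j) (at t)"
  by (rule bounded_linear.has_vector_derivative[OF bounded_linear_compose[OF
        bounded_linear_vec_nth bounded_linear_vec_nth], OF assms])

section \<open>The exponential of a complex matrix\<close>

primrec matpow :: "complex^'n^'n \<Rightarrow> nat \<Rightarrow> complex^'n^'n" where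
  "matpow M 0 = idm"
| "matpow M (Suc k) = M ** matpow M k"

lemma matpow_Suc_right: "matpow M (Suc k) = matpow M k ** M"
proof (induction k)
  case (Suc k)
  have "matpow M (Suc (Suc k)) = M ** (matpow M k ** M)" using Suc by simp
  then show ?case by (simp add: matrix_mul_assoc)
qed simp

text \<open>Each entry is written as a power series in \<open>t\<close>, so that the scalar theorem
  on termwise differentiation applies to it.\<close>

definition mexp :: "complex^'n^'n \<Rightarrow> real \<Rightarrow> complex^'n^'n" where
  "mexp M t = (\<chi> i j. \<Sum>k. matpow M k $ i $ j / fact k * of_real t ^ k)"

lemma mexp_summable:
  fixes M :: "complex^'n^'n"
  shows "summable (\<lambda>k. matpow M k $ i $ j / fact k * z ^ k)"
proof -
  define c where "c = (\<Sum>i\<in>UNIV. \<Sum>j\<in>UNIV. norm (M $ i $ j))"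
  have c: "(\<Sum>j\<in>UNIV. norm (M $ i $ j)) \<le> c" for i
    unfolding c_def by (rule member_le_sum) (auto intro: sum_nonneg)
  have "norm (matpow M k $ i $ j) \<le> c ^ k" for i j k
  proof (induction k arbitrary: i)
    case (Suc k)
    have "norm (matpow M (Suc k) $ i $ j) \<le> (\<Sum>l\<in>UNIV. norm (M $ i $ l * matpow M k $ l $ j))"
      by (simp add: matrix_mult_entry norm_sum)
    also have "\<dots> \<le> (\<Sum>l\<in>UNIV. norm (M $ i $ l) * c ^ k)"
      by (intro sum_mono) (simp add: norm_mult mult_left_mono Suc)
    also have "\<dots> = (\<Sum>l\<in>UNIV. norm (M $ i $ l)) * c ^ k" by (simp add: sum_distrib_right)
    also have "\<dots> \<le> c * c ^ k"
      using order_trans[OF norm_ge_zero Suc] by (intro mult_right_mono c) auto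
    finally show ?case by simp
  qed (simp add: idm_entry)
  then have "norm (matpow M k $ i $ j / fact k * z ^ k) \<le> c ^ k * norm z ^ k / fact k" for k
    by (simp add: norm_mult norm_divide norm_power divide_right_mono mult_right_mono)
  then have "norm (matpow M k $ i $ j / fact k * z ^ k) \<le> inverse (fact k) * (c * norm z) ^ k" for k
    by (simp add: power_mult_distrib field_simps)
  then show ?thesis by (intro summable_comparison_test[OF _ summable_exp[of "c * norm z"]]) auto
qed

lemma mexp_0: "mexp M 0 = idm"
  by (rule matrix_eqI) (simp only: mexp_def vec_lambda_beta of_real_0 powser_zero, simp)

lemma mexp_commute: "M ** mexp M t = mexp M t ** M"
proof (rule matrix_eqI)
  fix i j
  define e where "e k = of_real t ^ k / (fact k :: complex)" for k
  define f where "f i j k = matpow M k $ i $ j * e k" for i j k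
  have f: "f i j = (\<lambda>k. matpow M k $ i $ j / fact k * of_real t ^ k)" for i j
    by (auto simp: f_def e_def)
  have summable: "summable (f i j)" for i j unfolding f by (rule mexp_summable)
  have me: "mexp M t $ i $ j = suminf (f i j)" for i j by (simp add: mexp_def f)
  have "(M ** mexp M t) $ i $ j = (\<Sum>k. \<Sum>l\<in>UNIV. M $ i $ l * f l j k)"
    by (simp add: matrix_mult_entry me suminf_mult summable suminf_sum summable_mult)
  also have "(\<lambda>k. \<Sum>l\<in>UNIV. M $ i $ l * f l j k) = (\<lambda>k. \<Sum>l\<in>UNIV. f i l k * M $ l $ j)"
  proof
    fix k
    have "(\<Sum>l\<in>UNIV. M $ i $ l * f l j k) = (M ** matpow M k) $ i $ j * e k"
      by (simp add: matrix_mult_entry f_def sum_distrib_right mult.assoc)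
    also have "\<dots> = (matpow M k ** M) $ i $ j * e k" using matpow_Suc_right[of M k] by simp
    also have "\<dots> = (\<Sum>l\<in>UNIV. f i l k * M $ l $ j)"
      unfolding matrix_mult_entry f_def sum_distrib_right by (intro sum.cong refl) (simp add: mult_ac)
    finally show "(\<Sum>l\<in>UNIV. M $ i $ l * f l j k) = (\<Sum>l\<in>UNIV. f i l k * M $ l $ j)" .
  qed
  also have "(\<Sum>k. \<Sum>l\<in>UNIV. f i l k * M $ l $ j) = (mexp M t ** M) $ i $ j"
    by (simp add: matrix_mult_entry me suminf_mult2 summable suminf_sum summable_mult2)
  finally show "(M ** mexp M t) $ i $ j = (mexp M t ** M) $ i $ j" .
qed

lemma mexp_has_vector_derivative: "(mexp M has_vector_derivative M ** mexp M t) (at t)"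
proof (rule matrix_has_vector_derivativeI)
  fix i j
  let ?a = "\<lambda>i j k. matpow M k $ i $ j / fact k"
  have "((\<lambda>z. \<Sum>k. ?a i j k * z ^ k) has_field_derivative
      (\<Sum>k. diffs (?a i j) k * of_real t ^ k)) (at (complex_of_real t))"
    by (rule termdiffs_strong_converges_everywhere[OF mexp_summable])
  from has_vector_derivative_real_field[OF this]
  have "((\<lambda>t. mexp M t $ i $ j) has_vector_derivative
      (\<Sum>k. diffs (?a i j) k * of_real t ^ k)) (at t)"
    by (simp add: mexp_def)
  also have "(\<lambda>k. diffs (?a i j) k * of_real t ^ k) =
      (\<lambda>k. \<Sum>l\<in>UNIV. M $ i $ l * (?a l j k * of_real t ^ k))"
  proof
    fix k
    have "diffs (?a i j) k = (\<Sum>l\<in>UNIV. M $ i $ l * matpow M k $ l $ j) / fact k"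
      by (simp add: diffs_def matrix_mult_entry del: of_nat_Suc)
    then show "diffs (?a i j) k * of_real t ^ k =
        (\<Sum>l\<in>UNIV. M $ i $ l * (?a l j k * of_real t ^ k))"
      by (simp add: sum_divide_distrib sum_distrib_right mult.assoc)
  qed
  also have "(\<Sum>k. \<Sum>l\<in>UNIV. M $ i $ l * (?a l j k * of_real t ^ k)) = (M ** mexp M t) $ i $ j"
  proof -
    define f where "f i j k = ?a i j k * of_real t ^ k" for i j k
    have summable: "summable (f i j)" for i j unfolding f_def by (rule mexp_summable)
    have me: "mexp M t $ i $ j = (\<Sum>k. f i j k)" for i j by (simp only: mexp_def f_def vec_lambda_beta)
    show ?thesis unfolding f_def[symmetric]
      by (simp add: matrix_mult_entry me suminf_mult summable suminf_sum summable_mult)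
  qed
  finally show "((\<lambda>t. mexp M t $ i $ j) has_vector_derivative (M ** mexp M t) $ i $ j) (at t)" .
qed

text \<open>The product \<open>mexp M (- s) ** mexp M (s + t)\<close> has derivative 0 in
  \<open>s\<close>, because \<open>M\<close> commutes with its exponential. Comparing its values at
  0 and at \<open>s\<close> gives the group law.\<close>

lemma mexp_add:
  fixes M :: "complex^'n^'n"
  shows "mexp M (s + t) = mexp M s ** mexp M t"
proof -
  have const: "mexp M (- s) ** mexp M (s + t) = mexp M t" for s t
  proof -
    have "((\<lambda>s. mexp M (- s) ** mexp M (s + t)) has_vector_derivative 0) (at s)" for s
    proof -
      have "((\<lambda>s. mexp M (- s)) has_vector_derivative (- 1) *\<^sub>R (M ** mexp M (- s))) (at s)"
        using vector_diff_chain_at[of uminus "-1" s "mexp M", OF _ mexp_has_vector_derivative]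
          has_vector_derivative_minus[OF has_vector_derivative_id, of "at s"]
        by (simp add: o_def)
      moreover have "((\<lambda>s. mexp M (s + t)) has_vector_derivative 1 *\<^sub>R (M ** mexp M (s + t))) (at s)"
        using vector_diff_chain_at[of "\<lambda>s. s + t" 1 s "mexp M", OF _ mexp_has_vector_derivative]
          has_vector_derivative_add[OF has_vector_derivative_id[of "at s"] has_vector_derivative_const[of t]]
        by (simp add: o_def)
      ultimately have "((\<lambda>s. mexp M (- s) ** mexp M (s + t)) has_vector_derivative
          mexp M (- s) ** (1 *\<^sub>R (M ** mexp M (s + t))) +
          ((- 1) *\<^sub>R (M ** mexp M (- s))) ** mexp M (s + t)) (at s)"
        by (rule matrix_has_vector_derivative_mult)
      also have "mexp M (- s) ** (1 *\<^sub>R (M ** mexp M (s + t))) +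
          ((- 1) *\<^sub>R (M ** mexp M (- s))) ** mexp M (s + t) = 0"
        unfolding mexp_commute[of M "- s"]
        by (simp add: matrix_mul_assoc bounded_bilinear.minus_left[OF bounded_bilinear_matrix_mult])
      finally show ?thesis .
    qed
    then obtain c where c: "\<And>s. mexp M (- s) ** mexp M (s + t) = c"
      using has_vector_derivative_zero_constant[of UNIV "\<lambda>s. mexp M (- s) ** mexp M (s + t)"] by auto
    from c[of 0] c[of s] show ?thesis by (simp add: mexp_0)
  qed
  have inv: "mexp M (- s) ** mexp M s = idm" for s using const[of s 0] by (simp add: mexp_0)
  have "mexp M s ** (mexp M (- s) ** mexp M (s + t)) = mexp M s ** mexp M t"
    by (simp only: const)
  then show ?thesis using inv[of "- s"] by (simp add: matrix_mul_assoc)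
qed

lemma mexp_minus: "mexp M (- t) ** mexp M t = idm" "mexp M t ** mexp M (- t) = idm"
  using mexp_add[of M "- t" t] mexp_add[of M t "- t"] by (simp_all add: mexp_0)

section \<open>Adjoints, triangular matrices and the QR decomposition\<close>

lemma conj_transpose_entry: "conj_transpose A $ i $ j = cnj (A $ j $ i)"
  by (simp add: conj_transpose_def)

lemma conj_transpose_mult: "conj_transpose (A ** B) = conj_transpose B ** conj_transpose A"
  by (rule matrix_eqI) (simp add: conj_transpose_entry matrix_mult_entry mult.commute)

lemma conj_transpose_idm: "conj_transpose idm = idm"
  by (rule matrix_eqI) (simp add: conj_transpose_entry idm_entry)

lemma conj_transpose_conj_transpose: "conj_transpose (conj_transpose A) = A"
  by (rule matrix_eqI) (simp add: conj_transpose_entry)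

lemma mexp_hermitian:
  assumes "conj_transpose M = M"
  shows "conj_transpose (mexp M t) = mexp M t"
proof (rule matrix_eqI)
  fix i j
  have "conj_transpose (matpow M k) = matpow M k" for k
  proof (induction k)
    case (Suc k)
    have "conj_transpose (matpow M (Suc k)) = matpow M k ** M"
      by (simp add: conj_transpose_mult assms Suc)
    then show ?case by (simp only: matpow_Suc_right)
  qed (simp add: conj_transpose_idm)
  then have p: "cnj (matpow M k $ j $ i) = matpow M k $ i $ j" for k
    by (metis conj_transpose_entry)
  have "cnj (mexp M t $ j $ i) = (\<Sum>k. cnj (matpow M k $ j $ i / fact k * of_real t ^ k))"
    unfolding mexp_def
    by (simp only: vec_lambda_beta bounded_linear.suminf[OF bounded_linear_cnj mexp_summable])
  then show "conj_transpose (mexp M t) $ i $ j = mexp M t $ i $ j"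
    by (simp add: conj_transpose_entry p) (simp add: mexp_def)
qed

text \<open>Multiplication by such a matrix from the right keeps the span of the first
  \<open>k\<close> columns for every \<open>k\<close> and multiplies the left-justified minors of
  each order by a common positive number. Passing to the unitary QR factor thus affects neither the
  flag nor the signs.\<close>

definition upper_tri_pos :: "complex^'n::{finite,linorder}^'n::{finite,linorder} \<Rightarrow> bool" where
  "upper_tri_pos R \<longleftrightarrow> (\<forall>i j. j < i \<longrightarrow> R $ i $ j = 0) \<and> (\<forall>i. R $ i $ i \<in> \<real> \<and> 0 < Re (R $ i $ i))"

lemma upper_tri_pos_idm: "upper_tri_pos idm"
  by (auto simp: upper_tri_pos_def idm_entry)

lemma upper_triangular_mult_entry:
  fixes A B :: "complex^'n::{finite,linorder}^'n::{finite,linorder}"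
  assumes "\<And>i j. j < i \<Longrightarrow> A $ i $ j = 0" "\<And>i j. j < i \<Longrightarrow> B $ i $ j = 0"
  shows "j < i \<Longrightarrow> (A ** B) $ i $ j = 0" "(A ** B) $ i $ i = A $ i $ i * B $ i $ i"
proof -
  show "(A ** B) $ i $ j = 0" if "j < i"
    unfolding matrix_mult_entry
  proof (intro sum.neutral ballI)
    fix k show "A $ i $ k * B $ k $ j = 0"
      using assms(1)[of k i] assms(2)[of j k] that by (cases "k < i") auto
  qed
  have "(A ** B) $ i $ i = (\<Sum>k\<in>{i}. A $ i $ k * B $ k $ i)"
    unfolding matrix_mult_entry
  proof (rule sum.mono_neutral_right)
    show "\<forall>k\<in>UNIV - {i}. A $ i $ k * B $ k $ i = 0"
    proof
      fix k assume "k \<in> UNIV - {i}"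
      then show "A $ i $ k * B $ k $ i = 0"
        using assms(1)[of k i] assms(2)[of i k] by (cases "k < i") auto
    qed
  qed auto
  then show "(A ** B) $ i $ i = A $ i $ i * B $ i $ i" by simp
qed

lemma upper_tri_pos_mult:
  assumes "upper_tri_pos A" "upper_tri_pos B"
  shows "upper_tri_pos (A ** B)"
  using assms unfolding upper_tri_pos_def
  by (auto simp: upper_triangular_mult_entry complex_is_Real_iff)

lemma sum_split_at:
  fixes f :: "'n::{finite,linorder} \<Rightarrow> 'b::comm_monoid_add"
  assumes "\<And>j. p < j \<Longrightarrow> f j = 0"
  shows "sum f UNIV = f p + (\<Sum>j\<in>{..<p}. f j)"
proof -
  have "sum f UNIV = sum f (insert p {..<p})"
  proof (rule sum.mono_neutral_right)
    show "\<forall>j\<in>UNIV - insert p {..<p}. f j = 0"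
      using assms by (metis DiffD2 insertCI lessThan_iff linorder_neqE)
  qed auto
  then show ?thesis by simp
qed

text \<open>Only column \<open>p\<close> is changed: it is made orthogonal to the columns before it
  and normalised. \<open>V\<close> is this column operation and \<open>W\<close> its inverse; with
  both at hand, triangular matrices never have to be inverted.\<close>

lemma gram_schmidt_step:
  fixes Q U :: "complex^'n::{finite,linorder}^'n::{finite,linorder}"
  assumes U: "upper_tri_pos U" and Q: "Q = A ** U" and A: "A' ** A = idm"
    and on: "\<And>a b. a < p \<Longrightarrow> b < p \<Longrightarrow>
      (\<Sum>i\<in>UNIV. cnj (Q $ i $ a) * Q $ i $ b) = (if a = b then 1 else 0)"
  obtains Q' V W where "upper_tri_pos V" "upper_tri_pos W" "Q' = Q ** V" "Q = Q' ** W"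
    "\<forall>a\<le>p. \<forall>b\<le>p. (\<Sum>i\<in>UNIV. cnj (Q' $ i $ a) * Q' $ i $ b) = (if a = b then 1 else 0)"
proof -
  define c where "c j = (\<Sum>i\<in>UNIV. cnj (Q $ i $ j) * Q $ i $ p)" for j
  define w where "w i = Q $ i $ p - (\<Sum>j\<in>{..<p}. c j * Q $ i $ j)" for i
  define s where "s = (\<Sum>i\<in>UNIV. (cmod (w i))\<^sup>2)"
  have w_ne: "\<exists>i. w i \<noteq> 0"
  proof (rule ccontr)
    assume "\<not> ?thesis"
    then have w0: "w i = 0" for i by simp
    \<comment> \<open>\<open>v\<close> collects the coefficients of \<open>w\<close> in the columns
      of \<open>Q\<close>, so \<open>w = 0\<close> forces \<open>U *v v = 0\<close>. But component
      \<open>p\<close> of that vector is the diagonal entry \<open>U $ p $ p\<close>, because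
      \<open>U\<close> is upper triangular and \<open>v\<close> vanishes beyond
      \<open>p\<close>.\<close>
    define v :: "complex^'n::{finite,linorder}" where "v = (\<chi> j. if j = p then 1 else if j < p then - c j else 0)"
    have v: "v $ p = 1" "\<And>j. j < p \<Longrightarrow> v $ j = - c j" "\<And>j. p < j \<Longrightarrow> v $ j = 0"
      by (auto simp: v_def)
    have "(Q *v v) $ i = w i" for i
    proof -
      have "(Q *v v) $ i = Q $ i $ p * v $ p + (\<Sum>j\<in>{..<p}. Q $ i $ j * v $ j)"
        unfolding matrix_vector_mult_def by (subst sum_split_at[of p]) (auto simp: v)
      also have "\<dots> = w i" by (simp add: w_def v sum_negf mult.commute)
      finally show ?thesis .
    qed
    then have "Q *v v = 0" using w0 by (simp add: Finite_Cartesian_Product.vec_eq_iff)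
    then have "A' *v (Q *v v) = 0" by simp
    then have "(U *v v) $ p = 0"
      using A by (simp add: Q matrix_vector_mul_assoc matrix_mul_assoc)
    moreover have "(U *v v) $ p = U $ p $ p * v $ p + (\<Sum>j\<in>{..<p}. U $ p $ j * v $ j)"
      unfolding matrix_vector_mult_def by (subst sum_split_at[of p]) (auto simp: v)
    moreover have "(\<Sum>j\<in>{..<p}. U $ p $ j * v $ j) = 0"
      using U by (intro sum.neutral) (auto simp: upper_tri_pos_def)
    moreover have "U $ p $ p \<noteq> 0" using U by (metis less_irrefl upper_tri_pos_def zero_complex.sel(1))
    ultimately show False by (simp add: v)
  qed
  then obtain i0 where "w i0 \<noteq> 0" ..
  then have s: "0 < s" unfolding s_def by (intro sum_pos2[of UNIV i0]) simp_all
  define \<rho> where "\<rho> = complex_of_real (sqrt s)"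
  have \<rho>: "\<rho> \<noteq> 0" "cnj \<rho> = \<rho>" "\<rho> * \<rho> = of_real s" 
    using s by (simp_all add: \<rho>_def flip: of_real_mult)
  define Q' where "Q' = (\<chi> i j. if j = p then w i / \<rho> else Q $ i $ j)"
  have Q': "Q' $ i $ p = w i / \<rho>" "j < p \<Longrightarrow> Q' $ i $ j = Q $ i $ j" for i j
    by (auto simp: Q'_def)
  define V where "V = (\<chi> j k. if k = p then if j = p then 1 / \<rho> else if j < p then - c j / \<rho> else 0
      else if j = k then 1 else 0)"
  define W where "W = (\<chi> j k. if k = p then if j = p then \<rho> else if j < p then c j else 0
      else if j = k then 1 else 0)"
  have V: "V $ p $ p = 1 / \<rho>" "\<And>j. j < p \<Longrightarrow> V $ j $ p = - c j / \<rho>" "\<And>j. p < j \<Longrightarrow> V $ j $ p = 0"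
    and W: "W $ p $ p = \<rho>" "\<And>j. j < p \<Longrightarrow> W $ j $ p = c j" "\<And>j. p < j \<Longrightarrow> W $ j $ p = 0"
    by (auto simp: V_def W_def)
  show ?thesis
  proof (rule that)
    show "upper_tri_pos V" "upper_tri_pos W"
      using s by (auto simp: upper_tri_pos_def V_def W_def \<rho>_def)
    show "Q' = Q ** V"
    proof (rule matrix_eqI)
      fix i k
      show "Q' $ i $ k = (Q ** V) $ i $ k"
      proof (cases "k = p")
        case True
        have "(Q ** V) $ i $ p = Q $ i $ p * V $ p $ p + (\<Sum>j\<in>{..<p}. Q $ i $ j * V $ j $ p)"
          unfolding matrix_mult_entry by (subst sum_split_at[of p]) (auto simp: V)
        also have "\<dots> = w i / \<rho>"
          by (simp add: V w_def diff_divide_distrib sum_divide_distrib sum_negf mult.commute)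
        finally show ?thesis using True by (simp add: Q'_def)
      next
        case False
        then show ?thesis by (simp add: Q'_def matrix_mult_entry V_def mult_delta_right)
      qed
    qed
    show "Q = Q' ** W"
    proof (rule matrix_eqI)
      fix i k
      show "Q $ i $ k = (Q' ** W) $ i $ k"
      proof (cases "k = p")
        case True
        have "(Q' ** W) $ i $ p = Q' $ i $ p * W $ p $ p + (\<Sum>j\<in>{..<p}. Q' $ i $ j * W $ j $ p)"
          unfolding matrix_mult_entry by (subst sum_split_at[of p]) (auto simp: W)
        also have "\<dots> = Q $ i $ p"
          using \<rho> by (simp add: W Q' w_def mult.commute)
        finally show ?thesis using True by simp
      next
        case False
        then show ?thesis by (simp add: Q'_def matrix_mult_entry W_def mult_delta_right)
      qed
    qed
    have orth: "(\<Sum>i\<in>UNIV. cnj (Q $ i $ a) * w i) = 0" if "a < p" for a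
    proof -
      have "(\<Sum>i\<in>UNIV. cnj (Q $ i $ a) * w i) =
          c a - (\<Sum>j\<in>{..<p}. c j * (\<Sum>i\<in>UNIV. cnj (Q $ i $ a) * Q $ i $ j))"
        unfolding w_def c_def right_diff_distrib sum_subtractf sum_distrib_left
        by (subst sum.swap) (simp add: mult_ac)
      also have "(\<Sum>j\<in>{..<p}. c j * (\<Sum>i\<in>UNIV. cnj (Q $ i $ a) * Q $ i $ j)) = (\<Sum>j\<in>{..<p}. if a = j then c j else 0)"
        using that on by (intro sum.cong) auto
      finally show ?thesis using that by simp
    qed
    have orth': "(\<Sum>i\<in>UNIV. cnj (w i) * Q $ i $ a) = 0" if "a < p" for a
      using arg_cong[OF orth[OF that], of cnj] by (simp add: mult.commute)
    have nrm: "(\<Sum>i\<in>UNIV. cnj (w i) * w i) = of_real s"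
      unfolding s_def of_real_sum by (intro sum.cong refl) (simp add: complex_norm_square mult.commute del: of_real_power)
    show "\<forall>a\<le>p. \<forall>b\<le>p. (\<Sum>i\<in>UNIV. cnj (Q' $ i $ a) * Q' $ i $ b) = (if a = b then 1 else 0)"
    proof (intro allI impI)
      fix a b assume ab: "a \<le> p" "b \<le> p"
      then consider "a < p" "b < p" | "a < p" "b = p" | "a = p" "b < p" | "a = p" "b = p"
        unfolding le_less by blast
      then show "(\<Sum>i\<in>UNIV. cnj (Q' $ i $ a) * Q' $ i $ b) = (if a = b then 1 else 0)"
      proof cases
        case 1
        then show ?thesis using on[of a b] by (simp add: Q')
      next
        case 2
        then show ?thesis using orth[of a] by (auto simp: Q'_def simp flip: sum_divide_distrib)
      next
        case 3
        then show ?thesis using orth'[of b] by (auto simp: Q'_def \<rho> simp flip: sum_divide_distrib)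
      next
        case 4
        then show ?thesis using nrm \<rho> by (auto simp: Q'_def simp flip: sum_divide_distrib)
      qed
    qed
  qed
qed

lemma qr_decomposition:
  fixes A :: "complex^'n::{finite,linorder}^'n::{finite,linorder}"
  assumes A: "A' ** A = idm"
  obtains q R U where "q \<in> unitary_group" "upper_tri_pos R" "upper_tri_pos U" "A = q ** R" "q = A ** U"
proof -
  have "\<exists>Q R U. upper_tri_pos R \<and> upper_tri_pos U \<and> A = Q ** R \<and> Q = A ** U \<and>
      (\<forall>a b. card {..<a} < m \<longrightarrow> card {..<b} < m \<longrightarrow>
        (\<Sum>i\<in>UNIV. cnj (Q $ i $ a) * Q $ i $ b) = (if a = b then 1 else 0))"
    if "m \<le> CARD('n)" for m
    using that
  proof (induction m)
    case 0
    show ?case by (intro exI[of _ A] exI[of _ idm]) (simp add: upper_tri_pos_idm)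
  next
    case (Suc m)
    then obtain Q R U where IH: "upper_tri_pos R" "upper_tri_pos U" "A = Q ** R" "Q = A ** U"
      "\<And>a b. card {..<a} < m \<Longrightarrow> card {..<b} < m \<Longrightarrow>
        (\<Sum>i\<in>UNIV. cnj (Q $ i $ a) * Q $ i $ b) = (if a = b then 1 else 0)" by auto
    define p :: 'n where "p = nth_index m"
    have cp: "card {..<p} = m" using Suc.prems by (simp add: p_def card_lessThan_nth_index)
    have lt: "card {..<a} < m \<longleftrightarrow> a < p" for a
    proof
      assume "card {..<a} < m"
      then show "a < p" using cp by (metis card_mono finite lessThan_subset_iff not_le)
    next
      assume "a < p"
      then show "card {..<a} < m" unfolding cp[symmetric] by (intro psubset_card_mono) auto
    qed
    have le: "a \<le> p" if "card {..<a} < Suc m" for a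
    proof (rule ccontr)
      assume "\<not> a \<le> p"
      then have "insert p {..<p} \<subseteq> {..<a}" by auto
      then have "card (insert p {..<p}) \<le> card {..<a}" by (intro card_mono) auto
      then show False using that cp by simp
    qed
    obtain Q' V W where s: "upper_tri_pos V" "upper_tri_pos W" "Q' = Q ** V" "Q = Q' ** W"
      "\<forall>a\<le>p. \<forall>b\<le>p. (\<Sum>i\<in>UNIV. cnj (Q' $ i $ a) * Q' $ i $ b) = (if a = b then 1 else 0)"
      by (rule gram_schmidt_step[OF IH(2,4) A IH(5)[unfolded lt]])
    show ?case
    proof (rule exI[of _ Q'], rule exI[of _ "W ** R"], rule exI[of _ "U ** V"], intro conjI allI impI)
      show "A = Q' ** (W ** R)" using s(4) IH(3) by (simp add: matrix_mul_assoc)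
      show "Q' = A ** (U ** V)" using s(3) IH(4) by (simp add: matrix_mul_assoc)
      show "upper_tri_pos (W ** R)" "upper_tri_pos (U ** V)"
        using s(1,2) IH(1,2) by (simp_all only: upper_tri_pos_mult)
      show "(\<Sum>i\<in>UNIV. cnj (Q' $ i $ a) * Q' $ i $ b) = (if a = b then 1 else 0)"
        if "card {..<a} < Suc m" "card {..<b} < Suc m" for a b
        using s(5) le[OF that(1)] le[OF that(2)] by blast
    qed
  qed
  from this[OF order_refl] obtain Q R U where *: "upper_tri_pos R" "upper_tri_pos U" "A = Q ** R" "Q = A ** U"
      "\<And>a b. card {..<a} < CARD('n) \<Longrightarrow> card {..<b} < CARD('n) \<Longrightarrow>
        (\<Sum>i\<in>UNIV. cnj (Q $ i $ a) * Q $ i $ b) = (if a = b then 1 else 0)" by auto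
  have "card {..<a} < CARD('n)" for a :: 'n by (rule psubset_card_mono) auto
  then have "conj_transpose Q ** Q = idm"
    using *(5) by (intro matrix_eqI) (simp add: matrix_mult_entry conj_transpose_entry idm_entry)
  then have "Q \<in> unitary_group" by (simp add: unitary_group_def matrix_left_right_inverse)
  then show ?thesis using that * by blast
qed

section \<open>The Kaehler gradient in an eigenbasis\<close>

lemma unitary_groupD:
  assumes "g \<in> unitary_group"
  shows "g ** conj_transpose g = idm" "conj_transpose g ** g = idm"
  using assms by (simp_all add: unitary_group_def)

lemma unitary_group_conj_transpose: "g \<in> unitary_group \<Longrightarrow> conj_transpose g \<in> unitary_group"
  by (simp add: unitary_group_def conj_transpose_conj_transpose)

lemma matrix_inv_unitary:
  assumes "g \<in> unitary_group"
  shows "matrix_inv g = conj_transpose g"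
proof -
  have "\<exists>A'. g ** A' = idm \<and> A' ** g = idm" using unitary_groupD[OF assms] by blast
  then have "matrix_inv g ** g = idm" unfolding matrix_inv_def by (rule someI2_ex) simp
  then have "matrix_inv g ** (g ** conj_transpose g) = conj_transpose g"
    by (simp add: matrix_mul_assoc)
  then show ?thesis by (simp add: unitary_groupD[OF assms])
qed

definition conjug :: "complex^'n^'n \<Rightarrow> complex^'n^'n \<Rightarrow> complex^'n^'n" where
  "conjug g A = g ** A ** conj_transpose g"

lemma adj_act_unitary: "g \<in> unitary_group \<Longrightarrow> adj_act lam g = conjug g (cscale \<i> (Diag lam))"
  by (simp add: adj_act_def conjug_def matrix_inv_unitary)

lemma linear_conjug: "linear (conjug g)"
  unfolding conjug_def
  by (rule linearI) (simp_all add: bounded_bilinear.add_left[OF bounded_bilinear_matrix_mult]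
      bounded_bilinear.add_right[OF bounded_bilinear_matrix_mult]
      bounded_bilinear.scaleR_left[OF bounded_bilinear_matrix_mult]
      bounded_bilinear.scaleR_right[OF bounded_bilinear_matrix_mult])

lemma conjug_mult:
  assumes "g \<in> unitary_group"
  shows "conjug g A ** conjug g B = conjug g (A ** B)"
proof -
  have "conjug g A ** conjug g B = g ** A ** (conj_transpose g ** g) ** B ** conj_transpose g"
    by (simp only: conjug_def matrix_mul_assoc)
  then show ?thesis by (simp add: unitary_groupD[OF assms] conjug_def matrix_mul_assoc)
qed

lemma conj_transpose_conjug: "conj_transpose (conjug g A) = conjug g (conj_transpose A)"
  by (simp add: conjug_def conj_transpose_mult conj_transpose_conj_transpose matrix_mul_assoc)

lemma conjug_inverse:
  assumes "g \<in> unitary_group"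
  shows "conjug g (conjug (conj_transpose g) A) = A" "conjug (conj_transpose g) (conjug g A) = A"
proof -
  have "conjug g (conjug (conj_transpose g) A) =
      (g ** conj_transpose g) ** A ** (g ** conj_transpose g)"
    "conjug (conj_transpose g) (conjug g A) =
      (conj_transpose g ** g) ** A ** (conj_transpose g ** g)"
    by (simp_all only: conjug_def conj_transpose_conj_transpose matrix_mul_assoc)
  then show "conjug g (conjug (conj_transpose g) A) = A" "conjug (conj_transpose g) (conjug g A) = A"
    by (simp_all add: unitary_groupD[OF assms])
qed

lemma conjug_unitary_algebra:
  assumes "g \<in> unitary_group"
  shows "conjug g A \<in> unitary_algebra \<longleftrightarrow> A \<in> unitary_algebra"
proof -
  have "conj_transpose A = - A" if "conjug g (conj_transpose A) = conjug g (- A)"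
    using arg_cong[OF that, of "conjug (conj_transpose g)"] by (simp add: conjug_inverse assms)
  then show ?thesis
    by (auto simp: unitary_algebra_def conj_transpose_conjug linear_neg[OF linear_conjug, symmetric])
qed

lemma trace_conjug:
  assumes "g \<in> unitary_group"
  shows "trace (conjug g A) = trace A"
  unfolding conjug_def by (subst trace_mul_sym) (simp add: matrix_mul_assoc unitary_groupD[OF assms])

lemma ad_conjug:
  assumes "g \<in> unitary_group"
  shows "ad (conjug g A) (conjug g B) = conjug g (ad A B)"
  by (simp add: ad_def conjug_mult[OF assms] linear_diff[OF linear_conjug])

text \<open>The Hadamard product with a fixed array. For diagonal \<open>L\<close> both
  \<open>ad L\<close> and its absolute value are of this form.\<close>

definition had :: "('n \<Rightarrow> 'n \<Rightarrow> complex) \<Rightarrow> complex^'n^'n \<Rightarrow> complex^'n^'n" where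
  "had h A = (\<chi> j k. h j k * A $ j $ k)"

lemma linear_had: "linear (had h)"
  unfolding had_def by (rule linearI) (auto intro!: matrix_eqI simp: algebra_simps)

lemma ad_Diag: "ad (cscale \<i> (Diag lam)) A = had (\<lambda>j k. \<i> * of_real (lam $ j - lam $ k)) A"
proof (rule matrix_eqI)
  fix j k
  let ?D = "cscale \<i> (Diag lam)"
  have "(?D ** A) $ j $ k = (\<Sum>l\<in>UNIV. if l = j then \<i> * of_real (lam $ j) * A $ j $ k else 0)"
    unfolding matrix_mult_entry by (rule sum.cong) (auto simp: cscale_def Diag_def)
  moreover have "(A ** ?D) $ j $ k = (\<Sum>l\<in>UNIV. if l = k then \<i> * of_real (lam $ k) * A $ j $ k else 0)"
    unfolding matrix_mult_entry by (rule sum.cong) (auto simp: cscale_def Diag_def)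
  ultimately show "ad ?D A $ j $ k = had (\<lambda>j k. \<i> * of_real (lam $ j - lam $ k)) A $ j $ k"
    by (simp add: ad_def had_def algebra_simps)
qed

lemma cscale_Diag_unitary_algebra: "cscale \<i> (Diag lam) \<in> unitary_algebra"
  by (simp add: unitary_algebra_entry cscale_def Diag_def)

definition tangent_at_Diag :: "real^'n \<Rightarrow> (complex^'n^'n) set" where
  "tangent_at_Diag lam = {A \<in> unitary_algebra. \<forall>j k. lam $ j = lam $ k \<longrightarrow> A $ j $ k = 0}"

lemma subspace_tangent_at_Diag: "subspace (tangent_at_Diag lam)"
  using subspace_unitary_algebra by (auto simp: tangent_at_Diag_def subspace_def)

text \<open>At equal eigenvalues the quotient is the junk value \<open>x / 0 = 0\<close>, as it should be.\<close>

definition ad_Diag_inv :: "real^'n \<Rightarrow> complex^'n^'n \<Rightarrow> complex^'n^'n" where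
  "ad_Diag_inv lam A = (\<chi> j k. A $ j $ k / (\<i> * of_real (lam $ j - lam $ k)))"

lemma ad_Diag_inv:
  assumes "A \<in> tangent_at_Diag lam"
  shows "ad_Diag_inv lam A \<in> tangent_at_Diag lam"
    and "ad (cscale \<i> (Diag lam)) (ad_Diag_inv lam A) = A"
proof -
  have "cnj (ad_Diag_inv lam A $ j $ i) = - ad_Diag_inv lam A $ i $ j" for i j
  proof -
    have "cnj (A $ j $ i) = - A $ i $ j" using assms by (simp add: tangent_at_Diag_def unitary_algebra_entry)
    moreover have "cnj (\<i> * of_real (lam $ j - lam $ i)) = \<i> * of_real (lam $ i - lam $ j)"
      by (simp add: algebra_simps)
    ultimately show ?thesis by (simp add: ad_Diag_inv_def)
  qed
  then show "ad_Diag_inv lam A \<in> tangent_at_Diag lam"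
    by (simp add: tangent_at_Diag_def unitary_algebra_entry) (simp add: ad_Diag_inv_def)
  show "ad (cscale \<i> (Diag lam)) (ad_Diag_inv lam A) = A"
    unfolding ad_Diag using assms
    by (intro matrix_eqI) (auto simp: had_def ad_Diag_inv_def tangent_at_Diag_def)
qed

lemma im_ad_adj_act:
  assumes g: "g \<in> unitary_group"
  shows "im_ad (adj_act lam g) = conjug g ` tangent_at_Diag lam"
proof (intro equalityI subsetI)
  let ?D = "cscale \<i> (Diag lam)"
  fix V assume "V \<in> im_ad (adj_act lam g)"
  then obtain X where X: "X \<in> unitary_algebra" "V = ad (conjug g ?D) X"
    by (auto simp: im_ad_def adj_act_unitary[OF g])
  define Y where "Y = conjug (conj_transpose g) X"
  have XY: "X = conjug g Y" by (simp add: Y_def conjug_inverse[OF g])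
  then have Y: "Y \<in> unitary_algebra" using X conjug_unitary_algebra[OF g] by simp
  have "V = conjug g (ad ?D Y)" by (simp add: X XY ad_conjug[OF g])
  moreover have "ad ?D Y \<in> tangent_at_Diag lam"
    using ad_in_unitary_algebra[OF cscale_Diag_unitary_algebra Y, of lam]
    by (auto simp: tangent_at_Diag_def ad_Diag) (simp add: had_def)
  ultimately show "V \<in> conjug g ` tangent_at_Diag lam" by blast
next
  let ?D = "cscale \<i> (Diag lam)"
  fix V assume "V \<in> conjug g ` tangent_at_Diag lam"
  then obtain A where A: "A \<in> tangent_at_Diag lam" "V = conjug g A" by auto
  have "V = ad (adj_act lam g) (conjug g (ad_Diag_inv lam A))"
    by (simp add: A adj_act_unitary[OF g] ad_conjug[OF g] ad_Diag_inv)
  moreover have "conjug g (ad_Diag_inv lam A) \<in> unitary_algebra"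
    using ad_Diag_inv(1)[OF A(1)] by (simp add: conjug_unitary_algebra[OF g] tangent_at_Diag_def)
  ultimately show "V \<in> im_ad (adj_act lam g)" unfolding im_ad_def by blast
qed

lemma adj_act_unitary_algebra:
  assumes g: "g \<in> unitary_group"
  shows "adj_act lam g \<in> unitary_algebra"
  by (simp add: adj_act_unitary[OF g] conjug_unitary_algebra[OF g] cscale_Diag_unitary_algebra)

lemma Re_mult_cnj_same: "Re (z * cnj z) = (cmod z)\<^sup>2"
  by (simp add: cmod_power2) (simp add: power2_eq_square)

lemma Re_of_real_mult: "Re (of_real c * z) = c * Re z"
  by simp

text \<open>The preimages \<open>ad_Diag_inv lam A\<close> and \<open>ad_Diag_inv lam B\<close>
  vanish at equal eigenvalues, so after conjugation they already lie in the image of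
  \<open>ad\<close> and are their own projections. Their diagonals are 0, which kills the product of
  traces in \<open>kappa\<close>. At equal eigenvalues the summands are the harmless
  \<open>0 / 0 = 0\<close>.\<close>

lemma normal_metric_conjug:
  fixes g :: "complex^'n^'n"
  assumes g: "g \<in> unitary_group" and A: "A \<in> tangent_at_Diag lam" and B: "B \<in> tangent_at_Diag lam"
  shows "normal_metric (adj_act lam g) (conjug g A) (conjug g B) =
    2 * CARD('n) * (\<Sum>j\<in>UNIV. \<Sum>k\<in>UNIV. Re (A $ j $ k * cnj (B $ j $ k)) / (lam $ j - lam $ k)\<^sup>2)"
proof -
  let ?L = "adj_act lam g" and ?X = "ad_Diag_inv lam A" and ?Y = "ad_Diag_inv lam B"
  note L = adj_act_unitary_algebra[OF g, of lam]
  have X: "?X \<in> tangent_at_Diag lam" and Y: "?Y \<in> tangent_at_Diag lam"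
    using ad_Diag_inv(1)[OF A] ad_Diag_inv(1)[OF B] by blast+
  have u: "conjug g Z \<in> unitary_algebra" if "Z \<in> tangent_at_Diag lam" for Z
    using that by (simp add: conjug_unitary_algebra[OF g] tangent_at_Diag_def)
  have part: "im_ad_part ?L (conjug g Z) = conjug g Z" if Z: "Z \<in> tangent_at_Diag lam" for Z
    unfolding im_ad_part_def
  proof (rule the1_equality[OF ex1_im_ad_part[OF L u[OF Z]]])
    show "conjug g Z \<in> im_ad ?L \<and> conjug g Z - conjug g Z \<in> ker_ad ?L"
      using Z subspace_0[OF subspace_unitary_algebra]
      by (auto simp: im_ad_adj_act[OF g] ker_ad_def linear_0[OF linear_ad])
  qed
  have tr: "trace Z = 0" if "Z \<in> tangent_at_Diag lam" for Z
    using that by (simp add: trace_def tangent_at_Diag_def)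
  have "conjug g A = ad ?L (conjug g ?X)" "conjug g B = ad ?L (conjug g ?Y)"
    by (simp_all add: adj_act_unitary[OF g] ad_conjug[OF g] ad_Diag_inv A B)
  then have "normal_metric ?L (conjug g A) (conjug g B) = - Re (kappa (conjug g ?X) (conjug g ?Y))"
    by (simp add: normal_metric_ad[OF L u[OF X] u[OF Y]] part X Y)
  also have "kappa (conjug g ?X) (conjug g ?Y) = 2 * of_nat CARD('n) * trace (?X ** ?Y)"
    by (simp add: kappa_def conjug_mult[OF g] trace_conjug[OF g] tr X)
  also have "trace (?X ** ?Y) =
      (\<Sum>j\<in>UNIV. \<Sum>k\<in>UNIV. - (A $ j $ k * cnj (B $ j $ k) / of_real ((lam $ j - lam $ k)\<^sup>2)))"
    unfolding trace_def matrix_mult_entry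
  proof (intro sum.cong refl)
    fix j k
    have ii: "\<i> * d * (\<i> * d) = - (d * d)" for d
      by (simp add: mult.assoc mult.left_commute[of d \<i>])
    have "cnj (?Y $ j $ k) = - ?Y $ k $ j"
      using Y by (simp add: tangent_at_Diag_def unitary_algebra_entry)
    then have "?Y $ k $ j = - cnj (?Y $ j $ k)" by simp
    then show "?X $ j $ k * ?Y $ k $ j = - (A $ j $ k * cnj (B $ j $ k) / of_real ((lam $ j - lam $ k)\<^sup>2))"
      by (simp add: ad_Diag_inv_def power2_eq_square ii)
  qed
  finally show ?thesis
    by (simp add: sum_negf sum_distrib_left Re_divide_of_real flip: of_real_diff of_real_power
        del: times_complex.sel of_real_diff of_real_power) (simp add: sum_distrib_left)
qed

lemma tangent_norm_zero:
  fixes lam :: "real^'n"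
  assumes A: "A \<in> tangent_at_Diag lam"
    and c: "\<And>j k. lam $ j \<noteq> lam $ k \<Longrightarrow> 0 < c j k" "\<And>j k. 0 \<le> c j k"
    and le: "(\<Sum>j\<in>UNIV. \<Sum>k\<in>UNIV. c j k * (cmod (A $ j $ k))\<^sup>2) \<le> 0"
  shows "A = 0"
proof (rule matrix_eqI)
  fix j k
  show "A $ j $ k = 0 $ j $ k"
  proof (cases "lam $ j = lam $ k")
    case True
    then show ?thesis using A by (simp add: tangent_at_Diag_def)
  next
    case False
    have "c j k * (cmod (A $ j $ k))\<^sup>2 \<le> (\<Sum>k\<in>UNIV. c j k * (cmod (A $ j $ k))\<^sup>2)"
      by (rule member_le_sum) (auto simp: c(2))
    also have "\<dots> \<le> (\<Sum>j\<in>UNIV. \<Sum>k\<in>UNIV. c j k * (cmod (A $ j $ k))\<^sup>2)"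
      by (rule member_le_sum[of j UNIV "\<lambda>j. \<Sum>k\<in>UNIV. c j k * (cmod (A $ j $ k))\<^sup>2"])
        (auto simp: c(2) intro!: sum_nonneg)
    also note le
    finally show ?thesis using c(1)[OF False] by (simp add: mult_le_0_iff)
  qed
qed

abbreviation absdiff :: "real^'n \<Rightarrow> 'n \<Rightarrow> 'n \<Rightarrow> complex" where
  "absdiff lam j k \<equiv> of_real \<bar>lam $ j - lam $ k\<bar>"

lemma had_tangent_at_Diag:
  assumes "A \<in> tangent_at_Diag lam" "\<And>j k. c j k = (c k j :: real)"
  shows "had (\<lambda>j k. of_real (c j k)) A \<in> tangent_at_Diag lam"
  using assms by (simp add: tangent_at_Diag_def unitary_algebra_entry had_def)

text \<open>Shows that the choice in \<open>sqrt_neg_ad_sq\<close> is made from a nonempty set;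
  \<open>pos_sqrt_unique\<close> then identifies the chosen operator with this one on the tangent
  space.\<close>

lemma is_pos_sqrt_absdiff:
  fixes g :: "complex^'n^'n" and lam :: "real^'n"
  assumes g: "g \<in> unitary_group"
  defines "L \<equiv> adj_act lam g"
  shows "is_pos_sqrt (im_ad L) (normal_metric L) (\<lambda>V. - ad L (ad L V))
    (\<lambda>V. conjug g (had (absdiff lam) (conjug (conj_transpose g) V)))"
proof -
  let ?S = "\<lambda>V. conjug g (had (absdiff lam) (conjug (conj_transpose g) V))"
  have S: "?S (conjug g A) = conjug g (had (absdiff lam) A)" for A
    by (simp add: conjug_inverse[OF g])
  note T = had_tangent_at_Diag[where c = "\<lambda>j k. \<bar>lam $ j - lam $ k\<bar>", OF _ abs_minus_commute]
  have ad: "ad L (conjug g A) = conjug g (had (\<lambda>j k. \<i> * of_real (lam $ j - lam $ k)) A)" for A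
    by (simp add: L_def adj_act_unitary[OF g] ad_conjug[OF g] ad_Diag)
  have sq: "had (absdiff lam) (had (absdiff lam) A) =
      - had (\<lambda>j k. \<i> * of_real (lam $ j - lam $ k)) (had (\<lambda>j k. \<i> * of_real (lam $ j - lam $ k)) A)" for A
  proof (rule matrix_eqI)
    fix j k
    have "of_real \<bar>x\<bar> * (of_real \<bar>x\<bar> * a) = - (\<i> * of_real x * (\<i> * of_real x * a))"
      for x :: real and a
    proof -
      have "of_real \<bar>x\<bar> * of_real \<bar>x\<bar> = (of_real x * of_real x :: complex)"
        by (simp flip: of_real_mult)
      then have "of_real \<bar>x\<bar> * (of_real \<bar>x\<bar> * a) = of_real x * (of_real x * a)"
        by (simp flip: mult.assoc)
      then show ?thesis by (simp add: mult.assoc mult.left_commute[of "of_real x" \<i>])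
    qed
    then show "had (absdiff lam) (had (absdiff lam) A) $ j $ k =
      (- had (\<lambda>j k. \<i> * of_real (lam $ j - lam $ k)) (had (\<lambda>j k. \<i> * of_real (lam $ j - lam $ k)) A)) $ j $ k"
      by (simp add: had_def del: of_real_diff)
  qed
  show ?thesis unfolding is_pos_sqrt_def im_ad_adj_act[OF g] L_def
  proof (intro conjI ballI)
    show "linear ?S"
      using linear_compose[OF linear_compose[OF linear_conjug linear_had] linear_conjug]
      by (simp add: o_def)
    fix V assume "V \<in> conjug g ` tangent_at_Diag lam"
    then obtain A where A: "A \<in> tangent_at_Diag lam" "V = conjug g A" by auto
    show "?S V \<in> conjug g ` tangent_at_Diag lam" using T[OF A(1)] by (simp add: A S)
    show "?S (?S V) = - ad (adj_act lam g) (ad (adj_act lam g) V)"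
      unfolding A S by (simp add: ad[unfolded L_def] sq linear_neg[OF linear_conjug])
    show "0 \<le> normal_metric (adj_act lam g) (?S V) V"
    proof -
      have "Re (had (absdiff lam) A $ j $ k * cnj (A $ j $ k)) =
          \<bar>lam $ j - lam $ k\<bar> * (cmod (A $ j $ k))\<^sup>2" for j k
        by (simp add: had_def mult.assoc Re_of_real_mult Re_mult_cnj_same del: times_complex.sel)
      then show ?thesis unfolding A S
        by (subst normal_metric_conjug[OF g T[OF A(1)] A(1)])
          (simp add: sum_nonneg del: times_complex.sel)
    qed
    fix W assume "W \<in> conjug g ` tangent_at_Diag lam"
    then obtain B where B: "B \<in> tangent_at_Diag lam" "W = conjug g B" by auto
    show "normal_metric (adj_act lam g) (?S V) W = normal_metric (adj_act lam g) V (?S W)"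
      unfolding A B S normal_metric_conjug[OF g T[OF A(1)] B(1)] normal_metric_conjug[OF g A(1) T[OF B(1)]]
      by (simp add: had_def algebra_simps)
  qed
qed

text \<open>An eigenvector of \<open>S \<circ> S\<close> for \<open>c\<^sup>2\<close> with \<open>c > 0\<close> is an eigenvector of \<open>S\<close> for \<open>c\<close>: the
  vector \<open>S V - c V\<close> is an eigenvector of \<open>S\<close> for the negative number \<open>- c\<close>.\<close>

lemma pos_sqrt_unique:
  fixes g :: "complex^'n^'n"
  assumes g: "g \<in> unitary_group"
    and S: "is_pos_sqrt (im_ad (adj_act lam g)) (normal_metric (adj_act lam g))
      (\<lambda>V. - ad (adj_act lam g) (ad (adj_act lam g) V)) S"
    and A: "A \<in> tangent_at_Diag lam"
  shows "S (conjug g A) = conjug g (had (absdiff lam) A)"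
proof -
  let ?L = "adj_act lam g"
  let ?S = "\<lambda>V. conjug g (had (absdiff lam) (conjug (conj_transpose g) V))"
  \<comment> \<open>The component of \<open>A\<close> in the eigenspace of the Hadamard operator for
    the eigenvalue \<open>c\<close>. On such components \<open>S\<close> can be determined one
    eigenvalue at a time.\<close>
  define part where "part c = had (\<lambda>j k. of_real (if \<bar>lam $ j - lam $ k\<bar> = c then 1 else 0)) A" for c
  define C where "C = range (\<lambda>(j, k). \<bar>lam $ j - lam $ k\<bar>)"
  have C: "finite C" by (simp add: C_def)
  have part: "part c \<in> tangent_at_Diag lam" for c
    unfolding part_def by (rule had_tangent_at_Diag[OF A]) (simp add: abs_minus_commute)
  have hp: "had (absdiff lam) (part c) = c *\<^sub>R part c" for c
    by (rule matrix_eqI) (auto simp: had_def part_def scaleR_conv_of_real[symmetric])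
  have sum_part: "(\<Sum>c\<in>C. part c) = A"
  proof (rule matrix_eqI)
    fix j k
    have "\<bar>lam $ j - lam $ k\<bar> \<in> C" unfolding C_def by (rule range_eqI[of _ _ "(j, k)"]) simp
    then show "(\<Sum>c\<in>C. part c) $ j $ k = A $ j $ k"
      using C by (simp add: part_def had_def if_distrib[of "\<lambda>x. of_real x * _"] cong: if_cong)
  qed
  have lin: "linear S" using S by (simp add: is_pos_sqrt_def)
  have eig: "S (conjug g (part c)) = c *\<^sub>R conjug g (part c)" for c
  proof (cases "0 < c")
    case False
    have "part c = 0"
    proof (rule matrix_eqI)
      fix j k
      show "part c $ j $ k = 0 $ j $ k"
        using A False by (cases "lam $ j = lam $ k") (auto simp: part_def had_def tangent_at_Diag_def)
    qed
    then show ?thesis by (simp add: linear_0[OF linear_conjug] linear_0[OF lin])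
  next
    case True
    let ?V = "conjug g (part c)"
    have V: "?V \<in> im_ad ?L" using part by (auto simp: im_ad_adj_act[OF g])
    have SSV: "S (S ?V) = (c * c) *\<^sub>R ?V"
    proof -
      have "S (S ?V) = - ad ?L (ad ?L ?V)" using S V by (simp add: is_pos_sqrt_def)
      also have "\<dots> = ?S (?S ?V)"
        using is_pos_sqrt_absdiff[OF g, of lam] V by (simp add: is_pos_sqrt_def)
      also have "\<dots> = (c * c) *\<^sub>R ?V"
        by (simp add: conjug_inverse[OF g] hp linear_scale[OF linear_conjug] linear_scale[OF linear_had])
      finally show ?thesis .
    qed
    define W where "W = S ?V - c *\<^sub>R ?V"
    have "W \<in> im_ad ?L" unfolding W_def using S V subspace_im_ad[of ?L]
      by (intro subspace_diff subspace_scale) (auto simp: is_pos_sqrt_def)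
    then obtain B where B: "B \<in> tangent_at_Diag lam" "W = conjug g B"
      by (auto simp: im_ad_adj_act[OF g])
    have SW: "S W = conjug g ((- c) *\<^sub>R B)"
    proof -
      have "S W = (- c) *\<^sub>R W"
        unfolding W_def by (simp add: linear_diff[OF lin] linear_scale[OF lin] SSV scaleR_diff_right)
      then show ?thesis by (simp add: B linear_scale[OF linear_conjug] linear_neg[OF linear_conjug])
    qed
    have cB: "(- c) *\<^sub>R B \<in> tangent_at_Diag lam"
      using subspace_scale[OF subspace_tangent_at_Diag B(1)] .
    have "0 \<le> normal_metric ?L (S W) W"
      using S \<open>W \<in> im_ad ?L\<close> unfolding is_pos_sqrt_def by blast
    also have "\<dots> = 2 * CARD('n) *
        (\<Sum>j\<in>UNIV. \<Sum>k\<in>UNIV. Re (((- c) *\<^sub>R B) $ j $ k * cnj (B $ j $ k)) / (lam $ j - lam $ k)\<^sup>2)"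
      unfolding SW unfolding B by (rule normal_metric_conjug[OF g cB B(1)])
    also have "\<dots> = - (2 * CARD('n) * c *
        (\<Sum>j\<in>UNIV. \<Sum>k\<in>UNIV. 1 / (lam $ j - lam $ k)\<^sup>2 * (cmod (B $ j $ k))\<^sup>2))"
    proof -
      have "Re (((- c) *\<^sub>R z) * cnj z) = - c * (cmod z)\<^sup>2" for z
        using Re_mult_cnj_same[of z] by (simp add: algebra_simps flip: distrib_left)
      then have "Re (((- c) *\<^sub>R B) $ j $ k * cnj (B $ j $ k)) / x = - (c * (1 / x * (cmod (B $ j $ k))\<^sup>2))"
        for j k x by (simp del: times_complex.sel)
      then show ?thesis by (simp only: sum_negf sum_distrib_left[symmetric] mult_minus_right mult.assoc)
    qed
    finally have "(\<Sum>j\<in>UNIV. \<Sum>k\<in>UNIV. 1 / (lam $ j - lam $ k)\<^sup>2 * (cmod (B $ j $ k))\<^sup>2) \<le> 0"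
      using True by (simp add: mult_le_0_iff)
    then have "B = 0" by (rule tangent_norm_zero[OF B(1), rotated 2]) auto
    then show ?thesis using B by (simp add: W_def linear_0[OF linear_conjug])
  qed
  have "S (conjug g A) = (\<Sum>c\<in>C. S (conjug g (part c)))"
    by (subst sum_part[symmetric]) (simp add: linear_sum[OF linear_conjug] linear_sum[OF lin])
  also have "\<dots> = (\<Sum>c\<in>C. conjug g (had (absdiff lam) (part c)))"
    by (simp add: eig hp linear_scale[OF linear_conjug])
  also have "\<dots> = conjug g (had (absdiff lam) (\<Sum>c\<in>C. part c))"
    by (simp add: linear_sum[OF linear_conjug] linear_sum[OF linear_had])
  finally show ?thesis by (simp only: sum_part)
qed

text \<open>The square root contributes one factor \<open>\<bar>lam $ j - lam $ k\<bar>\<close>,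
  which cancels half of the squared denominator of the normal metric. The cancellation is also
  correct at difference 0, where both quotients are 0.\<close>

lemma kaehler_metric_conjug:
  fixes g :: "complex^'n^'n"
  assumes g: "g \<in> unitary_group" and A: "A \<in> tangent_at_Diag lam" and B: "B \<in> tangent_at_Diag lam"
  shows "kaehler_metric (adj_act lam g) (conjug g A) (conjug g B) =
    2 * CARD('n) * (\<Sum>j\<in>UNIV. \<Sum>k\<in>UNIV. Re (A $ j $ k * cnj (B $ j $ k)) / \<bar>lam $ j - lam $ k\<bar>)"
proof -
  have "sqrt_neg_ad_sq (adj_act lam g) (conjug g A) = conjug g (had (absdiff lam) A)"
  proof (rule pos_sqrt_unique[OF g _ A])
    show "is_pos_sqrt (im_ad (adj_act lam g)) (normal_metric (adj_act lam g))
        (\<lambda>V. - ad (adj_act lam g) (ad (adj_act lam g) V)) (sqrt_neg_ad_sq (adj_act lam g))"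
      unfolding sqrt_neg_ad_sq_def
      by (rule someI[of "is_pos_sqrt (im_ad (adj_act lam g)) (normal_metric (adj_act lam g))
            (\<lambda>V. - ad (adj_act lam g) (ad (adj_act lam g) V))", OF is_pos_sqrt_absdiff[OF g]])
  qed
  moreover have "had (absdiff lam) A \<in> tangent_at_Diag lam"
    by (rule had_tangent_at_Diag[OF A abs_minus_commute])
  moreover have "\<bar>x\<bar> * y / x\<^sup>2 = y / \<bar>x\<bar>" for x y :: real
    by (auto simp: power2_eq_square abs_if)
  then have "Re (had (absdiff lam) A $ j $ k * cnj (B $ j $ k)) / (lam $ j - lam $ k)\<^sup>2 =
      Re (A $ j $ k * cnj (B $ j $ k)) / \<bar>lam $ j - lam $ k\<bar>" for j k
    by (simp add: had_def mult.assoc flip: distrib_left)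
  ultimately show ?thesis
    by (simp add: kaehler_metric_def normal_metric_conjug[OF g _ B] del: times_complex.sel)
qed

text \<open>The minus sign is there because \<open>kappa\<close> is negative where the metric is
  positive. The formula uses a representative \<open>g\<close>; by
  \<open>is_kaehler_gradient_iff\<close> its value depends only on the point
  \<open>adj_act lam g\<close>.\<close>

definition grad_field :: "real^'n \<Rightarrow> complex^'n^'n \<Rightarrow> complex^'n^'n \<Rightarrow> complex^'n^'n" where
  "grad_field lam N g = - conjug g (had (absdiff lam) (conjug (conj_transpose g) N))"

text \<open>The function is linear and hence its own derivative. The metric divides the entry
  \<open>(j, k)\<close> by \<open>\<bar>lam $ j - lam $ k\<bar>\<close>, so the vector representing
  the derivative multiplies by it; entries of \<open>N'\<close> at equal eigenvalues pair with 0.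
  Uniqueness is the definiteness of the metric, tested on \<open>A - A0\<close>.\<close>

theorem is_kaehler_gradient_iff:
  fixes g :: "complex^'n^'n"
  assumes g: "g \<in> unitary_group" and N: "N \<in> unitary_algebra"
  shows "is_kaehler_gradient (\<lambda>M. Re (kappa M N)) (adj_act lam g) V \<longleftrightarrow> V = grad_field lam N g"
proof -
  let ?L = "adj_act lam g" and ?H = "\<lambda>M. Re (kappa M N)"
  define N' where "N' = conjug (conj_transpose g) N"
  have N': "N' \<in> unitary_algebra"
    unfolding N'_def using N conjug_unitary_algebra[OF unitary_group_conj_transpose[OF g]] by simp
  have NN': "N = conjug g N'" by (simp add: N'_def conjug_inverse[OF g])
  have lin: "linear ?H"
    unfolding kappa_def
    by (rule linearI) (simp_all add: trace_def matrix_mult_entry sum.distrib sum_distrib_left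
        sum_distrib_right scaleR_sum_right algebra_simps)
  have dH: "frechet_derivative ?H (at ?L) = ?H"
    using lin by (metis frechet_derivative_at linear_imp_has_derivative)
  have HW: "?H (conjug g B) = - (2 * CARD('n) * (\<Sum>j\<in>UNIV. \<Sum>k\<in>UNIV. Re (N' $ j $ k * cnj (B $ j $ k))))"
    if B: "B \<in> tangent_at_Diag lam" for B
  proof -
    have "trace B = 0" using B by (simp add: trace_def tangent_at_Diag_def)
    then have "?H (conjug g B) = 2 * CARD('n) * Re (trace (B ** N'))"
      by (simp add: kappa_def NN' conjug_mult[OF g] trace_conjug[OF g])
    also have "trace (B ** N') = (\<Sum>j\<in>UNIV. \<Sum>k\<in>UNIV. - (N' $ j $ k * cnj (B $ j $ k)))"
      unfolding trace_def matrix_mult_entry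
    proof (subst sum.swap, intro sum.cong refl)
      fix j k
      have "cnj (B $ j $ k) = - B $ k $ j"
        using B by (simp add: tangent_at_Diag_def unitary_algebra_entry)
      then show "B $ k $ j * N' $ j $ k = - (N' $ j $ k * cnj (B $ j $ k))" by simp
    qed
    finally show ?thesis by (simp add: sum_negf del: times_complex.sel)
  qed
  define A0 where "A0 = - had (absdiff lam) N'"
  have A0: "A0 \<in> tangent_at_Diag lam"
    using N' by (auto simp: A0_def tangent_at_Diag_def unitary_algebra_entry had_def abs_minus_commute)
  have gf: "grad_field lam N g = conjug g A0"
    by (simp add: grad_field_def A0_def N'_def linear_neg[OF linear_conjug])
  have V0: "kaehler_metric ?L (conjug g A0) (conjug g B) = ?H (conjug g B)"
    if B: "B \<in> tangent_at_Diag lam" for B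
  proof -
    have "Re (A0 $ j $ k * cnj (B $ j $ k)) / \<bar>lam $ j - lam $ k\<bar> = - Re (N' $ j $ k * cnj (B $ j $ k))"
      for j k
    proof (cases "lam $ j = lam $ k")
      case True
      then show ?thesis using B by (simp add: tangent_at_Diag_def)
    next
      case False
      have "A0 $ j $ k * cnj (B $ j $ k) =
          of_real (- \<bar>lam $ j - lam $ k\<bar>) * (N' $ j $ k * cnj (B $ j $ k))"
        by (simp add: A0_def had_def)
      then have "Re (A0 $ j $ k * cnj (B $ j $ k)) =
          - \<bar>lam $ j - lam $ k\<bar> * Re (N' $ j $ k * cnj (B $ j $ k))"
        by (simp only: Re_complex_of_real Im_complex_of_real times_complex.sel(1)[of "of_real _"])
      then show ?thesis using False by (simp del: times_complex.sel)
    qed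
    then show ?thesis
      by (simp add: kaehler_metric_conjug[OF g A0 B] HW[OF B] sum_negf del: times_complex.sel)
  qed
  show ?thesis
  proof
    assume "V = grad_field lam N g"
    then show "is_kaehler_gradient ?H ?L V"
      using A0 V0 by (auto simp: is_kaehler_gradient_def dH gf im_ad_adj_act[OF g])
  next
    assume grad: "is_kaehler_gradient ?H ?L V"
    then obtain A where A: "A \<in> tangent_at_Diag lam" "V = conjug g A"
      by (auto simp: is_kaehler_gradient_def im_ad_adj_act[OF g])
    have D: "A - A0 \<in> tangent_at_Diag lam"
      by (rule subspace_diff[OF subspace_tangent_at_Diag A(1) A0])
    have "kaehler_metric ?L (conjug g A) (conjug g (A - A0)) =
        kaehler_metric ?L (conjug g A0) (conjug g (A - A0))"
      using grad D V0[OF D] by (auto simp: is_kaehler_gradient_def A(2) dH im_ad_adj_act[OF g])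
    then have "(\<Sum>j\<in>UNIV. \<Sum>k\<in>UNIV. Re ((A $ j $ k - A0 $ j $ k) * cnj ((A - A0) $ j $ k)) /
        \<bar>lam $ j - lam $ k\<bar>) = 0" (is "?s = 0")
      by (simp add: kaehler_metric_conjug[OF g _ D] A(1) A0 left_diff_distrib diff_divide_distrib
          sum_subtractf del: times_complex.sel vector_minus_component)
    then have "(\<Sum>j\<in>UNIV. \<Sum>k\<in>UNIV. 1 / \<bar>lam $ j - lam $ k\<bar> * (cmod ((A - A0) $ j $ k))\<^sup>2) \<le> 0"
    proof -
      have "Re (z * cnj z) / x = 1 / x * (cmod z)\<^sup>2" for z x
        by (simp add: Re_mult_cnj_same del: times_complex.sel)
      then show ?thesis using \<open>?s = 0\<close> by (simp only: vector_minus_component[symmetric])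
    qed
    then have "A - A0 = 0" by (rule tangent_norm_zero[OF D, rotated 2]) auto
    then show "V = grad_field lam N g" by (simp add: gf A)
  qed
qed

section \<open>Uniqueness and explicit form of the gradient flow\<close>

text \<open>This norm is submultiplicative and sees only the moduli of entries. It suits matrix
  products and Hadamard products at the same time.\<close>

definition entry_norm :: "complex^'n^'n \<Rightarrow> real" where
  "entry_norm A = (\<Sum>j\<in>UNIV. \<Sum>k\<in>UNIV. cmod (A $ j $ k))"

lemma entry_norm_nonneg: "0 \<le> entry_norm A"
  by (simp add: entry_norm_def sum_nonneg)

lemma entry_norm_le:
  fixes A :: "complex^'n^'n"
  assumes "\<And>j k. cmod (A $ j $ k) \<le> c j k"
  shows "entry_norm A \<le> (\<Sum>j\<in>UNIV. \<Sum>k\<in>UNIV. c j k)"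
  unfolding entry_norm_def by (intro sum_mono assms)

lemma entry_norm_add: "entry_norm (A + B) \<le> entry_norm A + entry_norm B"
proof -
  have "entry_norm (A + B) \<le> (\<Sum>j\<in>UNIV. \<Sum>k\<in>UNIV. cmod (A $ j $ k) + cmod (B $ j $ k))"
    by (rule entry_norm_le) (simp add: norm_triangle_ineq)
  then show ?thesis by (simp add: entry_norm_def sum.distrib)
qed

text \<open>Bounds the triple sum of moduli and not just the product matrix, because in the
  commutator estimates each summand carries its own weight.\<close>

lemma sum_mult_le_entry_norm:
  fixes A B :: "complex^'n^'n"
  shows "(\<Sum>j\<in>UNIV. \<Sum>l\<in>UNIV. \<Sum>k\<in>UNIV. cmod (A $ j $ k) * cmod (B $ k $ l)) \<le>
    entry_norm A * entry_norm B"
proof -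
  have "(\<Sum>l\<in>UNIV. \<Sum>k\<in>UNIV. cmod (A $ j $ k) * cmod (B $ k $ l)) \<le>
      (\<Sum>k\<in>UNIV. cmod (A $ j $ k)) * entry_norm B" for j
  proof -
    have "(\<Sum>l\<in>UNIV. cmod (A $ j $ k) * cmod (B $ k $ l)) \<le> cmod (A $ j $ k) * entry_norm B" for k
      unfolding sum_distrib_left[symmetric] entry_norm_def
      by (intro mult_left_mono member_le_sum[of k UNIV "\<lambda>k. \<Sum>l\<in>UNIV. cmod (B $ k $ l)"])
        (auto intro: sum_nonneg)
    then show ?thesis
      by (subst sum.swap) (simp add: sum_distrib_right sum_mono)
  qed
  then have "(\<Sum>j\<in>UNIV. \<Sum>l\<in>UNIV. \<Sum>k\<in>UNIV. cmod (A $ j $ k) * cmod (B $ k $ l)) \<le>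
      (\<Sum>j\<in>UNIV. (\<Sum>k\<in>UNIV. cmod (A $ j $ k)) * entry_norm B)"
    by (rule sum_mono)
  then show ?thesis by (simp add: entry_norm_def[of A] sum_distrib_right)
qed

lemma entry_norm_mult:
  fixes A B :: "complex^'n^'n"
  shows "entry_norm (A ** B) \<le> entry_norm A * entry_norm B"
proof -
  have "entry_norm (A ** B) \<le> (\<Sum>j\<in>UNIV. \<Sum>l\<in>UNIV. \<Sum>k\<in>UNIV. cmod (A $ j $ k) * cmod (B $ k $ l))"
  proof (rule entry_norm_le)
    fix j l
    have "cmod ((A ** B) $ j $ l) \<le> (\<Sum>k\<in>UNIV. cmod (A $ j $ k * B $ k $ l))"
      unfolding matrix_mult_entry by (rule norm_sum)
    then show "cmod ((A ** B) $ j $ l) \<le> (\<Sum>k\<in>UNIV. cmod (A $ j $ k) * cmod (B $ k $ l))"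
      by (simp add: norm_mult)
  qed
  then show ?thesis using sum_mult_le_entry_norm order_trans by blast
qed

lemma entry_norm_le_norm:
  fixes A :: "complex^'n^'n"
  shows "entry_norm A \<le> (of_nat CARD('n))\<^sup>2 * norm A"
proof -
  have "cmod (A $ j $ k) \<le> norm A" for j k
    using Finite_Cartesian_Product.norm_nth_le[of "A $ j" k] Finite_Cartesian_Product.norm_nth_le[of A j] by linarith
  then have "entry_norm A \<le> (\<Sum>j\<in>(UNIV::'n set). \<Sum>k\<in>(UNIV::'n set). norm A)" by (rule entry_norm_le)
  then show ?thesis by (simp add: power2_eq_square mult.assoc)
qed

lemma norm_le_entry_norm: "norm A \<le> entry_norm A"
proof -
  have "norm A \<le> (\<Sum>j\<in>UNIV. norm (A $ j))" unfolding norm_vec_def by (rule L2_set_le_sum) auto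
  also have "\<dots> \<le> entry_norm A" unfolding entry_norm_def
    by (intro sum_mono) (simp add: norm_vec_def L2_set_le_sum)
  finally show ?thesis .
qed

lemma unitary_entry_norm:
  fixes g :: "complex^'n^'n"
  assumes "g \<in> unitary_group"
  shows "entry_norm g \<le> (of_nat CARD('n))\<^sup>2"
proof -
  have "cmod (g $ j $ k) \<le> 1" for j k
  proof -
    have "(\<Sum>k\<in>UNIV. g $ j $ k * cnj (g $ j $ k)) = 1"
      using arg_cong[OF unitary_groupD(1)[OF assms], of "\<lambda>A. A $ j $ j"]
      by (simp add: matrix_mult_entry conj_transpose_entry idm_entry)
    then have "(\<Sum>k\<in>UNIV. (cmod (g $ j $ k))\<^sup>2) = 1"
      by (metis (no_types, lifting) Re_sum Re_mult_cnj_same one_complex.sel(1) sum.cong)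
    moreover have "(cmod (g $ j $ k))\<^sup>2 \<le> (\<Sum>k\<in>UNIV. (cmod (g $ j $ k))\<^sup>2)"
      by (rule member_le_sum) auto
    ultimately show ?thesis by (simp add: power_le_one_iff)
  qed
  then have "entry_norm g \<le> (\<Sum>j\<in>(UNIV::'n set). \<Sum>k\<in>(UNIV::'n set). 1)" by (rule entry_norm_le)
  then show ?thesis by (simp add: power2_eq_square)
qed

lemma entry_norm_unitary_mult:
  fixes g h A :: "complex^'n^'n"
  assumes "g \<in> unitary_group" "h \<in> unitary_group"
  shows "entry_norm (g ** A ** h) \<le> (of_nat CARD('n))\<^sup>2 * (of_nat CARD('n))\<^sup>2 * entry_norm A"
proof -
  have "entry_norm (g ** A ** h) \<le> entry_norm g * entry_norm A * entry_norm h"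
    using entry_norm_mult[of "g ** A" h] entry_norm_mult[of g A] entry_norm_nonneg[of h]
    by (meson mult_right_mono order_trans)
  also have "\<dots> \<le> (of_nat CARD('n))\<^sup>2 * entry_norm A * (of_nat CARD('n))\<^sup>2"
    using unitary_entry_norm[OF assms(1)] unitary_entry_norm[OF assms(2)]
    by (intro mult_mono mult_nonneg_nonneg entry_norm_nonneg) auto
  finally show ?thesis by (simp add: mult_ac)
qed

lemma entry_norm_unitary_cancel:
  fixes g h A :: "complex^'n^'n"
  assumes g: "g \<in> unitary_group" and h: "h \<in> unitary_group"
  shows "entry_norm A \<le> (of_nat CARD('n))\<^sup>2 * (of_nat CARD('n))\<^sup>2 *
    entry_norm (conj_transpose g ** A ** h)"
proof -
  have "g ** (conj_transpose g ** A ** h) ** conj_transpose h =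
      (g ** conj_transpose g) ** A ** (h ** conj_transpose h)"
    by (simp only: matrix_mul_assoc)
  then have "A = g ** (conj_transpose g ** A ** h) ** conj_transpose h"
    by (simp add: unitary_groupD g h)
  then show ?thesis
    using entry_norm_unitary_mult[OF g unitary_group_conj_transpose[OF h], of "conj_transpose g ** A ** h"]
    by simp
qed

text \<open>In the mixed frame the difference of two orbit points is the commutator of the diagonal
  matrix with \<open>conj_transpose g ** h\<close>. Nearby points thus force the entries of
  \<open>conj_transpose g ** h\<close> between different eigenvalues to be small, even if
  \<open>g\<close> and \<open>h\<close> are far apart.\<close>

lemma adj_act_diff_entry:
  assumes g: "g \<in> unitary_group" and h: "h \<in> unitary_group"
  shows "(conj_transpose g ** (adj_act lam g - adj_act lam h) ** h) $ j $ l =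
    \<i> * of_real (lam $ j - lam $ l) * (conj_transpose g ** h) $ j $ l"
proof -
  let ?D = "cscale \<i> (Diag lam)"
  have "conj_transpose g ** (adj_act lam g - adj_act lam h) ** h =
      (conj_transpose g ** g) ** ?D ** conj_transpose g ** h -
      conj_transpose g ** h ** ?D ** (conj_transpose h ** h)"
    by (simp only: adj_act_unitary g h conjug_def diff_matrix_mult mult_matrix_diff matrix_mul_assoc)
  then have "conj_transpose g ** (adj_act lam g - adj_act lam h) ** h =
      ad ?D (conj_transpose g ** h)"
    by (simp add: unitary_groupD g h ad_def matrix_mul_assoc)
  then show ?thesis by (simp add: ad_Diag) (simp add: had_def)
qed

text \<open>Moving the Hadamard factor past a matrix product changes its weight from one eigenvalue
  distance to another. By the reverse triangle inequality the error is at most the distance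
  belonging to the other factor, which is the weight in \<open>adj_act_diff_entry\<close>.\<close>

lemma had_absdiff_mult_entry_le:
  fixes A B :: "complex^'n^'n"
  shows "cmod ((had (absdiff lam) (A ** B) - had (absdiff lam) A ** B) $ j $ l) \<le>
      (\<Sum>k\<in>UNIV. cmod (A $ j $ k) * cmod (of_real (lam $ k - lam $ l) * B $ k $ l))"
    and "cmod ((had (absdiff lam) (A ** B) - A ** had (absdiff lam) B) $ j $ l) \<le>
      (\<Sum>k\<in>UNIV. cmod (of_real (lam $ j - lam $ k) * A $ j $ k) * cmod (B $ k $ l))"
proof -
  let ?d = "\<lambda>j k. \<bar>lam $ j - lam $ k\<bar>"
  have "(had (absdiff lam) (A ** B) - had (absdiff lam) A ** B) $ j $ l =
      (\<Sum>k\<in>UNIV. of_real (?d j l - ?d j k) * (A $ j $ k * B $ k $ l))"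
    by (simp add: had_def matrix_mult_entry sum_distrib_left algebra_simps flip: sum_subtractf)
  then have "cmod ((had (absdiff lam) (A ** B) - had (absdiff lam) A ** B) $ j $ l) \<le>
      (\<Sum>k\<in>UNIV. cmod (of_real (?d j l - ?d j k) * (A $ j $ k * B $ k $ l)))"
    by (simp only: norm_sum)
  also have "\<dots> \<le> (\<Sum>k\<in>UNIV. cmod (A $ j $ k) * cmod (of_real (lam $ k - lam $ l) * B $ k $ l))"
  proof (rule sum_mono)
    fix k
    have "\<bar>?d j l - ?d j k\<bar> \<le> \<bar>lam $ k - lam $ l\<bar>" by linarith
    then have "\<bar>?d j l - ?d j k\<bar> * (cmod (A $ j $ k) * cmod (B $ k $ l)) \<le>
        \<bar>lam $ k - lam $ l\<bar> * (cmod (A $ j $ k) * cmod (B $ k $ l))"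
      by (intro mult_right_mono) auto
    then show "cmod (of_real (?d j l - ?d j k) * (A $ j $ k * B $ k $ l)) \<le>
        cmod (A $ j $ k) * cmod (of_real (lam $ k - lam $ l) * B $ k $ l)"
      by (simp add: norm_mult mult.left_commute del: of_real_diff)
  qed
  finally show "cmod ((had (absdiff lam) (A ** B) - had (absdiff lam) A ** B) $ j $ l) \<le>
      (\<Sum>k\<in>UNIV. cmod (A $ j $ k) * cmod (of_real (lam $ k - lam $ l) * B $ k $ l))" .
  have "(had (absdiff lam) (A ** B) - A ** had (absdiff lam) B) $ j $ l =
      (\<Sum>k\<in>UNIV. of_real (?d j l - ?d k l) * (A $ j $ k * B $ k $ l))"
    by (simp add: had_def matrix_mult_entry sum_distrib_left algebra_simps flip: sum_subtractf)
  then have "cmod ((had (absdiff lam) (A ** B) - A ** had (absdiff lam) B) $ j $ l) \<le>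
      (\<Sum>k\<in>UNIV. cmod (of_real (?d j l - ?d k l) * (A $ j $ k * B $ k $ l)))"
    by (simp only: norm_sum)
  also have "\<dots> \<le> (\<Sum>k\<in>UNIV. cmod (of_real (lam $ j - lam $ k) * A $ j $ k) * cmod (B $ k $ l))"
  proof (rule sum_mono)
    fix k
    have "\<bar>?d j l - ?d k l\<bar> \<le> \<bar>lam $ j - lam $ k\<bar>" by linarith
    then have "\<bar>?d j l - ?d k l\<bar> * (cmod (A $ j $ k) * cmod (B $ k $ l)) \<le>
        \<bar>lam $ j - lam $ k\<bar> * (cmod (A $ j $ k) * cmod (B $ k $ l))"
      by (intro mult_right_mono) auto
    then show "cmod (of_real (?d j l - ?d k l) * (A $ j $ k * B $ k $ l)) \<le>
        cmod (of_real (lam $ j - lam $ k) * A $ j $ k) * cmod (B $ k $ l)"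
      by (simp add: norm_mult mult.assoc del: of_real_diff)
  qed
  finally show "cmod ((had (absdiff lam) (A ** B) - A ** had (absdiff lam) B) $ j $ l) \<le>
      (\<Sum>k\<in>UNIV. cmod (of_real (lam $ j - lam $ k) * A $ j $ k) * cmod (B $ k $ l))" .
qed

lemma had_absdiff_commutator:
  fixes g h A :: "complex^'n^'n"
  assumes g: "g \<in> unitary_group" and h: "h \<in> unitary_group"
  defines "B \<equiv> conj_transpose g ** h"
  shows "entry_norm (had (absdiff lam) (A ** B) - had (absdiff lam) A ** B) \<le>
      entry_norm A * entry_norm (conj_transpose g ** (adj_act lam g - adj_act lam h) ** h)"
    and "entry_norm (had (absdiff lam) (B ** A) - B ** had (absdiff lam) A) \<le>
      entry_norm (conj_transpose g ** (adj_act lam g - adj_act lam h) ** h) * entry_norm A"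
proof -
  let ?D = "conj_transpose g ** (adj_act lam g - adj_act lam h) ** h"
  have D: "cmod (of_real (lam $ j - lam $ l) * B $ j $ l) = cmod (?D $ j $ l)" for j l
    by (simp add: adj_act_diff_entry[OF g h] norm_mult B_def del: of_real_diff)
  show "entry_norm (had (absdiff lam) (A ** B) - had (absdiff lam) A ** B) \<le> entry_norm A * entry_norm ?D"
    by (rule order_trans[OF entry_norm_le[OF had_absdiff_mult_entry_le(1)]])
      (unfold D, rule sum_mult_le_entry_norm)
  show "entry_norm (had (absdiff lam) (B ** A) - B ** had (absdiff lam) A) \<le> entry_norm ?D * entry_norm A"
    by (rule order_trans[OF entry_norm_le[OF had_absdiff_mult_entry_le(2)]])
      (unfold D, rule sum_mult_le_entry_norm)
qed

text \<open>In the mixed frame both fields come from the single matrix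
  \<open>Ng ** B = B ** Nh\<close>. They differ only in whether the Hadamard factor acts before or
  after multiplication by \<open>B\<close>, and \<open>had_absdiff_commutator\<close> bounds this by
  the distance of the orbit points.\<close>

lemma grad_field_lipschitz:
  fixes lam :: "real^'n" and N :: "complex^'n^'n"
  shows "\<exists>C. \<forall>g\<in>unitary_group. \<forall>h\<in>unitary_group.
    norm (grad_field lam N g - grad_field lam N h) \<le> C * norm (adj_act lam g - adj_act lam h)"
proof -
  define c where "c = (of_nat CARD('n) :: real)\<^sup>2 * (of_nat CARD('n))\<^sup>2"
  have c: "0 \<le> c" by (simp add: c_def)
  \<comment> \<open>The outer \<open>c\<close> pays for undoing the mixed frame,
    \<open>c * entry_norm N\<close> bounds both \<open>Ng\<close> and \<open>Nh\<close>, and the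
    last factor passes from \<open>D\<close> to the norm of the difference of the orbit
    points.\<close>
  have "norm (grad_field lam N g - grad_field lam N h) \<le>
      (c * (2 * (c * entry_norm N) * (c * (of_nat CARD('n))\<^sup>2))) * norm (adj_act lam g - adj_act lam h)"
    if g: "g \<in> unitary_group" and h: "h \<in> unitary_group" for g h
  proof -
    let ?gs = "conj_transpose g" and ?hs = "conj_transpose h"
    define B where "B = ?gs ** h"
    define D where "D = ?gs ** (adj_act lam g - adj_act lam h) ** h"
    define Ng where "Ng = conjug ?gs N"
    define Nh where "Nh = conjug ?hs N"
    let ?H = "had (absdiff lam)"
    have "Ng ** B = ?gs ** N ** (g ** ?gs) ** h" "B ** Nh = ?gs ** (h ** ?hs) ** N ** h"
      by (simp_all only: Ng_def Nh_def B_def conjug_def conj_transpose_conj_transpose matrix_mul_assoc)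
    then have NB: "Ng ** B = B ** Nh" by (simp add: unitary_groupD g h)
    have "?gs ** (grad_field lam N g - grad_field lam N h) ** h =
        ?gs ** h ** ?H Nh ** (?hs ** h) - (?gs ** g) ** ?H Ng ** ?gs ** h"
      by (simp only: grad_field_def conjug_def Ng_def Nh_def diff_matrix_mult mult_matrix_diff
          matrix_mul_assoc minus_diff_minus minus_diff_eq bounded_bilinear.minus_left[OF bounded_bilinear_matrix_mult]
          bounded_bilinear.minus_right[OF bounded_bilinear_matrix_mult])
    also have "\<dots> = B ** ?H Nh - ?H Ng ** B"
      by (simp add: unitary_groupD g h B_def matrix_mul_assoc)
    also have "\<dots> = (?H (Ng ** B) - ?H Ng ** B) + (-1) *\<^sub>R (?H (B ** Nh) - B ** ?H Nh)"
      by (simp add: NB)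
    finally have eq: "?gs ** (grad_field lam N g - grad_field lam N h) ** h = \<dots>" .
    have neg: "entry_norm ((-1) *\<^sub>R X) = entry_norm X" for X :: "complex^'n^'n"
      by (simp add: entry_norm_def)
    have bN: "entry_norm Ng \<le> c * entry_norm N" "entry_norm Nh \<le> c * entry_norm N"
      unfolding c_def Ng_def Nh_def conjug_def
      by (intro entry_norm_unitary_mult unitary_group_conj_transpose g h
          | simp add: conj_transpose_conj_transpose g h)+
    have bD: "entry_norm D \<le> c * (of_nat CARD('n))\<^sup>2 * norm (adj_act lam g - adj_act lam h)"
    proof -
      have "entry_norm D \<le> c * entry_norm (adj_act lam g - adj_act lam h)"
        unfolding c_def D_def by (intro entry_norm_unitary_mult unitary_group_conj_transpose g h)
      also have "\<dots> \<le> c * ((of_nat CARD('n))\<^sup>2 * norm (adj_act lam g - adj_act lam h))"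
        by (intro mult_left_mono entry_norm_le_norm c)
      finally show ?thesis by (simp add: mult.assoc)
    qed
    have "norm (grad_field lam N g - grad_field lam N h) \<le>
        c * entry_norm (?gs ** (grad_field lam N g - grad_field lam N h) ** h)"
      using norm_le_entry_norm entry_norm_unitary_cancel[OF g h] order_trans unfolding c_def by blast
    also have "\<dots> \<le> c * (entry_norm Ng * entry_norm D + entry_norm D * entry_norm Nh)"
    proof (rule mult_left_mono[OF _ c])
      have "entry_norm (?gs ** (grad_field lam N g - grad_field lam N h) ** h) \<le>
          entry_norm (?H (Ng ** B) - ?H Ng ** B) + entry_norm (?H (B ** Nh) - B ** ?H Nh)"
        using entry_norm_add[of "?H (Ng ** B) - ?H Ng ** B" "(-1) *\<^sub>R (?H (B ** Nh) - B ** ?H Nh)"]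
        unfolding eq neg .
      also have "\<dots> \<le> entry_norm Ng * entry_norm D + entry_norm D * entry_norm Nh"
        unfolding B_def D_def by (intro add_mono had_absdiff_commutator[OF g h])
      finally show "entry_norm (?gs ** (grad_field lam N g - grad_field lam N h) ** h) \<le>
          entry_norm Ng * entry_norm D + entry_norm D * entry_norm Nh" .
    qed
    also have "\<dots> \<le> c * (2 * (c * entry_norm N) * entry_norm D)"
      using mult_right_mono[OF bN(1) entry_norm_nonneg[of D]]
        mult_left_mono[OF bN(2) entry_norm_nonneg[of D]] c
      by (intro mult_left_mono) (auto simp: algebra_simps)
    also have "\<dots> \<le> c * (2 * (c * entry_norm N) * (c * (of_nat CARD('n))\<^sup>2 * norm (adj_act lam g - adj_act lam h)))"
      by (intro mult_left_mono bD mult_nonneg_nonneg c entry_norm_nonneg) auto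
    finally show ?thesis by (simp add: mult_ac)
  qed
  then show ?thesis by blast
qed

lemma flow_line_iff:
  assumes N: "N \<in> unitary_algebra"
  shows "kaehler_gradient_flow_line lam N L \<longleftrightarrow>
    (\<forall>t. \<exists>g\<in>unitary_group. L t = adj_act lam g \<and> (L has_vector_derivative grad_field lam N g) (at t))"
  unfolding kaehler_gradient_flow_line_def orbit_def
  using is_kaehler_gradient_iff[OF _ N, of _ lam] by (auto; metis imageE)

text \<open>Gronwall for the squared distance. The representatives are picked separately at each
  time and need not vary continuously, which is why the Lipschitz bound is in terms of orbit
  points.\<close>

lemma flow_line_unique:
  fixes lam :: "real^'n"
  assumes N: "N \<in> unitary_algebra"
    and L: "kaehler_gradient_flow_line lam N L" and K: "kaehler_gradient_flow_line lam N K"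
    and 0: "L 0 = K 0" and t: "0 \<le> t"
  shows "L t = K t"
proof -
  obtain C where C: "\<And>g h. g \<in> unitary_group \<Longrightarrow> h \<in> unitary_group \<Longrightarrow>
      norm (grad_field lam N g - grad_field lam N h) \<le> C * norm (adj_act lam g - adj_act lam h)"
    using grad_field_lipschitz[of lam N] by blast
  obtain g where g: "\<And>t. g t \<in> unitary_group" "\<And>t. L t = adj_act lam (g t)"
    "\<And>t. (L has_vector_derivative grad_field lam N (g t)) (at t)"
    using L unfolding flow_line_iff[OF N] by metis
  obtain h where h: "\<And>t. h t \<in> unitary_group" "\<And>t. K t = adj_act lam (h t)"
    "\<And>t. (K has_vector_derivative grad_field lam N (h t)) (at t)"
    using K unfolding flow_line_iff[OF N] by metis
  let ?V = "\<lambda>t. grad_field lam N (g t) - grad_field lam N (h t)"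
  have "(L t - K t) \<bullet> (L t - K t) \<le> 0"
  proof (rule gronwall_nonpos[OF _ _ _ t])
    fix s
    have d: "((\<lambda>s. L s - K s) has_vector_derivative ?V s) (at s)"
      by (intro derivative_intros g h)
    from bounded_bilinear.has_vector_derivative[OF bounded_bilinear_inner d d]
    show "((\<lambda>s. (L s - K s) \<bullet> (L s - K s)) has_real_derivative
        (L s - K s) \<bullet> ?V s + ?V s \<bullet> (L s - K s)) (at s)"
      by (simp add: has_real_derivative_iff_has_vector_derivative)
    have "(L s - K s) \<bullet> ?V s \<le> norm (L s - K s) * norm (?V s)" by (rule norm_cauchy_schwarz)
    also have "\<dots> \<le> norm (L s - K s) * (C * norm (L s - K s))"
      using C[OF g(1) h(1), of s s] g(2) h(2) by (intro mult_left_mono) auto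
    also have "\<dots> = C * ((L s - K s) \<bullet> (L s - K s))"
      by (simp add: dot_square_norm power2_eq_square)
    finally show "(L s - K s) \<bullet> ?V s + ?V s \<bullet> (L s - K s) \<le> 2 * C * ((L s - K s) \<bullet> (L s - K s))"
      by (simp add: inner_commute)
  qed (simp add: 0)
  then show ?thesis by (metis eq_iff_diff_eq_0 inner_ge_zero inner_eq_zero_iff order_antisym)
qed

text \<open>Forward and backward differences are both listed because
  \<open>flow_difference_entry\<close> uses the former above the diagonal and the latter below
  it.\<close>

lemma mexp_difference_quotient:
  fixes M :: "complex^'n^'n"
  shows "((\<lambda>h. entry_norm (mexp M h - idm - h *\<^sub>R M) / \<bar>h\<bar>) \<longlongrightarrow> 0) (at 0)"
    and "((\<lambda>h. entry_norm (idm - mexp M (- h) - h *\<^sub>R M) / \<bar>h\<bar>) \<longlongrightarrow> 0) (at 0)"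
    and "((\<lambda>h. entry_norm (mexp M h - idm)) \<longlongrightarrow> 0) (at 0)"
    and "((\<lambda>h. entry_norm (idm - mexp M (- h))) \<longlongrightarrow> 0) (at 0)"
proof -
  have d: "(mexp M has_vector_derivative M) (at 0)"
    using mexp_has_vector_derivative[of M 0] by (simp add: mexp_0)
  have minus: "filterlim uminus (at (0::real)) (at 0)"
    by (rule filterlim_atI) (auto intro!: tendsto_eq_intros simp: eventually_at_filter)
  have neg: "entry_norm (- X) = entry_norm X" for X :: "complex^'n^'n" by (simp add: entry_norm_def)
  have "((\<lambda>h. norm (mexp M (0 + h) - mexp M 0 - h *\<^sub>R M) / norm h) \<longlongrightarrow> 0) (at 0)"
    using d unfolding has_vector_derivative_def has_derivative_at by blast
  then have "((\<lambda>h. (of_nat CARD('n))\<^sup>2 * (norm (mexp M h - idm - h *\<^sub>R M) / \<bar>h\<bar>)) \<longlongrightarrow> 0) (at 0)"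
    by (intro tendsto_mult_right_zero) (simp add: mexp_0)
  moreover have "\<forall>\<^sub>F h in at 0. norm (entry_norm (mexp M h - idm - h *\<^sub>R M) / \<bar>h\<bar>) \<le>
      (of_nat CARD('n))\<^sup>2 * (norm (mexp M h - idm - h *\<^sub>R M) / \<bar>h\<bar>)"
    by (intro always_eventually allI)
      (simp add: entry_norm_nonneg divide_right_mono entry_norm_le_norm)
  ultimately show 1: "((\<lambda>h. entry_norm (mexp M h - idm - h *\<^sub>R M) / \<bar>h\<bar>) \<longlongrightarrow> 0) (at 0)"
    by (rule Lim_null_comparison[rotated])
  from filterlim_compose[OF 1 minus]
  have "((\<lambda>h. entry_norm (- (mexp M (- h) - idm - (- h) *\<^sub>R M)) / \<bar>h\<bar>) \<longlongrightarrow> 0) (at 0)"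
    unfolding neg by simp
  then show "((\<lambda>h. entry_norm (idm - mexp M (- h) - h *\<^sub>R M) / \<bar>h\<bar>) \<longlongrightarrow> 0) (at 0)"
    by (simp add: algebra_simps)
  have "isCont (mexp M) 0" using d by (rule has_vector_derivative_continuous)
  then have c: "(mexp M \<longlongrightarrow> idm) (at 0)" by (simp add: isCont_def mexp_0)
  show 3: "((\<lambda>h. entry_norm (mexp M h - idm)) \<longlongrightarrow> 0) (at 0)"
    unfolding entry_norm_def
    by (rule tendsto_eq_intros c refl | simp add: entry_norm_def)+
  from filterlim_compose[OF 3 minus]
  have "((\<lambda>h. entry_norm (- (mexp M (- h) - idm))) \<longlongrightarrow> 0) (at 0)" unfolding neg .
  then show "((\<lambda>h. entry_norm (idm - mexp M (- h))) \<longlongrightarrow> 0) (at 0)" by simp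
qed

text \<open>By the QR factorisation \<open>conj_transpose (q s) ** mexp M (s - r) ** q r\<close>
  equals \<open>R s ** U r\<close> and is upper triangular. Below the diagonal this is used
  directly, above it after taking adjoints with \<open>s\<close> and \<open>r\<close> exchanged,
  since \<open>mexp M\<close> is hermitian. As \<open>lam\<close> decreases, the eigenvalue
  differences have opposite signs in the two cases; this turns them into absolute values.\<close>

lemma flow_difference_entry:
  fixes lam :: "real^'n::{finite,linorder}"
  assumes M: "conj_transpose M = M"
    and lam: "\<And>i j. i \<le> j \<Longrightarrow> lam $ j \<le> lam $ i"
    and q: "\<And>t. q t \<in> unitary_group"
    and R: "\<And>t. upper_tri_pos (R t)" and U: "\<And>t. upper_tri_pos (U t)"
    and qR: "\<And>t. mexp M t ** g = q t ** R t" and qU: "\<And>t. q t = mexp M t ** g ** U t"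
  shows "(conj_transpose (q t) ** (adj_act lam (q t) - adj_act lam (q (t + h))) ** q (t + h)) $ j $ l =
    - \<i> * absdiff lam j l * (conj_transpose (q t) **
        (if l < j then idm - mexp M (- h) else mexp M h - idm) ** q (t + h)) $ j $ l"
proof -
  let ?B = "conj_transpose (q t) ** q (t + h)"
  have upper: "(conj_transpose (q s) ** mexp M (s - r) ** q r) $ a $ b = 0" if "b < a" for s r a b
  proof -
    have "mexp M (s - r) ** q r = mexp M (s - r) ** mexp M r ** g ** U r"
      by (subst qU) (simp only: matrix_mul_assoc)
    also have "\<dots> = q s ** R s ** U r"
      by (simp add: mexp_add[symmetric] qR)
    finally have "conj_transpose (q s) ** (mexp M (s - r) ** q r) =
        (conj_transpose (q s) ** q s) ** (R s ** U r)" by (simp only: matrix_mul_assoc)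
    then have "conj_transpose (q s) ** mexp M (s - r) ** q r = R s ** U r"
      by (simp add: unitary_groupD[OF q] matrix_mul_assoc)
    then show ?thesis using R[of s] U[of r] that
      by (simp add: upper_tri_pos_def upper_triangular_mult_entry)
  qed
  consider "l < j" | "j < l" | "j = l" by (metis linorder_neqE)
  then have "of_real (lam $ j - lam $ l) * ?B $ j $ l =
    - (absdiff lam j l * (conj_transpose (q t) **
        (if l < j then idm - mexp M (- h) else mexp M h - idm) ** q (t + h)) $ j $ l)"
  proof cases
    case 1
    have "(conj_transpose (q t) ** mexp M (- h) ** q (t + h)) $ j $ l = 0"
      using upper[OF 1, of t "t + h"] by simp
    moreover have "lam $ j \<le> lam $ l" using lam 1 by simp
    ultimately show ?thesis using 1
      by (simp add: mult_matrix_diff diff_matrix_mult abs_if algebra_simps)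
  next
    case 2
    have "cnj ((conj_transpose (q (t + h)) ** mexp M h ** q t) $ l $ j) = 0"
      using upper[OF 2, of "t + h" t] by simp
    then have "conj_transpose (conj_transpose (q (t + h)) ** mexp M h ** q t) $ j $ l = 0"
      by (simp only: conj_transpose_entry)
    then have "(conj_transpose (q t) ** mexp M h ** q (t + h)) $ j $ l = 0"
      by (simp add: conj_transpose_mult conj_transpose_conj_transpose mexp_hermitian[OF M] matrix_mul_assoc)
    moreover have "lam $ l \<le> lam $ j" "\<not> l < j" using lam 2 by simp_all
    ultimately show ?thesis using 2
      by (simp add: mult_matrix_diff diff_matrix_mult abs_if algebra_simps)
  qed simp
  then show ?thesis
    unfolding adj_act_diff_entry[OF q q] by (simp only: mult.assoc mult_minus_left mult_minus_right)
qed

text \<open>The QR factor \<open>q\<close> is never differentiated. The difference quotient of the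
  orbit points is estimated in the mixed frame of \<open>q t\<close> and \<open>q (t + h)\<close>,
  where the exponentials appear explicitly.\<close>

lemma flow_has_vector_derivative:
  fixes lam :: "real^'n::{finite,linorder}"
  assumes M: "M = cscale \<i> N" and herm: "conj_transpose M = M"
    and lam: "\<And>i j. i \<le> j \<Longrightarrow> lam $ j \<le> lam $ i"
    and q: "\<And>t. q t \<in> unitary_group"
    and R: "\<And>t. upper_tri_pos (R t)" and U: "\<And>t. upper_tri_pos (U t)"
    and qR: "\<And>t. mexp M t ** g = q t ** R t" and qU: "\<And>t. q t = mexp M t ** g ** U t"
  shows "((\<lambda>t. adj_act lam (q t)) has_vector_derivative grad_field lam N (q t)) (at t)"
proof -
  let ?L = "\<lambda>t. adj_act lam (q t)" and ?V = "grad_field lam N (q t)" and ?H = "had (absdiff lam)"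
  let ?qs = "conj_transpose (q t)"
  define c where "c = (of_nat CARD('n) :: real)\<^sup>2 * (of_nat CARD('n))\<^sup>2"
  define cd where "cd = (\<Sum>j\<in>UNIV. \<Sum>k\<in>UNIV. \<bar>lam $ j - lam $ k\<bar>)"
  define N' where "N' = conjug ?qs N"
  have c: "0 \<le> c" by (simp add: c_def)
  have cd: "\<bar>lam $ j - lam $ k\<bar> \<le> cd" for j k
  proof -
    have "\<bar>lam $ j - lam $ k\<bar> \<le> (\<Sum>k\<in>UNIV. \<bar>lam $ j - lam $ k\<bar>)" by (rule member_le_sum) auto
    also have "\<dots> \<le> cd" unfolding cd_def
      by (rule member_le_sum[of j UNIV "\<lambda>j. \<Sum>k\<in>UNIV. \<bar>lam $ j - lam $ k\<bar>"]) (auto intro: sum_nonneg)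
    finally show ?thesis .
  qed
  have cd0: "0 \<le> cd" using cd[of undefined undefined] by simp
  define R1 where "R1 h = mexp M h - idm - h *\<^sub>R M" for h
  define R2 where "R2 h = idm - mexp M (- h) - h *\<^sub>R M" for h
  \<comment> \<open>The first summand bounds the remainders of the exponential. The second is the
    commutator error \<open>entry_norm N' * entry_norm D\<close> with the estimate \<open>nD\<close>
    inserted. Each tends to 0, and the outer \<open>c\<close> undoes the mixed frame.\<close>
  define bound where "bound h = c * (cd * c * (entry_norm (R1 h) / \<bar>h\<bar> + entry_norm (R2 h) / \<bar>h\<bar>) +
      entry_norm N' * (cd * c * (entry_norm (mexp M h - idm) + entry_norm (idm - mexp M (- h)))))" for h
  have pick: "cmod (absdiff lam j l * (?qs ** (if l < j then X else Y) ** Z) $ j $ l) \<le>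
      cd * (cmod ((?qs ** Y ** Z) $ j $ l) + cmod ((?qs ** X ** Z) $ j $ l))" for X Y Z j l
  proof -
    have "cmod (absdiff lam j l * (?qs ** (if l < j then X else Y) ** Z) $ j $ l) \<le>
        cd * cmod ((?qs ** (if l < j then X else Y) ** Z) $ j $ l)"
      using cd[of j l] by (simp add: norm_mult mult_right_mono del: of_real_diff)
    also have "\<dots> \<le> cd * (cmod ((?qs ** Y ** Z) $ j $ l) + cmod ((?qs ** X ** Z) $ j $ l))"
      by (intro mult_left_mono cd0) auto
    finally show ?thesis .
  qed
  have unit: "entry_norm (?qs ** X ** q s) \<le> c * entry_norm X" for X s
    unfolding c_def by (intro entry_norm_unitary_mult unitary_group_conj_transpose q)
  have pick_sum: "(\<Sum>j\<in>UNIV. \<Sum>l\<in>UNIV. cd * (cmod ((?qs ** Y ** q s) $ j $ l) + cmod ((?qs ** X ** q s) $ j $ l))) \<le>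
      cd * c * (entry_norm Y + entry_norm X)" for X Y s
  proof -
    have "(\<Sum>j\<in>UNIV. \<Sum>l\<in>UNIV. cd * (cmod ((?qs ** Y ** q s) $ j $ l) + cmod ((?qs ** X ** q s) $ j $ l))) =
        cd * (entry_norm (?qs ** Y ** q s) + entry_norm (?qs ** X ** q s))"
      by (simp only: entry_norm_def sum_distrib_left[symmetric] sum.distrib)
    also have "\<dots> \<le> cd * (c * entry_norm Y + c * entry_norm X)"
      by (intro mult_left_mono add_mono unit cd0)
    finally show ?thesis by (simp add: algebra_simps)
  qed
  have le: "norm (?L (t + h) - ?L t - h *\<^sub>R ?V) / norm h \<le> bound h" if h: "h \<noteq> 0" for h
  proof -
    let ?q' = "q (t + h)"
    define B where "B = ?qs ** ?q'"
    define D where "D = ?qs ** (?L t - ?L (t + h)) ** ?q'"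
    define G where "G = ?qs ** (?L (t + h) - ?L t - h *\<^sub>R ?V) ** ?q'"
    have D: "D $ j $ l = - \<i> * absdiff lam j l * (?qs **
        (if l < j then idm - mexp M (- h) else mexp M h - idm) ** ?q') $ j $ l" for j l
      unfolding D_def by (rule flow_difference_entry[OF herm lam q R U qR qU])
    have nD: "entry_norm D \<le> cd * c * (entry_norm (mexp M h - idm) + entry_norm (idm - mexp M (- h)))"
    proof (rule order_trans[OF entry_norm_le pick_sum])
      fix j l
      have eq: "cmod (D $ j $ l) = cmod (absdiff lam j l * (?qs **
          (if l < j then idm - mexp M (- h) else mexp M h - idm) ** ?q') $ j $ l)"
        by (simp add: D norm_mult del: of_real_diff)
      show "cmod (D $ j $ l) \<le> cd * (cmod ((?qs ** (mexp M h - idm) ** ?q') $ j $ l) +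
          cmod ((?qs ** (idm - mexp M (- h)) ** ?q') $ j $ l))"
        unfolding eq by (rule pick)
    qed
    have QV: "?qs ** ?V ** ?q' = - (?H N' ** B)"
    proof -
      have "?qs ** ?V ** ?q' = - ((?qs ** q t) ** ?H N' ** ?qs ** ?q')"
        by (simp only: grad_field_def conjug_def N'_def matrix_mul_assoc
          bounded_bilinear.minus_left[OF bounded_bilinear_matrix_mult]
          bounded_bilinear.minus_right[OF bounded_bilinear_matrix_mult])
      then show ?thesis by (simp add: unitary_groupD[OF q] B_def matrix_mul_assoc)
    qed
    have NB: "?qs ** N ** ?q' = N' ** B"
    proof -
      have "N' ** B = ?qs ** N ** (q t ** ?qs) ** ?q'"
        by (simp only: N'_def B_def conjug_def conj_transpose_conj_transpose matrix_mul_assoc)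
      then show ?thesis by (simp add: unitary_groupD[OF q])
    qed
    have iM: "\<i> * (?qs ** M ** ?q') $ j $ l = - (N' ** B) $ j $ l" for j l
    proof -
      have "(?qs ** M ** ?q') $ j $ l = \<i> * (?qs ** N ** ?q') $ j $ l"
        by (simp add: M matrix_mult_entry cscale_def sum_distrib_left sum_distrib_right mult_ac)
      then show ?thesis by (simp add: NB)
    qed
    have G: "G = - D - h *\<^sub>R (?qs ** ?V ** ?q')"
      by (simp add: G_def D_def mult_matrix_diff diff_matrix_mult
          bounded_bilinear.scaleR_left[OF bounded_bilinear_matrix_mult]
          bounded_bilinear.scaleR_right[OF bounded_bilinear_matrix_mult])
    \<comment> \<open>Replace the exponential difference by \<open>h *\<^sub>R M\<close> plus a
      remainder. Since \<open>\<i>\<close> times \<open>M\<close> is \<open>- N\<close>, the main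
      term is the Hadamard transform of \<open>N' ** B\<close>; the gradient contributes
      \<open>?H N' ** B\<close>, and only the commutator of the two operations survives.\<close>
    have G_entry: "G $ j $ l = \<i> * (absdiff lam j l * (?qs ** (if l < j then R2 h else R1 h) ** ?q') $ j $ l) -
        of_real h * (?H (N' ** B) - ?H N' ** B) $ j $ l" for j l
    proof -
      let ?E = "if l < j then idm - mexp M (- h) else mexp M h - idm"
      have E: "?E = (if l < j then R2 h else R1 h) + h *\<^sub>R M" by (simp add: R1_def R2_def)
      have "(?qs ** ?E ** ?q') $ j $ l = (?qs ** (if l < j then R2 h else R1 h) ** ?q') $ j $ l +
          of_real h * (?qs ** M ** ?q') $ j $ l"
        unfolding E
        by (simp add: bounded_bilinear.add_left[OF bounded_bilinear_matrix_mult]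
            bounded_bilinear.add_right[OF bounded_bilinear_matrix_mult]
            bounded_bilinear.scaleR_left[OF bounded_bilinear_matrix_mult]
            bounded_bilinear.scaleR_right[OF bounded_bilinear_matrix_mult] scaleR_conv_of_real[symmetric])
      then have "\<i> * (?qs ** ?E ** ?q') $ j $ l = \<i> * (?qs ** (if l < j then R2 h else R1 h) ** ?q') $ j $ l +
          of_real h * (\<i> * (?qs ** M ** ?q') $ j $ l)"
        by (simp only: distrib_left mult.left_commute)
      also have "\<i> * (?qs ** M ** ?q') $ j $ l = - (N' ** B) $ j $ l" by (rule iM)
      finally have *: "\<i> * (?qs ** ?E ** ?q') $ j $ l =
          \<i> * (?qs ** (if l < j then R2 h else R1 h) ** ?q') $ j $ l - of_real h * (N' ** B) $ j $ l"
        by simp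
      have "G $ j $ l = absdiff lam j l * (\<i> * (?qs ** ?E ** ?q') $ j $ l) + of_real h * (?H N' ** B) $ j $ l"
        by (simp add: G QV D del: of_real_diff) (simp add: scaleR_conv_of_real mult_ac)
      then show ?thesis unfolding * by (simp add: had_def algebra_simps del: of_real_diff)
    qed
    have nG: "entry_norm G \<le> cd * c * (entry_norm (R1 h) + entry_norm (R2 h)) + \<bar>h\<bar> * (entry_norm N' * entry_norm D)"
    proof -
      have "entry_norm G \<le> (\<Sum>j\<in>UNIV. \<Sum>l\<in>UNIV.
          cd * (cmod ((?qs ** R1 h ** ?q') $ j $ l) + cmod ((?qs ** R2 h ** ?q') $ j $ l)) +
          \<bar>h\<bar> * cmod ((?H (N' ** B) - ?H N' ** B) $ j $ l))"
      proof (rule entry_norm_le)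
        fix j l
        have "cmod (G $ j $ l) \<le>
            cmod (\<i> * (absdiff lam j l * (?qs ** (if l < j then R2 h else R1 h) ** ?q') $ j $ l)) +
            cmod (of_real h * (?H (N' ** B) - ?H N' ** B) $ j $ l)"
          unfolding G_entry by (rule norm_triangle_ineq4)
        also have "\<dots> \<le> cd * (cmod ((?qs ** R1 h ** ?q') $ j $ l) + cmod ((?qs ** R2 h ** ?q') $ j $ l)) +
          \<bar>h\<bar> * cmod ((?H (N' ** B) - ?H N' ** B) $ j $ l)"
          unfolding norm_mult[of \<i>] norm_mult[of "of_real h"] norm_ii mult_1_left norm_of_real
          by (intro add_mono pick order_refl)
        finally show "cmod (G $ j $ l) \<le>
          cd * (cmod ((?qs ** R1 h ** ?q') $ j $ l) + cmod ((?qs ** R2 h ** ?q') $ j $ l)) +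
          \<bar>h\<bar> * cmod ((?H (N' ** B) - ?H N' ** B) $ j $ l)" .
      qed
      also have "\<dots> = (\<Sum>j\<in>UNIV. \<Sum>l\<in>UNIV.
          cd * (cmod ((?qs ** R1 h ** ?q') $ j $ l) + cmod ((?qs ** R2 h ** ?q') $ j $ l))) +
          \<bar>h\<bar> * entry_norm (?H (N' ** B) - ?H N' ** B)"
        by (simp only: sum.distrib entry_norm_def sum_distrib_left)
      also have "\<dots> \<le> cd * c * (entry_norm (R1 h) + entry_norm (R2 h)) + \<bar>h\<bar> * (entry_norm N' * entry_norm D)"
        unfolding B_def D_def
        by (intro add_mono pick_sum mult_left_mono had_absdiff_commutator(1) q) auto
      finally show ?thesis .
    qed
    have "norm (?L (t + h) - ?L t - h *\<^sub>R ?V) \<le> c * entry_norm G"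
      using norm_le_entry_norm entry_norm_unitary_cancel[OF q q] order_trans unfolding c_def G_def by blast
    also have "\<dots> \<le> c * (cd * c * (entry_norm (R1 h) + entry_norm (R2 h)) + \<bar>h\<bar> * (entry_norm N' *
        (cd * c * (entry_norm (mexp M h - idm) + entry_norm (idm - mexp M (- h))))))"
      by (intro mult_left_mono order_trans[OF nG] add_left_mono nD c entry_norm_nonneg abs_ge_zero)
    also have "\<dots> = bound h * \<bar>h\<bar>" using h by (simp add: bound_def field_simps)
    finally show ?thesis using h by (simp add: divide_le_eq)
  qed
  have "(bound \<longlongrightarrow> c * (cd * c * (0 + 0) + entry_norm N' * (cd * c * (0 + 0)))) (at 0)"
    unfolding bound_def R1_def R2_def by (intro tendsto_intros mexp_difference_quotient)
  then have b0: "(bound \<longlongrightarrow> 0) (at 0)" by simp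
  have "((\<lambda>h. norm (?L (t + h) - ?L t - h *\<^sub>R ?V) / norm h) \<longlongrightarrow> 0) (at 0)"
    by (rule Lim_null_comparison[OF _ b0]) (use le in \<open>auto simp: eventually_at_filter\<close>)
  then show ?thesis
    unfolding has_vector_derivative_def has_derivative_at by (simp add: bounded_linear_scaleR_left)
qed

lemma cscale_hermitian:
  "N \<in> unitary_algebra \<Longrightarrow> conj_transpose (cscale \<i> N) = cscale \<i> N"
  by (rule matrix_eqI) (simp add: conj_transpose_entry cscale_def unitary_algebra_entry)

theorem flow_line_exists:
  fixes lam :: "real^'n::{finite,linorder}"
  assumes N: "N \<in> unitary_algebra" and g: "g \<in> unitary_group"
    and lam: "\<forall>i j. i \<le> j \<longrightarrow> lam $ j \<le> lam $ i"
  obtains q where "q 0 = g" "\<And>t. q t \<in> unitary_group"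
    "kaehler_gradient_flow_line lam N (\<lambda>t. adj_act lam (q t))"
    "\<And>t. \<exists>U. upper_tri_pos U \<and> q t = mexp (cscale \<i> N) t ** g ** U"
proof -
  let ?M = "cscale \<i> N"
  have "\<exists>p. fst p \<in> unitary_group \<and> upper_tri_pos (fst (snd p)) \<and> upper_tri_pos (snd (snd p)) \<and>
      mexp ?M t ** g = fst p ** fst (snd p) \<and> fst p = mexp ?M t ** g ** snd (snd p) \<and>
      (t = 0 \<longrightarrow> fst p = g)" for t
  proof (cases "t = 0")
    \<comment> \<open>At time 0 the trivial factorisation is chosen. The path then starts exactly at
      \<open>g\<close> without an appeal to uniqueness of the QR decomposition.\<close>
    case True
    then show ?thesis using g by (intro exI[of _ "(g, idm, idm)"]) (simp add: upper_tri_pos_idm mexp_0)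
  next
    case False
    have "(conj_transpose g ** mexp ?M (- t)) ** (mexp ?M t ** g) =
        conj_transpose g ** (mexp ?M (- t) ** mexp ?M t) ** g" by (simp only: matrix_mul_assoc)
    then have "(conj_transpose g ** mexp ?M (- t)) ** (mexp ?M t ** g) = idm"
      by (simp add: mexp_minus unitary_groupD[OF g])
    then obtain q R U where qru: "q \<in> unitary_group" "upper_tri_pos R" "upper_tri_pos U"
      "mexp ?M t ** g = q ** R" "q = mexp ?M t ** g ** U" by (rule qr_decomposition)
    show ?thesis
      by (rule exI[of _ "(q, R, U)"], unfold fst_conv snd_conv, intro conjI impI qru)
        (use False in simp)
  qed
  then obtain p where p: "\<And>t. fst (p t) \<in> unitary_group" "\<And>t. upper_tri_pos (fst (snd (p t)))"
    "\<And>t. upper_tri_pos (snd (snd (p t)))" "\<And>t. mexp ?M t ** g = fst (p t) ** fst (snd (p t))"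
    "\<And>t. fst (p t) = mexp ?M t ** g ** snd (snd (p t))" "\<And>t. t = 0 \<Longrightarrow> fst (p t) = g"
    by metis
  have lam': "\<And>i j. i \<le> j \<Longrightarrow> lam $ j \<le> lam $ i" using lam by blast
  show ?thesis
  proof (rule that[of "\<lambda>t. fst (p t)"])
    show "fst (p 0) = g" by (rule p(6)) simp
    show "kaehler_gradient_flow_line lam N (\<lambda>t. adj_act lam (fst (p t)))"
      unfolding flow_line_iff[OF N]
    proof (intro allI bexI conjI)
      show "((\<lambda>t. adj_act lam (fst (p t))) has_vector_derivative grad_field lam N (fst (p t))) (at t)" for t
        by (rule flow_has_vector_derivative[OF refl cscale_hermitian[OF N] lam' p(1,2,3,4,5)])
    qed (simp_all add: p(1))
    show "\<exists>U. upper_tri_pos U \<and> fst (p t) = mexp ?M t ** g ** U" for t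
      using p(3,5) by blast
  qed (rule p(1))
qed

section \<open>Positivity along the flow\<close>

definition unitary_nonneg :: "(complex^'n::{finite,linorder}^'n::{finite,linorder}) set" where
  "unitary_nonneg = {g \<in> unitary_group. \<forall>I. left_minor I g \<in> \<real> \<and> 0 \<le> Re (left_minor I g)}"

section \<open>Compactness of the unitary group and closures of positive parts\<close>

lemma continuous_on_conj_transpose: "continuous_on S conj_transpose"
proof (rule linear_continuous_on)
  have "linear conj_transpose"
    by (rule linearI) (auto intro!: matrix_eqI simp: conj_transpose_entry)
  then show "bounded_linear conj_transpose" by (rule linear_conv_bounded_linear[THEN iffD1])
qed

lemma compact_unitary_group: "compact (unitary_group :: (complex^'n^'n) set)"
proof (rule compact_eq_bounded_closed[THEN iffD2], rule conjI)
  have "norm g \<le> (of_nat CARD('n))\<^sup>2" if "g \<in> unitary_group" for g :: "complex^'n^'n"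
    using norm_le_entry_norm unitary_entry_norm[OF that] by (rule order_trans)
  then show "bounded (unitary_group :: (complex^'n^'n) set)" by (auto simp: bounded_iff)
  show "closed (unitary_group :: (complex^'n^'n) set)"
    unfolding unitary_group_def
    by (intro closed_Collect_conj closed_Collect_eq matrix_continuous_on_mult
        continuous_on_conj_transpose continuous_on_id continuous_on_const)
qed

lemma continuous_on_adj_act: "continuous_on unitary_group (adj_act lam)"
proof (rule continuous_on_eq)
  show "continuous_on unitary_group (\<lambda>g. conjug g (cscale \<i> (Diag lam)))"
    unfolding conjug_def
    by (intro matrix_continuous_on_mult continuous_on_conj_transpose continuous_on_id continuous_on_const)
qed (simp add: adj_act_unitary)

lemma continuous_on_left_minor: "continuous_on S (left_minor I)"
proof -
  have "continuous_on S (\<lambda>g. sdet (entries g) I)"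
    unfolding entries_def by (intro continuous_rdet continuous_intros)
  then show ?thesis by (simp flip: left_minor_eq_sdet)
qed

lemma closure_unitary_pos_subset:
  "closure (unitary_pos :: (complex^'n::{finite,linorder}^'n::{finite,linorder}) set) \<subseteq> unitary_nonneg"
  (is "closure ?P \<subseteq> _")
proof -
  have U: "closure ?P \<subseteq> unitary_group"
    by (rule closure_minimal[OF _ compact_imp_closed[OF compact_unitary_group]]) (auto simp: unitary_pos_def)
  have "closure ?P \<subseteq> {g. \<forall>I. left_minor I g \<in> \<real> \<and> 0 \<le> Re (left_minor I g)}"
  proof (rule closure_minimal)
    show "?P \<subseteq> {g. \<forall>I. left_minor I g \<in> \<real> \<and> 0 \<le> Re (left_minor I g)}"
      by (auto simp: unitary_pos_def intro: less_imp_le)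
    show "closed {g :: complex^'n::{finite,linorder}^'n::{finite,linorder}. \<forall>I. left_minor I g \<in> \<real> \<and> 0 \<le> Re (left_minor I g)}"
      unfolding complex_is_Real_iff
      by (intro closed_Collect_all closed_Collect_conj closed_Collect_eq closed_Collect_le
          continuous_intros continuous_on_left_minor)
  qed
  then show ?thesis using U by (auto simp: unitary_nonneg_def)
qed

text \<open>The image of a compact set is closed, so limits of positive orbit points lift to limits
  of positive unitary matrices. The sharper information \<open>closure unitary_pos\<close>, beyond
  nonnegative minors, is what later admits inequalities proved only for positive minors.\<close>

lemma orbit_nonneg_subset: "orbit_nonneg lam \<subseteq> adj_act lam ` closure unitary_pos"
  unfolding orbit_nonneg_def orbit_pos_def
proof (rule closure_minimal)
  show "adj_act lam ` unitary_pos \<subseteq> adj_act lam ` closure unitary_pos"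
    by (intro image_mono closure_subset)
  have U: "closure unitary_pos \<subseteq> unitary_group"
    using closure_unitary_pos_subset by (auto simp: unitary_nonneg_def)
  then have "closure unitary_pos = closure unitary_pos \<inter> unitary_group" by auto
  then have "compact (closure unitary_pos)"
    using closed_Int_compact[OF closed_closure compact_unitary_group] by metis
  then show "closed (adj_act lam ` closure unitary_pos)"
    by (intro compact_imp_closed compact_continuous_image continuous_on_subset[OF continuous_on_adj_act U])
qed

lemma unitary_minor_nonzero:
  fixes g :: "complex^'n::{finite,linorder}^'n::{finite,linorder}"
  assumes "g \<in> unitary_group" "k \<le> CARD('n)"
  shows "\<exists>J::'n set. card J = k \<and> left_minor J g \<noteq> 0"
  using exists_left_minor_nonzero[OF unitary_groupD(1)[OF assms(1)] assms(2)] by metis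

lemma left_minor_mult_upper_tri_pos:
  fixes A U :: "complex^'n::{finite,linorder}^'n::{finite,linorder}"
  assumes U: "upper_tri_pos U"
  shows "\<exists>c>0. \<forall>I. card I = k \<longrightarrow> left_minor I (A ** U) = of_real c * left_minor I A"
proof (intro exI[of _ "\<Prod>b<k. Re (U $ nth_index b $ nth_index b)"] conjI allI impI)
  show "0 < (\<Prod>b<k. Re (U $ nth_index b $ nth_index b))"
    using U by (auto simp: upper_tri_pos_def intro!: prod_pos)
next
  fix I :: "'n set" assume I: "card I = k"
  let ?xs = "sorted_list_of_set I"
  have "length ?xs \<le> CARD('n)" by (simp add: card_mono)
  then have "left_minor I (A ** U) = left_minor I A * (\<Prod>b<length ?xs. U $ nth_index b $ nth_index b)"
    unfolding left_minor_eq_sdet using U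
    by (intro rdet_mult_upper_triangular) (auto simp: upper_tri_pos_def)
  also have "(\<Prod>b<length ?xs. U $ nth_index b $ nth_index b) =
      of_real (\<Prod>b<k. Re (U $ nth_index b $ nth_index b))"
    using U unfolding of_real_prod
    by (intro prod.cong) (simp_all add: I upper_tri_pos_def complex_is_Real_iff complex_eq_iff)
  finally show "left_minor I (A ** U) =
      of_real (\<Prod>b<k. Re (U $ nth_index b $ nth_index b)) * left_minor I A" by simp
qed

lemma entries_mexp_has_vector_derivative:
  fixes M g :: "complex^'n::{finite,linorder}^'n::{finite,linorder}"
  shows "((\<lambda>t. entries (mexp M t ** g) r b) has_vector_derivative
    (\<Sum>l\<in>UNIV. M $ r $ l * entries (mexp M t ** g) l b)) (at t)"
proof -
  have "((\<lambda>t. mexp M t ** g) has_vector_derivative mexp M t ** 0 + (M ** mexp M t) ** g) (at t)"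
    by (intro matrix_has_vector_derivative_mult mexp_has_vector_derivative has_vector_derivative_const)
  then have "((\<lambda>t. mexp M t ** g) has_vector_derivative M ** (mexp M t ** g)) (at t)"
    by (simp add: matrix_mul_assoc bounded_bilinear.zero_right[OF bounded_bilinear_matrix_mult])
  from matrix_has_vector_derivative_entry[OF this, of r "nth_index b"]
  show ?thesis by (simp only: entries_def matrix_mult_entry[of M])
qed

lemma complexify_entry: "complexify T $ i $ j = of_real (T $ i $ j)"
  by (simp add: complexify_def)

lemmas entries_complexify_has_vector_derivative =
  entries_mexp_has_vector_derivative[of "complexify T" for T, unfolded complexify_entry]

lemma mexp_flow_nonneg:
  fixes T :: "real^'n::{finite,linorder}^'n::{finite,linorder}"
  assumes T: "T \<in> gl_nonneg" and g: "g \<in> unitary_nonneg" and t: "0 \<le> t"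
    and q: "q \<in> unitary_group" "q = mexp (complexify T) t ** g ** U" "upper_tri_pos U"
  shows "q \<in> unitary_nonneg"
  unfolding unitary_nonneg_def
proof (intro CollectI conjI allI q(1))
  fix I
  obtain c where c: "0 < c" "left_minor I q = of_real c * left_minor I (mexp (complexify T) t ** g)"
    unfolding q(2) using left_minor_mult_upper_tri_pos[OF q(3)] by blast
  have "sdet (entries (mexp (complexify T) t ** g)) I \<in> \<real> \<and>
      0 \<le> Re (sdet (entries (mexp (complexify T) t ** g)) I)"
    by (rule minor_flow_totally_nonneg[OF T entries_complexify_has_vector_derivative _ t])
      (use g in \<open>auto simp: mexp_0 unitary_nonneg_def simp flip: left_minor_eq_sdet\<close>)
  then show "left_minor I q \<in> \<real>" "0 \<le> Re (left_minor I q)"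
    using c by (simp_all add: left_minor_eq_sdet complex_is_Real_iff)
qed

lemma mexp_flow_pos:
  fixes T :: "real^'n::{finite,linorder}^'n::{finite,linorder}"
  assumes T: "T \<in> gl_pos" and g: "g \<in> unitary_nonneg" and t: "0 < t"
    and q: "q \<in> unitary_group" "q = mexp (complexify T) t ** g ** U" "upper_tri_pos U"
  shows "q \<in> unitary_pos"
  unfolding unitary_pos_def
proof (intro CollectI conjI allI q(1))
  fix I
  obtain c where c: "0 < c" "left_minor I q = of_real c * left_minor I (mexp (complexify T) t ** g)"
    unfolding q(2) using left_minor_mult_upper_tri_pos[OF q(3)] by blast
  have gU: "g \<in> unitary_group" using g by (simp add: unitary_nonneg_def)
  have "sdet (entries (mexp (complexify T) t ** g)) I \<in> \<real> \<and>
      0 < Re (sdet (entries (mexp (complexify T) t ** g)) I)"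
    by (rule minor_flow_totally_positive[OF T entries_complexify_has_vector_derivative _ _ t])
      (use g unitary_minor_nonzero[OF gU] in
        \<open>auto simp: mexp_0 unitary_nonneg_def simp flip: left_minor_eq_sdet\<close>)
  then show "left_minor I q \<in> \<real>" "0 < Re (left_minor I q)"
    using c by (simp_all add: left_minor_eq_sdet complex_is_Real_iff)
qed

text \<open>The flow itself proves the approximation. For the adjacency matrix \<open>T\<close> of
  the path of indices, a strictly positive generator, the trajectory through \<open>g\<close> is in
  the positive part for all \<open>t > 0\<close> and tends to its starting point as \<open>t\<close>
  goes to 0.\<close>

lemma adj_act_unitary_nonneg:
  fixes lam :: "real^'n::{finite,linorder}"
  assumes lam: "\<forall>i j. i \<le> j \<longrightarrow> lam $ j \<le> lam $ i" and g: "g \<in> unitary_nonneg"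
  shows "adj_act lam g \<in> orbit_nonneg lam"
proof -
  define T :: "real^'n::{finite,linorder}^'n::{finite,linorder}"
    where "T = (\<chi> i j. if next_index i j \<or> next_index j i then 1 else 0)"
  have T: "T \<in> gl_pos" by (auto simp: gl_pos_def tridiagonal_def T_def)
  define N where "N = cscale (- \<i>) (complexify T)"
  have iN: "cscale \<i> N = complexify T"
    by (rule matrix_eqI) (simp add: N_def cscale_def flip: mult.assoc)
  have N: "N \<in> unitary_algebra"
    by (auto simp: unitary_algebra_entry N_def cscale_def complexify_def T_def)
  have gU: "g \<in> unitary_group" using g by (simp add: unitary_nonneg_def)
  obtain q where q: "q 0 = g" "\<And>t. q t \<in> unitary_group"
    "kaehler_gradient_flow_line lam N (\<lambda>t. adj_act lam (q t))"
    "\<And>t. \<exists>U. upper_tri_pos U \<and> q t = mexp (cscale \<i> N) t ** g ** U"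
    using flow_line_exists[OF N gU lam] by metis
  have pos: "adj_act lam (q t) \<in> orbit_pos lam" if "0 < t" for t
    using q(4)[of t] mexp_flow_pos[OF T g that q(2)] unfolding iN orbit_pos_def by blast
  obtain V where "((\<lambda>t. adj_act lam (q t)) has_vector_derivative V) (at 0)"
    using q(3) unfolding kaehler_gradient_flow_line_def by blast
  then have "isCont (\<lambda>t. adj_act lam (q t)) 0" by (rule has_vector_derivative_continuous)
  then have "((\<lambda>t. adj_act lam (q t)) \<longlongrightarrow> adj_act lam g) (at_right 0)"
    unfolding isCont_def q(1) by (rule filterlim_at_split[THEN iffD1, THEN conjunct2])
  moreover have "\<forall>\<^sub>F t in at_right 0. adj_act lam (q t) \<in> closure (orbit_pos lam)"
    by (rule eventually_at_right_less[THEN eventually_mono]) (use pos closure_subset in blast)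
  ultimately show ?thesis unfolding orbit_nonneg_def
    by (intro Lim_in_closed_set[OF closed_closure]) auto
qed

lemma flow_line_eq:
  fixes lam :: "real^'n::{finite,linorder}"
  assumes lam: "\<forall>i j. i \<le> j \<longrightarrow> lam $ j \<le> lam $ i" and N: "N \<in> unitary_algebra"
    and L: "kaehler_gradient_flow_line lam N L" and g: "g \<in> unitary_group" "L 0 = adj_act lam g"
    and t: "0 \<le> t"
  obtains q U where "q \<in> unitary_group" "upper_tri_pos U" "q = mexp (cscale \<i> N) t ** g ** U"
    "L t = adj_act lam q"
proof -
  obtain q where q: "q 0 = g" "\<And>t. q t \<in> unitary_group"
    "kaehler_gradient_flow_line lam N (\<lambda>t. adj_act lam (q t))"
    "\<And>t. \<exists>U. upper_tri_pos U \<and> q t = mexp (cscale \<i> N) t ** g ** U"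
    using flow_line_exists[OF N g(1) lam] by metis
  obtain U where U: "upper_tri_pos U" "q t = mexp (cscale \<i> N) t ** g ** U" using q(4) by blast
  have "L t = adj_act lam (q t)"
    by (rule flow_line_unique[OF N L q(3) _ t]) (simp add: q(1) g(2))
  then show ?thesis by (rule that[OF q(2) U])
qed

lemma weakly_preserves_positivityI:
  fixes lam :: "real^'n::{finite,linorder}"
  assumes lam: "\<forall>i j. i \<le> j \<longrightarrow> lam $ j \<le> lam $ i" and N: "N \<in> unitary_algebra"
    and T: "T \<in> gl_nonneg" "cscale \<i> N = complexify T"
  shows "weakly_preserves_positivity lam (kaehler_gradient_flow_line lam N)"
  unfolding weakly_preserves_positivity_def
proof (intro allI impI)
  fix L and t :: real
  assume L: "kaehler_gradient_flow_line lam N L" "L 0 \<in> orbit_nonneg lam" and t: "0 \<le> t"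
  obtain g where g: "g \<in> unitary_nonneg" "L 0 = adj_act lam g"
    using L(2) orbit_nonneg_subset closure_unitary_pos_subset by fast
  then have gU: "g \<in> unitary_group" by (simp add: unitary_nonneg_def)
  obtain q U where q: "q \<in> unitary_group" "upper_tri_pos U" "q = mexp (cscale \<i> N) t ** g ** U"
    "L t = adj_act lam q" by (rule flow_line_eq[OF lam N L(1) gU g(2) t])
  show "L t \<in> orbit_nonneg lam" unfolding q(4)
    by (rule adj_act_unitary_nonneg[OF lam mexp_flow_nonneg[OF T(1) g(1) t q(1) q(3)[unfolded T(2)] q(2)]])
qed

lemma strictly_preserves_positivityI:
  fixes lam :: "real^'n::{finite,linorder}"
  assumes lam: "\<forall>i j. i \<le> j \<longrightarrow> lam $ j \<le> lam $ i" and N: "N \<in> unitary_algebra"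
    and T: "T \<in> gl_pos" "cscale \<i> N = complexify T"
  shows "strictly_preserves_positivity lam (kaehler_gradient_flow_line lam N)"
  unfolding strictly_preserves_positivity_def
proof (intro allI impI)
  fix L and t :: real
  assume L: "kaehler_gradient_flow_line lam N L" "L 0 \<in> orbit_nonneg lam" and t: "0 < t"
  obtain g where g: "g \<in> unitary_nonneg" "L 0 = adj_act lam g"
    using L(2) orbit_nonneg_subset closure_unitary_pos_subset by fast
  then have gU: "g \<in> unitary_group" by (simp add: unitary_nonneg_def)
  obtain q U where q: "q \<in> unitary_group" "upper_tri_pos U" "q = mexp (cscale \<i> N) t ** g ** U"
    "L t = adj_act lam q" by (rule flow_line_eq[OF lam N L(1) gU g(2) less_imp_le[OF t]])
  show "L t \<in> orbit_pos lam" unfolding q(4) orbit_pos_def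
    by (rule imageI[OF mexp_flow_pos[OF T(1) g(1) t q(1) q(3)[unfolded T(2)] q(2)]])
qed

section \<open>Necessity of the tridiagonal form\<close>

text \<open>For positive minors this is \<open>truncated_pluecker_sign\<close>, which divides by
  minors. The resulting inequality is polynomial in the entries and so passes to the
  closure.\<close>

lemma closure_truncated_pluecker:
  fixes g :: "complex^'n::{finite,linorder}^'n::{finite,linorder}" and x :: 'n
  assumes g: "g \<in> closure unitary_pos"
    and SC: "S \<inter> C = {}" "2 \<le> card C" "C \<inter> {..x} \<noteq> {}"
  shows "0 \<le> Re (- ((-1) ^ card (C \<inter> {..x})) *
    (\<Sum>y\<in>C \<inter> {..x}. (-1) ^ card {z\<in>C. z < y} *
      (left_minor (insert y S) g * left_minor (S \<union> C - {y}) g)))"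
proof -
  let ?f = "\<lambda>g. Re (- ((-1) ^ card (C \<inter> {..x})) *
    (\<Sum>y\<in>C \<inter> {..x}. (-1) ^ card {z\<in>C. z < y} *
      (left_minor (insert y S) g * left_minor (S \<union> C - {y}) g)))"
  have "closure unitary_pos \<subseteq> {g. 0 \<le> ?f g}"
  proof (rule closure_minimal)
    show "closed {g :: complex^'n::{finite,linorder}^'n::{finite,linorder}. 0 \<le> ?f g}"
      by (intro closed_Collect_le continuous_intros continuous_on_left_minor)
    show "unitary_pos \<subseteq> {g. 0 \<le> ?f g}"
    proof
      fix g :: "complex^'n::{finite,linorder}^'n::{finite,linorder}"
      assume g: "g \<in> unitary_pos"
      define d where "d X = Re (left_minor X g)" for X
      have lm: "left_minor X g = of_real (d X)" for X
        using g by (auto simp: d_def unitary_pos_def complex_is_Real_iff complex_eq_iff)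
      have rel: "(\<Sum>y\<in>C. (-1) ^ card {z\<in>C. z < y} * d (insert y S) * d (S \<union> C - {y})) = 0"
        if "S \<inter> C = {}" "2 \<le> card C" for S C :: "'n set"
      proof -
        have "(\<Sum>y\<in>C. (-1) ^ card {z\<in>C. z < y} * left_minor (insert y S) g *
            left_minor (S \<union> C - {y}) g) = 0"
          unfolding left_minor_eq_sdet by (rule pluecker) (use that in auto)
        then have "of_real (\<Sum>y\<in>C. (-1) ^ card {z\<in>C. z < y} * d (insert y S) * d (S \<union> C - {y})) = (0::complex)"
          by (simp add: lm)
        then show ?thesis by (simp only: of_real_eq_0_iff)
      qed
      have "0 \<le> - ((-1) ^ card (C \<inter> {..x})) *
        (\<Sum>y\<in>C \<inter> {..x}. (-1) ^ card {z\<in>C. z < y} * d (insert y S) * d (S \<union> C - {y}))"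
        by (rule truncated_pluecker_sign[OF rel _ SC]) (use g in \<open>auto simp: d_def unitary_pos_def\<close>)
      also have "\<dots> = Re (of_real (- ((-1) ^ card (C \<inter> {..x})) *
        (\<Sum>y\<in>C \<inter> {..x}. (-1) ^ card {z\<in>C. z < y} * d (insert y S) * d (S \<union> C - {y}))))"
        by (simp only: Re_complex_of_real)
      also have "\<dots> = ?f g" by (simp add: lm mult.assoc)
      finally show "g \<in> {g. 0 \<le> ?f g}" by simp
    qed
  qed
  then show ?thesis using g by blast
qed

text \<open>The subspaces spanned by the first \<open>k\<close> columns are determined by the point of the orbit for the
  positions \<open>k\<close> of the descents of \<open>lam\<close>.\<close>

definition descent :: "real^'n::{finite,linorder} \<Rightarrow> nat \<Rightarrow> bool" where
  "descent lam k \<longleftrightarrow> 0 < k \<and> k < CARD('n) \<and> lam $ nth_index (k - 1) \<noteq> lam $ nth_index k"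

text \<open>Equality of the points makes \<open>conj_transpose g ** h\<close> commute with the
  diagonal matrix, hence block diagonal for the groups of equal eigenvalues. A descent ends such a
  group, so \<open>rdet_mult\<close> applies there. The factor \<open>c\<close> is nonzero because
  \<open>h\<close> has some nonzero minor of order \<open>k\<close>.\<close>

lemma adj_act_eq_left_minor:
  fixes lam :: "real^'n::{finite,linorder}"
  assumes lam: "\<forall>i j. i \<le> j \<longrightarrow> lam $ j \<le> lam $ i" and k: "descent lam k"
    and g: "g \<in> unitary_group" and h: "h \<in> unitary_group" and eq: "adj_act lam g = adj_act lam h"
  shows "\<exists>c. c \<noteq> 0 \<and> (\<forall>X. card X = k \<longrightarrow> left_minor X h = c * left_minor X g)"
proof -
  let ?B = "conj_transpose g ** h"
  define c where "c = Determinant.det (Matrix.mat k k (\<lambda>(a, b). ?B $ nth_index a $ nth_index b))"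
  have B0: "?B $ j $ l = 0" if "lam $ j \<noteq> lam $ l" for j l
    using adj_act_diff_entry[OF g h, of lam j l] that unfolding eq
    by (simp add: bounded_bilinear.zero_left[OF bounded_bilinear_matrix_mult]
        bounded_bilinear.zero_right[OF bounded_bilinear_matrix_mult])
  have "g ** ?B = (g ** conj_transpose g) ** h" by (simp only: matrix_mul_assoc)
  then have gB: "h = g ** ?B" by (simp add: unitary_groupD[OF g])
  have "?B $ nth_index a $ nth_index b = 0" if ab: "k \<le> a" "a < CARD('n)" "b < k" for a b
  proof (rule B0)
    have le: "nth_index i \<le> (nth_index j :: 'n)" if "i \<le> j" "j < CARD('n)" for i j
      using that nth_index_less[of i j] by (cases "i = j") (auto intro: less_imp_le)
    have "lam $ nth_index a \<le> lam $ nth_index k" using lam le ab by blast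
    moreover have "lam $ nth_index k \<le> lam $ nth_index (k - 1)"
      using lam le[of "k - 1" k] k by (auto simp: descent_def)
    moreover have "lam $ nth_index (k - 1) \<le> lam $ nth_index b"
      using lam le[of b "k - 1"] k ab by (auto simp: descent_def)
    ultimately show "lam $ nth_index a \<noteq> lam $ nth_index b" using k by (auto simp: descent_def)
  qed
  then have "rdet (entries (g ** ?B)) (sorted_list_of_set X) = rdet (entries g) (sorted_list_of_set X) * c"
    if "card X = k" for X
    unfolding c_def using k that by (intro rdet_mult) (auto simp: descent_def)
  then have X: "left_minor X h = c * left_minor X g" if "card X = k" for X
    using that gB by (simp add: left_minor_eq_sdet mult.commute)
  obtain J where "card J = k" "left_minor J h \<noteq> 0"
    using unitary_minor_nonzero[OF h, of k] k by (auto simp: descent_def)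
  then have "c \<noteq> 0" using X by auto
  then show ?thesis using X by blast
qed

text \<open>A signed permutation matrix whose first columns run through \<open>I\<close>, then
  through the rest of \<open>I'\<close>. Nonvanishing is stated for lists because the derivative
  formula produces unsorted ones.\<close>

lemma exists_coordinate_flag:
  fixes I I' :: "'n::{finite,linorder} set"
  assumes "I \<subseteq> I'"
  obtains g where "g \<in> unitary_nonneg"
    and "\<And>ys. length ys = card I \<Longrightarrow> rdet (entries g) ys \<noteq> 0 \<longleftrightarrow> set ys = I"
    and "\<And>ys. length ys = card I' \<Longrightarrow> rdet (entries g) ys \<noteq> 0 \<longleftrightarrow> set ys = I'"
    and "left_minor I g = 1" "left_minor I' g = 1"
proof -
  let ?n = "CARD('n)"
  define ws where "ws = sorted_list_of_set I @ sorted_list_of_set (I' - I) @ sorted_list_of_set (- I')"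
  have cI': "card I' = card I + card (I' - I)"
    using assms by (simp add: card_Diff_subset card_mono)
  have dws: "distinct ws" "set ws = UNIV" using assms by (auto simp: ws_def)
  then have lws: "length ws = ?n" using distinct_card by fastforce
  define W where "W k = set (take k ws)" for k
  have WI: "W (card I) = I" "W (card I') = I'"
    using assms cI' by (auto simp: W_def ws_def)
  have cW: "card (W k) = k" if "k \<le> ?n" for k
    using that dws lws by (simp add: W_def distinct_card)
  have mem: "ws ! b \<in> W k" if "b < k" "k \<le> ?n" for b k
    using that lws unfolding W_def by (metis in_set_conv_nth length_take min.absorb2 nth_take)
  have memD: "\<exists>b<k. y = ws ! b" if "y \<in> W k" "k \<le> ?n" for y k
    using that lws unfolding W_def by (auto simp: in_set_conv_nth)
  have ws_eq: "ws ! a = ws ! b \<longleftrightarrow> a = b" if "a < ?n" "b < ?n" for a b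
    using that dws lws by (simp add: nth_eq_iff_index_eq)
  define P where "P r b = (if r = ws ! b then 1 else 0 :: complex)" for r b
  have P0: "rdet P ys = 0" if P0: "length ys = k" "k \<le> ?n" "set ys \<noteq> W k" for ys k
  proof (cases "distinct ys")
    case True
    then have "card (set ys) = card (W k)" using that cW by (simp add: distinct_card)
    then have "\<not> set ys \<subseteq> W k" using that(3) by (metis card_subset_eq finite)
    then obtain y where "y \<in> set ys" "y \<notin> W k" by auto
    then obtain a where a: "a < k" "ys ! a \<notin> W k" using P0(1) by (auto simp: in_set_conv_nth)
    have "rdet P ys = (\<Sum>b<k. Matrix.mat k k (\<lambda>(a, b). P (ys ! a) b) $$ (a, b) *
        cofactor (Matrix.mat k k (\<lambda>(a, b). P (ys ! a) b)) a b)"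
      unfolding rdet_def that(1) by (rule laplace_expansion_row) (use a in auto)
    also have "\<dots> = 0"
      using a mem[OF _ that(2)] by (intro sum.neutral) (auto simp: P_def)
    finally show ?thesis .
  qed (rule rdet_not_distinct)
  have P1: "rdet P ys * rdet P ys = 1" if ys: "length ys = k" "k \<le> ?n" "set ys = W k" for ys k
  proof -
    let ?A = "Matrix.mat k k (\<lambda>(a, b). P (ys ! a) b)"
    have dys: "distinct ys" using ys cW by (metis card_distinct)
    have "?A * transpose_mat ?A = 1\<^sub>m k"
    proof (rule eq_matI)
      fix a b assume "a < dim_row (1\<^sub>m k)" "b < dim_col (1\<^sub>m k)"
      then have ab: "a < k" "b < k" by auto
      then have "ys ! a \<in> W k" using ys by (metis nth_mem)
      then obtain c where c: "c < k" "ys ! a = ws ! c" using memD ys(2) by blast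
      have "(\<Sum>l<k. P (ys ! a) l * P (ys ! b) l) = (\<Sum>l<k. if l = c then P (ys ! b) c else 0)"
        using c ys(2) by (intro sum.cong refl) (auto simp: P_def ws_eq)
      also have "\<dots> = P (ys ! b) c" using c by simp
      also have "\<dots> = (if a = b then 1 else 0)"
        using c ab dys ys(1) nth_eq_iff_index_eq[OF dys, of a b] by (auto simp: P_def)
      finally show "(?A * transpose_mat ?A) $$ (a, b) = 1\<^sub>m k $$ (a, b)"
        using ab by (simp add: Matrix.scalar_prod_def atLeast0LessThan)
    qed auto
    then have "Determinant.det ?A * Determinant.det (transpose_mat ?A) = 1"
      by (metis det_mult det_one mat_carrier transpose_carrier_mat)
    moreover have "Determinant.det (transpose_mat ?A) = Determinant.det ?A"
      by (rule det_transpose[of _ k]) simp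
    ultimately show ?thesis by (simp add: rdet_def ys(1))
  qed
  define \<delta> where "\<delta> k = sdet P (W k)" for k
  have \<delta>: "\<delta> k * \<delta> k = 1" if "k \<le> ?n" for k
    unfolding \<delta>_def by (rule P1[OF _ that]) (use cW[OF that] in auto)
  then have \<delta>1: "\<delta> k = 1 \<or> \<delta> k = - 1" if "k \<le> ?n" for k
    using that by (metis square_eq_1_iff power2_eq_square)
  have \<delta>0: "\<delta> 0 = 1" by (simp add: \<delta>_def W_def rdet_def)
  \<comment> \<open>The column signs telescope: the first \<open>k\<close> of them multiply to
    \<open>\<delta> k\<close>, which is the sign of the only nonzero minor of order \<open>k\<close>
    of the permutation matrix. So that minor becomes 1.\<close>
  define \<sigma> where "\<sigma> b = \<delta> (Suc b) * \<delta> b" for b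
  define PM :: "complex^'n::{finite,linorder}^'n::{finite,linorder}" where "PM = (\<chi> r c. P r (card {..<c}))"
  define SM :: "complex^'n::{finite,linorder}^'n::{finite,linorder}" where "SM = (\<chi> r c. if r = c then \<sigma> (card {..<c}) else 0)"
  define g where "g = PM ** SM"
  have prod: "(\<Prod>b<k. \<sigma> b) = \<delta> k" if "k \<le> ?n" for k
    using that
  proof (induction k)
    case (Suc k)
    then show ?case using \<delta>[of k] by (simp add: \<sigma>_def mult.left_commute)
  qed (simp add: \<delta>0)
  have rg: "rdet (entries g) ys = rdet P ys * \<delta> k" if ys: "length ys = k" "k \<le> ?n" for ys k
  proof -
    have "rdet (entries g) ys = rdet (entries PM) ys * (\<Prod>b<length ys. SM $ nth_index b $ nth_index b)"
      unfolding g_def by (rule rdet_mult_upper_triangular) (use ys in \<open>auto simp: SM_def\<close>)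
    also have "(\<Prod>b<length ys. SM $ nth_index b $ nth_index b) = (\<Prod>b<k. \<sigma> b)"
      using ys by (intro prod.cong) (auto simp: SM_def card_lessThan_nth_index)
    also have "rdet (entries PM) ys = rdet P ys"
      unfolding rdet_def using ys
      by (intro arg_cong[where f = Determinant.det] eq_matI)
        (auto simp: entries_def PM_def card_lessThan_nth_index)
    finally show ?thesis using prod[OF ys(2)] by simp
  qed
  have lg: "left_minor X g = (if X = W (card X) then 1 else 0)" for X
  proof -
    have k: "card X \<le> ?n" by (simp add: card_mono)
    show ?thesis
    proof (cases "X = W (card X)")
      case True
      have "sdet P X = \<delta> (card X)" unfolding \<delta>_def by (rule arg_cong[OF True])
      then have "left_minor X g = 1"
        using rg[OF _ k, of "sorted_list_of_set X"] \<delta>[OF k] by (simp add: left_minor_eq_sdet)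
      then show ?thesis using True by simp
    next
      case False
      then have "rdet P (sorted_list_of_set X) = 0" by (intro P0[OF _ k]) auto
      then show ?thesis using rg[OF _ k, of "sorted_list_of_set X"] False by (simp add: left_minor_eq_sdet)
    qed
  qed
  have "conj_transpose g ** g = idm"
  proof (rule matrix_eqI)
    fix c d :: 'n
    have lt: "card {..<c} < ?n" for c :: 'n by (rule psubset_card_mono) auto
    have ge: "g $ r $ c = P r (card {..<c}) * \<sigma> (card {..<c})" for r c
      unfolding g_def matrix_mult_entry SM_def PM_def by (simp add: mult_delta_right)
    have "\<sigma> (card {..<c}) * \<sigma> (card {..<c}) = 1" "cnj (\<sigma> (card {..<c})) = \<sigma> (card {..<c})"
      using \<delta>1[of "card {..<c}"] \<delta>1[of "Suc (card {..<c})"] lt[of c] by (auto simp: \<sigma>_def)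
    moreover have "card {..<c} = card {..<d} \<longleftrightarrow> c = d"
      by (metis card_lessThan_nth_index nth_index_cases)
    moreover have "(conj_transpose g ** g) $ c $ d = (\<Sum>r\<in>UNIV. if r = ws ! card {..<c} then
        cnj (\<sigma> (card {..<c})) * \<sigma> (card {..<d}) * P r (card {..<d}) else 0)"
      unfolding matrix_mult_entry conj_transpose_entry ge by (intro sum.cong refl) (auto simp: P_def)
    ultimately show "(conj_transpose g ** g) $ c $ d = idm $ c $ d"
      using ws_eq[OF lt[of c] lt[of d]] by (auto simp: idm_entry P_def)
  qed
  then have gU: "g \<in> unitary_group" by (simp add: unitary_group_def matrix_left_right_inverse)
  have ne: "rdet (entries g) ys \<noteq> 0 \<longleftrightarrow> set ys = W k" if ys: "length ys = k" "k \<le> ?n" for ys k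
    using P0[OF ys] P1[OF ys] \<delta>[OF ys(2)] rg[OF ys] by auto
  show ?thesis
  proof (rule that[of g])
    show "g \<in> unitary_nonneg" using gU by (auto simp: unitary_nonneg_def lg)
    show "left_minor I g = 1" "left_minor I' g = 1" using WI by (simp_all add: lg)
    show "rdet (entries g) ys \<noteq> 0 \<longleftrightarrow> set ys = I" if "length ys = card I" for ys
      using ne[OF that] WI by (simp add: card_mono)
    show "rdet (entries g) ys \<noteq> 0 \<longleftrightarrow> set ys = I'" if "length ys = card I'" for ys
      using ne[OF that] WI by (simp add: card_mono)
  qed
qed

text \<open>With at most one descent, \<open>lam\<close> is constant before and from it on, and so
  takes at most two values.\<close>

lemma two_descents:
  fixes lam :: "real^'n::{finite,linorder}"
  assumes "3 \<le> card (range (\<lambda>i. lam $ i))"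
  obtains k k' where "descent lam k" "descent lam k'" "k < k'"
proof (rule ccontr)
  note witnesses = that
  assume no: "\<not> thesis"
  have uniq: "k = k'" if "descent lam k" "descent lam k'" for k k'
    using that no witnesses[of k k'] witnesses[of k' k] by (metis linorder_neqE_nat)
  let ?f = "\<lambda>b. lam $ (nth_index b :: 'n)"
  have const: "?f b = ?f a" if "a \<le> b" "b < CARD('n)" "\<And>c. a < c \<Longrightarrow> c \<le> b \<Longrightarrow> \<not> descent lam c" for a b
    using that
  proof (induction b rule: dec_induct)
    case (step b)
    then have "\<not> descent lam (Suc b)" "?f b = ?f a" by auto
    then show ?case using step.prems by (simp add: descent_def)
  qed simp
  have "\<exists>k<CARD('n). range (\<lambda>i. lam $ i) \<subseteq> {?f 0, ?f k}"
  proof (cases "\<exists>k. descent lam k")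
    case True
    then obtain k where k: "descent lam k" by blast
    have "lam $ i \<in> {?f 0, ?f k}" for i
    proof -
      obtain b where b: "b < CARD('n)" "i = nth_index b" by (rule nth_index_cases)
      show ?thesis
      proof (cases "k \<le> b")
        case True
        have "?f b = ?f k" by (rule const[OF True b(1)]) (use uniq[OF k] in auto)
        then show ?thesis by (simp add: b)
      next
        case False
        have "?f b = ?f 0" by (rule const[OF _ b(1)]) (use uniq[OF k] False in auto)
        then show ?thesis by (simp add: b)
      qed
    qed
    then show ?thesis using k by (auto simp: descent_def)
  next
    case False
    have "lam $ i = ?f 0" for i
    proof -
      obtain b where b: "b < CARD('n)" "i = nth_index b" by (rule nth_index_cases)
      show ?thesis unfolding b(2) by (rule const[OF _ b(1)]) (use False in auto)
    qed
    then show ?thesis by (intro exI[of _ 0]) auto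
  qed
  then obtain k where "range (\<lambda>i. lam $ i) \<subseteq> {?f 0, ?f k}" by blast
  then have "card (range (\<lambda>i. lam $ i)) \<le> card {?f 0, ?f k}" by (intro card_mono) auto
  also have "\<dots> \<le> 2" by (simp add: card_insert_if)
  finally show False using assms by simp
qed

text \<open>The sign conditions hold for a representative whose minors differ from those of the
  exponential flow by an unknown complex factor in each order. Dividing by \<open>W\<close>, built
  from minors that are 1 at the start, cancels these factors, and \<open>Z t / (t * W t)\<close>
  tends to \<open>Z'\<close>.\<close>

lemma derivative_nonneg_real:
  fixes Z W :: "real \<Rightarrow> complex"
  assumes Z: "(Z has_vector_derivative Z') (at 0)" "Z 0 = 0"
    and W: "isCont W 0" "W 0 = 1"
    and ratio: "\<And>t. 0 < t \<Longrightarrow> W t \<noteq> 0 \<Longrightarrow> Z t / W t \<in> \<real> \<and> 0 \<le> Re (Z t / W t)"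
  shows "Z' \<in> \<real> \<and> 0 \<le> Re Z'"
proof -
  have "((\<lambda>h. norm (Z (0 + h) - Z 0 - h *\<^sub>R Z') / norm h) \<longlongrightarrow> 0) (at 0)"
    using Z(1) unfolding has_vector_derivative_def has_derivative_at by blast
  then have "((\<lambda>h. norm (Z h - h *\<^sub>R Z') / norm h) \<longlongrightarrow> 0) (at_right 0)"
    using Z(2) by (auto intro: tendsto_mono[OF at_le])
  moreover have "\<forall>\<^sub>F h in at_right 0. norm (Z h - h *\<^sub>R Z') / norm h = norm ((1 / h) *\<^sub>R Z h - Z')"
  proof (rule eventually_at_right_less[THEN eventually_mono])
    fix h :: real assume h: "0 < h"
    have "norm ((1 / h) *\<^sub>R Z h - Z') = norm ((1 / h) *\<^sub>R (Z h - h *\<^sub>R Z'))"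
      using h by (simp add: scaleR_diff_right)
    then show "norm (Z h - h *\<^sub>R Z') / norm h = norm ((1 / h) *\<^sub>R Z h - Z')"
      using h by simp
  qed
  ultimately have "((\<lambda>h. norm ((1 / h) *\<^sub>R Z h - Z')) \<longlongrightarrow> 0) (at_right 0)"
    by (rule Lim_transform_eventually)
  then have "((\<lambda>h. (1 / h) *\<^sub>R Z h - Z') \<longlongrightarrow> 0) (at_right 0)" by (simp only: tendsto_norm_zero_iff)
  then have "((\<lambda>h. (1 / h) *\<^sub>R Z h) \<longlongrightarrow> Z') (at_right 0)" by (simp add: LIM_zero_iff)
  moreover have Wt: "(W \<longlongrightarrow> 1) (at_right 0)"
    using W by (auto simp: isCont_def intro: tendsto_mono[OF at_le])
  ultimately have "((\<lambda>h. (1 / h) *\<^sub>R Z h / W h) \<longlongrightarrow> Z' / 1) (at_right 0)"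
    by (intro tendsto_divide) auto
  moreover have "\<forall>\<^sub>F h in at_right 0. (1 / h) *\<^sub>R Z h / W h \<in> {z. z \<in> \<real> \<and> 0 \<le> Re z}"
  proof -
    have "\<forall>\<^sub>F h in at_right 0. W h \<noteq> 0" by (rule tendsto_imp_eventually_ne[OF Wt]) simp
    moreover have "\<forall>\<^sub>F h in at_right 0. 0 < (h :: real)" by (rule eventually_at_right_less)
    ultimately show ?thesis
    proof eventually_elim
      case (elim h)
      have "(1 / h) *\<^sub>R Z h / W h = (1 / h) *\<^sub>R (Z h / W h)" by (simp add: divide_inverse)
      then show ?case using ratio[of h] elim by (simp add: complex_is_Real_iff)
    qed
  qed
  moreover have "closed {z. z \<in> \<real> \<and> 0 \<le> Re z}"
    unfolding complex_is_Real_iff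
    by (intro closed_Collect_conj closed_Collect_eq closed_Collect_le continuous_intros)
  ultimately have "Z' / 1 \<in> {z. z \<in> \<real> \<and> 0 \<le> Re z}"
    by (intro Lim_in_closed_set) auto
  then show ?thesis by simp
qed

section \<open>First-order conditions at coordinate flags\<close>

lemma left_minor_mexp_has_vector_derivative:
  fixes M g :: "complex^'n::{finite,linorder}^'n::{finite,linorder}"
  shows "((\<lambda>t. left_minor X (mexp M t ** g)) has_vector_derivative
    (\<Sum>a<card X. \<Sum>l\<in>UNIV. M $ (sorted_list_of_set X ! a) $ l *
      rdet (entries (mexp M t ** g)) ((sorted_list_of_set X)[a := l]))) (at t)"
  using rdet_has_vector_derivative[of "\<lambda>t. entries (mexp M t ** g)" "\<lambda>i j. M $ i $ j" t
      "sorted_list_of_set X", OF entries_mexp_has_vector_derivative]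
  by (simp add: left_minor_eq_sdet)

text \<open>Among all single-row replacements only the one that puts \<open>i\<close> in the place
  of \<open>j\<close> gives the row set \<open>I\<close>; every other minor in the derivative
  vanishes at the flag. The number \<open>\<epsilon>\<close> is the minor of \<open>I\<close> up to
  the sign of sorting, and neighbours need no sorting.\<close>

lemma coordinate_minor_derivative:
  fixes M g :: "complex^'n::{finite,linorder}^'n::{finite,linorder}"
  assumes flag: "\<And>ys. length ys = card I \<Longrightarrow> rdet (entries g) ys \<noteq> 0 \<longleftrightarrow> set ys = I"
    and i: "i \<in> I" and j: "j \<notin> I"
  obtains \<epsilon> where "\<epsilon> \<noteq> 0"
    "((\<lambda>t. left_minor (insert j (I - {i})) (mexp M t ** g)) has_vector_derivative M $ j $ i * \<epsilon>) (at 0)"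
    "next_index i j \<or> next_index j i \<longrightarrow> \<epsilon> = left_minor I g"
proof -
  define X where "X = insert j (I - {i})"
  let ?xs = "sorted_list_of_set X"
  have c: "card X = card I" unfolding X_def using i j by (metis DiffD1 card.remove card_insert_disjoint finite)
  have len: "length ?xs = card I" using c by simp
  have set: "set ?xs = X" "distinct ?xs" by simp_all
  obtain p where p: "p < card I" "?xs ! p = j"
    using len set(1) by (metis X_def in_set_conv_nth insertI1)
  have set_p: "set (?xs[p := l]) = insert l (I - {i})" for l
    using set_update_distinct[OF set(2), of p l] p len set(1) j by (auto simp: X_def)
  have zero: "rdet (entries g) (?xs[a := l]) = 0" if "a < card I" "a \<noteq> p \<or> l \<noteq> i" for a l
  proof -
    have "set (?xs[a := l]) \<noteq> I"
    proof (cases "a = p")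
      case True
      then have "i \<notin> set (?xs[a := l])" using that set_p by auto
      then show ?thesis using i by auto
    next
      case False
      then have "?xs[a := l] ! p = j" "p < length (?xs[a := l])" using p len by simp_all
      then have "j \<in> set (?xs[a := l])" by (metis nth_mem)
      then show ?thesis using j by auto
    qed
    then show ?thesis using flag[of "?xs[a := l]"] len by simp
  qed
  define \<epsilon> where "\<epsilon> = rdet (entries g) (?xs[p := i])"
  have "(\<Sum>a<card I. \<Sum>l\<in>UNIV. M $ (?xs ! a) $ l * rdet (entries g) (?xs[a := l])) =
      (\<Sum>a\<in>{p}. \<Sum>l\<in>UNIV. M $ (?xs ! a) $ l * rdet (entries g) (?xs[a := l]))"
    using p by (intro sum.mono_neutral_right) (auto simp: zero)
  also have "\<dots> = (\<Sum>l\<in>{i}. M $ (?xs ! p) $ l * rdet (entries g) (?xs[p := l]))"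
  proof -
    have "(\<Sum>l\<in>UNIV. M $ (?xs ! p) $ l * rdet (entries g) (?xs[p := l])) =
        (\<Sum>l\<in>{i}. M $ (?xs ! p) $ l * rdet (entries g) (?xs[p := l]))"
      using p zero by (intro sum.mono_neutral_right) auto
    then show ?thesis by simp
  qed
  also have "\<dots> = M $ j $ i * \<epsilon>" by (simp add: p \<epsilon>_def)
  finally have "((\<lambda>t. left_minor X (mexp M t ** g)) has_vector_derivative M $ j $ i * \<epsilon>) (at 0)"
    using left_minor_mexp_has_vector_derivative[of X M g 0] unfolding c
    by (simp add: mexp_0)
  moreover have "\<epsilon> \<noteq> 0"
    unfolding \<epsilon>_def using flag[of "?xs[p := i]"] len set_p[of i] i by (simp add: insert_absorb)
  moreover have "\<epsilon> = left_minor I g" if "next_index i j \<or> next_index j i"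
  proof -
    have "?xs[p := i] = sorted_list_of_set (insert i (X - {?xs ! p}))"
      by (rule sorted_list_update_neighbour) (use p c that i j in \<open>auto simp: X_def\<close>)
    also have "insert i (X - {?xs ! p}) = I" using i j p by (auto simp: X_def)
    finally show ?thesis by (simp add: \<epsilon>_def left_minor_eq_sdet)
  qed
  ultimately show ?thesis using that unfolding X_def by blast
qed

lemma flow_line_minors:
  fixes lam :: "real^'n::{finite,linorder}"
  assumes lam: "\<forall>i j. i \<le> j \<longrightarrow> lam $ j \<le> lam $ i" and N: "N \<in> unitary_algebra"
    and g: "g \<in> unitary_group"
  obtains L where "kaehler_gradient_flow_line lam N L" "L 0 = adj_act lam g"
    "\<And>t h k. h \<in> unitary_group \<Longrightarrow> L t = adj_act lam h \<Longrightarrow> descent lam k \<Longrightarrow>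
      \<exists>c. c \<noteq> 0 \<and> (\<forall>X. card X = k \<longrightarrow> left_minor X h = c * left_minor X (mexp (cscale \<i> N) t ** g))"
proof -
  obtain q where q: "q 0 = g" "\<And>t. q t \<in> unitary_group"
    "kaehler_gradient_flow_line lam N (\<lambda>t. adj_act lam (q t))"
    "\<And>t. \<exists>U. upper_tri_pos U \<and> q t = mexp (cscale \<i> N) t ** g ** U"
    using flow_line_exists[OF N g lam] by metis
  show ?thesis
  proof (rule that[OF q(3)])
    fix t h k
    assume h: "h \<in> unitary_group" "adj_act lam (q t) = adj_act lam h" and k: "descent lam k"
    obtain c1 where c1: "c1 \<noteq> 0" "\<And>X. card X = k \<Longrightarrow> left_minor X h = c1 * left_minor X (q t)"
      using adj_act_eq_left_minor[OF lam k q(2) h] by blast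
    obtain c2 where c2: "c2 > 0"
      "\<And>X. card X = k \<Longrightarrow> left_minor X (q t) = of_real c2 * left_minor X (mexp (cscale \<i> N) t ** g)"
      using q(4)[of t] left_minor_mult_upper_tri_pos[of _ k "mexp (cscale \<i> N) t ** g"] by metis
    show "\<exists>c. c \<noteq> 0 \<and> (\<forall>X. card X = k \<longrightarrow> left_minor X h = c * left_minor X (mexp (cscale \<i> N) t ** g))"
      using c1 c2 by (intro exI[of _ "c1 * of_real c2"]) (simp add: mult.assoc)
  qed (simp add: q(1))
qed

text \<open>One matrix \<open>h\<close> serves all descents at once, as the incidence relation
  multiplies minors of two orders of the same matrix.\<close>

lemma weakly_preserved_minors:
  fixes lam :: "real^'n::{finite,linorder}"
  assumes lam: "\<forall>i j. i \<le> j \<longrightarrow> lam $ j \<le> lam $ i" and N: "N \<in> unitary_algebra"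
    and weak: "weakly_preserves_positivity lam (kaehler_gradient_flow_line lam N)"
    and g: "g \<in> unitary_nonneg" and t: "0 \<le> t"
  obtains h where "h \<in> closure unitary_pos"
    "\<And>k. descent lam k \<Longrightarrow> \<exists>c. c \<noteq> 0 \<and>
      (\<forall>X. card X = k \<longrightarrow> left_minor X h = c * left_minor X (mexp (cscale \<i> N) t ** g))"
proof -
  have gU: "g \<in> unitary_group" using g by (simp add: unitary_nonneg_def)
  obtain L where L: "kaehler_gradient_flow_line lam N L" "L 0 = adj_act lam g"
    "\<And>t h k. h \<in> unitary_group \<Longrightarrow> L t = adj_act lam h \<Longrightarrow> descent lam k \<Longrightarrow>
      \<exists>c. c \<noteq> 0 \<and> (\<forall>X. card X = k \<longrightarrow> left_minor X h = c * left_minor X (mexp (cscale \<i> N) t ** g))"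
    by (rule flow_line_minors[OF lam N gU]) blast
  have "L 0 \<in> orbit_nonneg lam" unfolding L(2) by (rule adj_act_unitary_nonneg[OF lam g])
  then have "L t \<in> orbit_nonneg lam"
    using weak L(1) t unfolding weakly_preserves_positivity_def by blast
  then obtain h where h: "h \<in> closure unitary_pos" "L t = adj_act lam h"
    using orbit_nonneg_subset by fast
  have "h \<in> unitary_group" using h(1) closure_unitary_pos_subset by (auto simp: unitary_nonneg_def)
  then show ?thesis using that[OF h(1)] L(3)[OF _ h(2)] by blast
qed

lemma isCont_left_minor_mexp:
  fixes M g :: "complex^'n::{finite,linorder}^'n::{finite,linorder}"
  shows "isCont (\<lambda>t. left_minor X (mexp M t ** g)) t"
  by (rule has_vector_derivative_continuous[OF left_minor_mexp_has_vector_derivative])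

lemma obtain_disjoint_set:
  fixes F :: "'n::finite set"
  assumes "card F + m \<le> CARD('n)"
  obtains S where "S \<inter> F = {}" "card S = m"
proof -
  have "m \<le> card (- F)" using assms by (simp add: Compl_eq_Diff_UNIV card_Diff_subset)
  then show ?thesis using that by (metis Int_commute disjoint_eq_subset_Compl obtain_subset_with_card_n)
qed

text \<open>Start at the coordinate flag of \<open>I\<close>, which contains \<open>i\<close> but
  not \<open>j\<close>. The minor with \<open>i\<close> exchanged for \<open>j\<close> is 0 at the
  start and must stay nonnegative relative to that of \<open>I\<close>; its derivative is the entry
  in question.\<close>

lemma weak_adjacent_entry:
  fixes lam :: "real^'n::{finite,linorder}"
  assumes lam: "\<forall>i j. i \<le> j \<longrightarrow> lam $ j \<le> lam $ i" and N: "N \<in> unitary_algebra"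
    and weak: "weakly_preserves_positivity lam (kaehler_gradient_flow_line lam N)"
    and k: "descent lam k" and ij: "next_index i j \<or> next_index j i"
  shows "cscale \<i> N $ j $ i \<in> \<real> \<and> 0 \<le> Re (cscale \<i> N $ j $ i)"
proof -
  let ?M = "cscale \<i> N"
  have neq: "i \<noteq> j" using ij by (auto simp: next_index_def)
  obtain S where S: "S \<inter> {i, j} = {}" "card S = k - 1"
    by (rule obtain_disjoint_set[of "{i, j}" "k - 1"]) (use neq k in \<open>auto simp: descent_def\<close>)
  define I where "I = insert i S"
  have I: "i \<in> I" "j \<notin> I" "card I = k" "I - {i} = S" using S neq k by (auto simp: I_def descent_def)
  obtain g where g: "g \<in> unitary_nonneg"
    "\<And>ys. length ys = card I \<Longrightarrow> rdet (entries g) ys \<noteq> 0 \<longleftrightarrow> set ys = I"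
    "left_minor I g = 1"
    by (rule exists_coordinate_flag[OF order_refl, of I]) blast
  obtain \<epsilon> where \<epsilon>: "\<epsilon> \<noteq> 0"
    "((\<lambda>t. left_minor (insert j (I - {i})) (mexp ?M t ** g)) has_vector_derivative ?M $ j $ i * \<epsilon>) (at 0)"
    "next_index i j \<or> next_index j i \<longrightarrow> \<epsilon> = left_minor I g"
    by (rule coordinate_minor_derivative[OF g(2) I(1,2), of ?M]) blast
  have cX: "card (insert j (I - {i})) = k" using S k by (simp add: I descent_def)
  have "?M $ j $ i * \<epsilon> \<in> \<real> \<and> 0 \<le> Re (?M $ j $ i * \<epsilon>)"
  proof (rule derivative_nonneg_real[OF \<epsilon>(2) _ isCont_left_minor_mexp[where X = I and M = ?M and g = g]])
    have "insert j (I - {i}) \<noteq> I" using I by auto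
    then show "left_minor (insert j (I - {i})) (mexp ?M 0 ** g) = 0"
      using g(2)[of "sorted_list_of_set (insert j (I - {i}))"] cX I(3)
      by (simp add: mexp_0 left_minor_eq_sdet del: sorted_list_of_set_insert_remove)
    show "left_minor I (mexp ?M 0 ** g) = 1" by (simp add: mexp_0 g(3))
    fix t :: real assume t: "0 < t" and ne: "left_minor I (mexp ?M t ** g) \<noteq> 0"
    obtain h where h: "h \<in> closure unitary_pos"
      "\<And>k. descent lam k \<Longrightarrow> \<exists>c. c \<noteq> 0 \<and>
        (\<forall>X. card X = k \<longrightarrow> left_minor X h = c * left_minor X (mexp ?M t ** g))"
      by (rule weakly_preserved_minors[OF lam N weak g(1) less_imp_le[OF t]]) blast
    obtain c where c: "c \<noteq> 0" "\<And>X. card X = k \<Longrightarrow> left_minor X h = c * left_minor X (mexp ?M t ** g)"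
      using h(2)[OF k] by blast
    have "h \<in> unitary_nonneg" using h(1) closure_unitary_pos_subset by blast
    then have "left_minor (insert j (I - {i})) h / left_minor I h \<in> \<real> \<and>
        0 \<le> Re (left_minor (insert j (I - {i})) h / left_minor I h)"
      by (auto simp: unitary_nonneg_def complex_is_Real_iff Re_divide Im_divide)
    then show "left_minor (insert j (I - {i})) (mexp ?M t ** g) / left_minor I (mexp ?M t ** g) \<in> \<real> \<and>
      0 \<le> Re (left_minor (insert j (I - {i})) (mexp ?M t ** g) / left_minor I (mexp ?M t ** g))"
      using c(1) by (simp add: c(2)[OF cX] c(2)[OF I(3)])
  qed
  then show ?thesis using \<epsilon>(3) ij g(3) by simp
qed

lemma exists_next_index:
  fixes i j :: "'n::{finite,linorder}"
  assumes "i < j"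
  obtains m where "next_index i m" "m \<le> j"
proof -
  define m where "m = Min {y. i < y}"
  have "m \<in> {y. i < y}" unfolding m_def by (rule Min_in) (use assms in auto)
  moreover have le: "m \<le> y" if "i < y" for y unfolding m_def using that by (intro Min_le) auto
  ultimately have "next_index i m" by (fastforce simp: next_index_def)
  then show ?thesis using that le[OF assms] by blast
qed

text \<open>The set \<open>A\<close> contains \<open>i\<close>, its successor \<open>m\<close>,
  \<open>j\<close> and the padding \<open>E\<close>. The sizes of \<open>S\<close> and
  \<open>E\<close> make the two factors of each summand minors of orders \<open>k\<close> and
  \<open>k'\<close>, the orders visible on the orbit. Room for the padding is left because
  \<open>k' < CARD('n)\<close>.\<close>

lemma weak_nonadjacent_entry:
  fixes lam :: "real^'n::{finite,linorder}"
  assumes lam: "\<forall>i j. i \<le> j \<longrightarrow> lam $ j \<le> lam $ i" and N: "N \<in> unitary_algebra"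
    and weak: "weakly_preserves_positivity lam (kaehler_gradient_flow_line lam N)"
    and k: "descent lam k" "descent lam k'" "k < k'" and ij: "i < j" "\<not> next_index i j"
  shows "cscale \<i> N $ j $ i = 0"
proof -
  let ?M = "cscale \<i> N"
  have kn: "0 < k" "k' < CARD('n)" using k by (auto simp: descent_def)
  obtain m where m: "next_index i m" "m \<le> j" by (rule exists_next_index[OF ij(1)])
  have im: "i < m" and mj: "m < j" using m ij by (auto simp: next_index_def order.strict_iff_order)
  have "i \<noteq> m" "m \<noteq> j" "i \<noteq> j" using im mj ij by auto
  then have c3: "card {i, m, j} = 3" by simp
  obtain S where S: "S \<inter> {i, m, j} = {}" "card S = k - 1"
    by (rule obtain_disjoint_set[of "{i, m, j}" "k - 1"]) (use c3 k kn in auto)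
  have c3S: "card ({i, m, j} \<union> S) = k + 2"
    using S c3 kn by (subst card_Un_disjoint) auto
  obtain E where E: "E \<inter> ({i, m, j} \<union> S) = {}" "card E = k' - k - 1"
    by (rule obtain_disjoint_set[of "{i, m, j} \<union> S" "k' - k - 1"]) (use c3S k kn in auto)
  define A where "A = {i, m, j} \<union> E"
  have A: "i \<in> A" "m \<in> A" "j \<in> A" "S \<inter> A = {}" using S E by (auto simp: A_def)
  have cA: "card A = k' - k + 2"
    unfolding A_def using E c3 k by (subst card_Un_disjoint) auto
  have cS: "card (insert y S) = k" if "y \<in> A" for y
  proof -
    have "y \<notin> S" using that A(4) by auto
    then show ?thesis using S(2) kn by simp
  qed
  have cSA: "card (S \<union> A - {y}) = k'" if "y \<in> A" for y
  proof -
    have "card (S \<union> A) = k' + 1" using A(4) S(2) cA k kn by (subst card_Un_disjoint) auto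
    then show ?thesis using that by simp
  qed
  \<comment> \<open>At this flag the factor of order \<open>k\<close> is nonzero at time 0 only for
    \<open>y = i\<close> and the factor of order \<open>k'\<close> only for \<open>y = j\<close>. To
    first order all other summands vanish, and the summand of \<open>j\<close> lies beyond both
    cut-offs.\<close>
  define I where "I = insert i S"
  define I' where "I' = S \<union> A - {j}"
  have II': "I \<subseteq> I'" using A S im mj by (auto simp: I_def I'_def)
  have cI: "card I = k" "card I' = k'" using cS cSA A by (auto simp: I_def I'_def)
  obtain g where g: "g \<in> unitary_nonneg"
    "\<And>ys. length ys = card I \<Longrightarrow> rdet (entries g) ys \<noteq> 0 \<longleftrightarrow> set ys = I"
    "\<And>ys. length ys = card I' \<Longrightarrow> rdet (entries g) ys \<noteq> 0 \<longleftrightarrow> set ys = I'"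
    "left_minor I g = 1" "left_minor I' g = 1"
    by (rule exists_coordinate_flag[OF II']) blast
  have g0: "left_minor X g = 0" if "card X = k \<and> X \<noteq> I \<or> card X = k' \<and> X \<noteq> I'" for X
    using that g(2)[of "sorted_list_of_set X"] g(3)[of "sorted_list_of_set X"] cI
    by (auto simp: left_minor_eq_sdet)
  have i': "i \<in> I'" "j \<notin> I'" using A im mj by (auto simp: I'_def)
  obtain \<epsilon> where \<epsilon>: "\<epsilon> \<noteq> 0"
    "((\<lambda>t. left_minor (insert j (I' - {i})) (mexp ?M t ** g)) has_vector_derivative ?M $ j $ i * \<epsilon>) (at 0)"
    by (rule coordinate_minor_derivative[OF g(3) i', of ?M]) blast
  have SAi: "insert j (I' - {i}) = S \<union> A - {i}" using A im mj by (auto simp: I'_def)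
  let ?D = "\<lambda>X t. left_minor X (mexp ?M t ** g)"
  let ?s = "\<lambda>y. (-1) ^ card {z\<in>A. z < y} :: complex"
  let ?Z = "\<lambda>x t. - ((-1) ^ card (A \<inter> {..x})) *
      (\<Sum>y\<in>A \<inter> {..x}. ?s y * (?D (insert y S) t * ?D (S \<union> A - {y}) t))"
  have D0: "?D (insert y S) 0 = (if y = i then 1 else 0)" "y \<noteq> j \<Longrightarrow> ?D (S \<union> A - {y}) 0 = 0"
    if y: "y \<in> A" for y
  proof -
    have "insert y S \<noteq> I" if "y \<noteq> i" using that y A(4) by (auto simp: I_def)
    then show "?D (insert y S) 0 = (if y = i then 1 else 0)"
      using g(4) g0[of "insert y S"] cS[OF y] by (auto simp: mexp_0 I_def)
    assume "y \<noteq> j"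
    then have "S \<union> A - {y} \<noteq> I'" using y by (auto simp: I'_def)
    then show "?D (S \<union> A - {y}) 0 = 0" using g0 cSA[OF y] by (simp add: mexp_0)
  qed
  have termd: "((\<lambda>t. ?D (insert y S) t * ?D (S \<union> A - {y}) t) has_vector_derivative
      (if y = i then ?M $ j $ i * \<epsilon> else 0)) (at 0)" if y: "y \<in> A" "y \<noteq> j" for y
  proof -
    obtain a where a: "(?D (insert y S) has_vector_derivative a) (at 0)"
      using left_minor_mexp_has_vector_derivative by blast
    obtain b where b: "(?D (S \<union> A - {y}) has_vector_derivative b) (at 0)" "y = i \<Longrightarrow> b = ?M $ j $ i * \<epsilon>"
      using left_minor_mexp_has_vector_derivative \<epsilon>(2) unfolding SAi by blast
    have "((\<lambda>t. ?D (insert y S) t * ?D (S \<union> A - {y}) t) has_vector_derivative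
        ?D (insert y S) 0 * b + a * ?D (S \<union> A - {y}) 0) (at 0)"
      by (rule has_vector_derivative_mult[OF a b(1)])
    then show ?thesis using D0[OF y(1)] y(2) b(2) by auto
  qed
  have sign: "- ((-1) ^ card (A \<inter> {..x})) * (?s i * (?M $ j $ i * \<epsilon>)) \<in> \<real> \<and>
      0 \<le> Re (- ((-1) ^ card (A \<inter> {..x})) * (?s i * (?M $ j $ i * \<epsilon>)))"
    if x: "i \<le> x" "x < j" for x
  proof (rule derivative_nonneg_real[where Z = "?Z x" and W = "\<lambda>t. ?D I t * ?D I' t"])
    have "(\<Sum>y\<in>A \<inter> {..x}. ?s y * (if y = i then ?M $ j $ i * \<epsilon> else 0)) = ?s i * (?M $ j $ i * \<epsilon>)"
      using A(1) x by (simp add: mult_delta_right)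
    moreover have "(?Z x has_vector_derivative - ((-1) ^ card (A \<inter> {..x})) *
        (\<Sum>y\<in>A \<inter> {..x}. ?s y * (if y = i then ?M $ j $ i * \<epsilon> else 0))) (at 0)"
      by (intro has_vector_derivative_mult_right has_vector_derivative_sum termd) (use x in auto)
    ultimately show "(?Z x has_vector_derivative - ((-1) ^ card (A \<inter> {..x})) * (?s i * (?M $ j $ i * \<epsilon>))) (at 0)"
      by simp
    show "?Z x 0 = 0"
    proof -
      have "(\<Sum>y\<in>A \<inter> {..x}. ?s y * (?D (insert y S) 0 * ?D (S \<union> A - {y}) 0)) = 0"
        using x D0(2) by (intro sum.neutral ballI) auto
      then show ?thesis by simp
    qed
    show "isCont (\<lambda>t. ?D I t * ?D I' t) 0" by (intro continuous_intros isCont_left_minor_mexp)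
    show "?D I 0 * ?D I' 0 = 1" using g(4,5) by (simp add: mexp_0)
    fix t :: real assume t: "0 < t" and ne: "?D I t * ?D I' t \<noteq> 0"
    obtain h where h: "h \<in> closure unitary_pos"
      "\<And>k. descent lam k \<Longrightarrow> \<exists>c. c \<noteq> 0 \<and> (\<forall>X. card X = k \<longrightarrow> left_minor X h = c * ?D X t)"
      by (rule weakly_preserved_minors[OF lam N weak g(1) less_imp_le[OF t]]) blast
    obtain c where c: "c \<noteq> 0" "\<And>X. card X = k \<Longrightarrow> left_minor X h = c * ?D X t"
      using h(2)[OF k(1)] by blast
    obtain c' where c': "c' \<noteq> 0" "\<And>X. card X = k' \<Longrightarrow> left_minor X h = c' * ?D X t"
      using h(2)[OF k(2)] by blast
    let ?T = "- ((-1) ^ card (A \<inter> {..x})) *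
      (\<Sum>y\<in>A \<inter> {..x}. ?s y * (left_minor (insert y S) h * left_minor (S \<union> A - {y}) h))"
    let ?W = "left_minor I h * left_minor I' h"
    have hn: "left_minor X h \<in> \<real>" "0 \<le> Re (left_minor X h)" for X
      using h(1) closure_unitary_pos_subset by (auto simp: unitary_nonneg_def)
    have "?T \<in> \<real>" using hn(1)
      by (intro Reals_mult Reals_minus Reals_power sum_in_Reals) auto
    moreover have "0 \<le> Re ?T"
      by (rule closure_truncated_pluecker[OF h(1) A(4)]) (use A(1) x cA in auto)
    moreover have "?W \<in> \<real>" "0 \<le> Re ?W"
      using hn[of I] hn[of I'] by (auto simp: complex_is_Real_iff)
    moreover have "z / w \<in> \<real> \<and> 0 \<le> Re (z / w)"
      if "z \<in> \<real>" "0 \<le> Re z" "w \<in> \<real>" "0 \<le> Re w" for z w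
      using that by (auto elim!: Reals_cases simp flip: of_real_divide)
    ultimately have "?T / ?W \<in> \<real> \<and> 0 \<le> Re (?T / ?W)" by blast
    moreover have "?T = (c * c') * ?Z x t"
    proof -
      have "(\<Sum>y\<in>A \<inter> {..x}. ?s y * (left_minor (insert y S) h * left_minor (S \<union> A - {y}) h)) =
          (c * c') * (\<Sum>y\<in>A \<inter> {..x}. ?s y * (?D (insert y S) t * ?D (S \<union> A - {y}) t))"
        unfolding sum_distrib_left by (intro sum.cong refl) (simp add: c(2)[OF cS] c'(2)[OF cSA] mult_ac)
      then show ?thesis by simp
    qed
    moreover have "?W = (c * c') * (?D I t * ?D I' t)" by (simp add: c(2) c'(2) cI)
    moreover have "(c * c' * z) / (c * c' * w) = z / w" for z w using c(1) c'(1) by simp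
    ultimately show "?Z x t / (?D I t * ?D I' t) \<in> \<real> \<and> 0 \<le> Re (?Z x t / (?D I t * ?D I' t))"
      by (simp only:)
  qed
  \<comment> \<open>Moving the cut-off from \<open>i\<close> to \<open>m\<close> adds the single
    index \<open>m\<close> to the cut-off set. The required sign flips while the first-order value
    of the sum is unchanged.\<close>
  have Ai: "A \<inter> {..i} = insert i {z\<in>A. z < i}" using A by auto
  have Am: "A \<inter> {..m} = insert m (insert i {z\<in>A. z < i})"
    using A im next_index_less(2)[OF m(1)] by (auto simp: le_less)
  have ci: "card (A \<inter> {..i}) = Suc (card {z\<in>A. z < i})" unfolding Ai by simp
  have cm: "card (A \<inter> {..m}) = Suc (Suc (card {z\<in>A. z < i}))"
  proof -
    have "m \<noteq> i" "\<not> m < i" using im by auto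
    then show ?thesis unfolding Am by simp
  qed
  have "?M $ j $ i * \<epsilon> \<in> \<real> \<and> 0 \<le> Re (?M $ j $ i * \<epsilon>)"
    using sign[OF order_refl ij(1)] unfolding ci by simp
  moreover have "0 \<le> Re (- (?M $ j $ i * \<epsilon>))"
    using sign[OF less_imp_le[OF im] mj] unfolding cm by simp
  ultimately have "?M $ j $ i * \<epsilon> = 0" by (simp add: complex_is_Real_iff complex_eq_iff)
  then show ?thesis using \<epsilon>(1) by simp
qed

lemma weakly_preserves_positivityD:
  fixes lam :: "real^'n::{finite,linorder}"
  assumes lam: "\<forall>i j. i \<le> j \<longrightarrow> lam $ j \<le> lam $ i"
    and three: "3 \<le> card (range (\<lambda>i. lam $ i))" and N: "N \<in> unitary_algebra"
    and weak: "weakly_preserves_positivity lam (kaehler_gradient_flow_line lam N)"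
  shows "cscale \<i> N \<in> complexify ` gl_nonneg"
proof -
  let ?M = "cscale \<i> N"
  obtain k k' where k: "descent lam k" "descent lam k'" "k < k'" by (rule two_descents[OF three])
  define T where "T = (\<chi> i j. Re (?M $ i $ j))"
  have herm: "?M $ i $ j = cnj (?M $ j $ i)" for i j
    using cscale_hermitian[OF N] by (metis conj_transpose_entry)
  have adj: "?M $ i $ j \<in> \<real> \<and> 0 \<le> Re (?M $ i $ j)" if "next_index i j \<or> next_index j i" for i j
    using weak_adjacent_entry[OF lam N weak k(1), of j i] that by blast
  have nonadj: "?M $ i $ j = 0" if "i \<noteq> j" "\<not> next_index i j" "\<not> next_index j i" for i j
  proof (cases "i < j")
    case True
    then show ?thesis using weak_nonadjacent_entry[OF lam N weak k True that(2)] herm[of i j] by simp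
  next
    case False
    then show ?thesis using weak_nonadjacent_entry[OF lam N weak k, of j i] that by simp
  qed
  have "Im (?M $ i $ j) = 0" for i j
  proof (cases "i = j")
    case True
    then show ?thesis using arg_cong[OF herm[of i i], of Im] by simp
  next
    case False
    then show ?thesis using adj[of i j] nonadj[of i j]
      by (cases "next_index i j \<or> next_index j i") (auto simp: complex_is_Real_iff)
  qed
  then have "?M = complexify T"
    by (intro matrix_eqI) (simp add: complexify_entry T_def complex_eq_iff)
  moreover have "T \<in> gl_nonneg"
    using adj nonadj by (auto simp: gl_nonneg_def tridiagonal_def T_def)
  ultimately show ?thesis by blast
qed

section \<open>Zero entries next to the diagonal obstruct strict positivity\<close>

lemma next_index_unique:
  assumes al: "next_index a l" and ij: "next_index i j" and "a \<le> i" "i < l"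
  shows "a = i \<and> l = j"
proof -
  have "a = i"
    using next_index_less(1)[OF al, of i] assms(3,4) by (metis le_less less_asym less_irrefl)
  moreover have "i < j" using ij by (simp add: next_index_def)
  then have "l = j"
    using next_index_less(1)[OF al, of j] next_index_less(1)[OF ij, of l] \<open>a = i\<close> assms(4)
    by (metis less_asym)
  ultimately show ?thesis ..
qed

text \<open>If \<open>T\<close> has a zero next to the diagonal, then the index sets reachable from \<open>J\<close> all meet the
  initial segment \<open>{..i}\<close> in equally many elements, so minors of a coordinate flag stay zero.\<close>

lemma compound_gen_preserves_card:
  fixes T :: "real^'n::{finite,linorder}^'n::{finite,linorder}"
  assumes T: "tridiagonal T" and ij: "next_index i j" "T $ i $ j = 0" "T $ j $ i = 0"
    and ne: "compound_gen T J J' \<noteq> 0"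
  shows "card J' = card J" "card (J' \<inter> {..i}) = card (J \<inter> {..i})"
proof -
  obtain a where a: "a \<in> J"
    "(\<Sum>l\<in>- (J - {a}). if J' = insert l (J - {a}) then T $ a $ l else 0) \<noteq> 0"
    using ne unfolding compound_gen_def by (rule sum.not_neutral_contains_not_neutral)
  from a(2) obtain l where "l \<in> - (J - {a})" "(if J' = insert l (J - {a}) then T $ a $ l else 0) \<noteq> 0"
    by (rule sum.not_neutral_contains_not_neutral)
  with a(1) have al: "a \<in> J" "l \<notin> J - {a}" "J' = insert l (J - {a})" "T $ a $ l \<noteq> 0"
    by (auto split: if_splits)
  have "card (insert l (J - {a})) = card J"
    using al(1,2) by (metis card.remove card_insert_disjoint finite)
  then show "card J' = card J" by (simp add: al(3))
  \<comment> \<open>A neighbour move crosses the gap between \<open>i\<close> and its successor only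
    if it exchanges \<open>i\<close> and \<open>j\<close>, and there both entries of
    \<open>T\<close> are 0.\<close>
  have side: "a \<le> i \<longleftrightarrow> l \<le> i"
  proof (cases "a = l")
    case False
    then have n: "next_index a l \<or> next_index l a" using T al(4) by (auto simp: tridiagonal_def)
    show ?thesis
    proof (rule ccontr)
      assume "\<not> ?thesis"
      then consider "a \<le> i" "i < l" | "l \<le> i" "i < a" using not_le by blast
      then show False
      proof cases
        case 1
        then have "next_index a l" using n by (auto simp: next_index_def)
        then have "a = i" "l = j" using next_index_unique[OF _ ij(1) 1] by blast+
        then show False using al(4) ij by simp
      next
        case 2
        then have "next_index l a" using n by (auto simp: next_index_def)
        then have "l = i" "a = j" using next_index_unique[OF _ ij(1) 2] by blast+
        then show False using al(4) ij by simp
      qed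
    qed
  qed simp
  show "card (J' \<inter> {..i}) = card (J \<inter> {..i})"
  proof (cases "a \<le> i")
    case True
    then have "J' \<inter> {..i} = insert l ((J \<inter> {..i}) - {a})" "l \<notin> (J \<inter> {..i}) - {a}" "a \<in> J \<inter> {..i}"
      using side al by auto
    then show ?thesis by (metis card.remove card_insert_disjoint finite finite_Diff)
  next
    case False
    then have "J' \<inter> {..i} = J \<inter> {..i}" using side al by auto
    then show ?thesis by simp
  qed
qed

text \<open>Strict preservation implies weak preservation, since time 0 is trivial. If an entry next
  to the diagonal were 0, the conserved number of rows in \<open>{..i}\<close> would keep the minor
  of \<open>J\<close> at 0 along the trajectory through the coordinate flag of \<open>I\<close>. At
  time 1 it would have to be positive.\<close>

lemma strictly_preserves_positivityD:
  fixes lam :: "real^'n::{finite,linorder}"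
  assumes lam: "\<forall>i j. i \<le> j \<longrightarrow> lam $ j \<le> lam $ i"
    and three: "3 \<le> card (range (\<lambda>i. lam $ i))" and N: "N \<in> unitary_algebra"
    and strict: "strictly_preserves_positivity lam (kaehler_gradient_flow_line lam N)"
  shows "cscale \<i> N \<in> complexify ` gl_pos"
proof -
  let ?M = "cscale \<i> N"
  have "weakly_preserves_positivity lam (kaehler_gradient_flow_line lam N)"
    unfolding weakly_preserves_positivity_def
  proof (intro allI impI)
    fix L and t :: real
    assume L: "kaehler_gradient_flow_line lam N L" "L 0 \<in> orbit_nonneg lam" and t: "0 \<le> t"
    then show "L t \<in> orbit_nonneg lam"
      using strict closure_subset[of "orbit_pos lam"] unfolding strictly_preserves_positivity_def
        orbit_nonneg_def by (cases "t = 0") auto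
  qed
  then obtain T where T: "T \<in> gl_nonneg" "?M = complexify T"
    using weakly_preserves_positivityD[OF lam three N] by blast
  have sym: "T $ i $ j = T $ j $ i" for i j
  proof -
    have "complex_of_real (T $ i $ j) = cnj (complex_of_real (T $ j $ i))"
      using cscale_hermitian[OF N] unfolding T(2) by (metis complexify_entry conj_transpose_entry)
    then show ?thesis by simp
  qed
  obtain k k' where k: "descent lam k" "descent lam k'" "k < k'" by (rule two_descents[OF three])
  have pos: "T $ i $ j \<noteq> 0" if n: "next_index i j" for i j
  proof
    assume zero: "T $ i $ j = 0"
    have neq: "i \<noteq> j" "i < j" using n by (auto simp: next_index_def)
    obtain S where S: "S \<inter> {i, j} = {}" "card S = k - 1"
      by (rule obtain_disjoint_set[of "{i, j}" "k - 1"]) (use neq k in \<open>auto simp: descent_def\<close>)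
    define I where "I = insert i S"
    define J where "J = insert j S"
    have cIJ: "card I = k" "card J = k" using S k by (auto simp: I_def J_def descent_def)
    have "card (I \<inter> {..i}) = Suc (card (S \<inter> {..i}))" using S by (simp add: I_def)
    moreover have "card (J \<inter> {..i}) = card (S \<inter> {..i})" using neq by (simp add: J_def)
    ultimately have J: "card (J \<inter> {..i}) \<noteq> card (I \<inter> {..i})" by simp
    obtain g where g: "g \<in> unitary_nonneg"
      "\<And>ys. length ys = card I \<Longrightarrow> rdet (entries g) ys \<noteq> 0 \<longleftrightarrow> set ys = I"
      by (rule exists_coordinate_flag[OF order_refl, of I]) blast
    have gU: "g \<in> unitary_group" using g(1) by (simp add: unitary_nonneg_def)
    obtain L where L: "kaehler_gradient_flow_line lam N L" "L 0 = adj_act lam g"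
      "\<And>t h k. h \<in> unitary_group \<Longrightarrow> L t = adj_act lam h \<Longrightarrow> descent lam k \<Longrightarrow>
        \<exists>c. c \<noteq> 0 \<and> (\<forall>X. card X = k \<longrightarrow> left_minor X h = c * left_minor X (mexp ?M t ** g))"
      by (rule flow_line_minors[OF lam N gU]) blast
    have "L 0 \<in> orbit_nonneg lam" unfolding L(2) by (rule adj_act_unitary_nonneg[OF lam g(1)])
    then have "\<forall>t>0. L t \<in> orbit_pos lam"
      using strict L(1) unfolding strictly_preserves_positivity_def by blast
    then have "L 1 \<in> orbit_pos lam" by simp
    then obtain h where h: "h \<in> unitary_pos" "L 1 = adj_act lam h" by (auto simp: orbit_pos_def)
    have "h \<in> unitary_group" using h(1) by (simp add: unitary_pos_def)
    then obtain c where c: "left_minor J h = c * left_minor J (mexp ?M 1 ** g)"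
      using L(3)[OF _ h(2) k(1)] cIJ(2) by blast
    have "sdet (entries (mexp (complexify T) 1 ** g)) J = 0"
    proof (rule minor_flow_zero[OF T(1) entries_complexify_has_vector_derivative,
          where X = "{J. card J = k \<and> card (J \<inter> {..i}) \<noteq> card (I \<inter> {..i})}"])
      show "J \<in> {J. card J = k \<and> card (J \<inter> {..i}) \<noteq> card (I \<inter> {..i})}" using J cIJ by simp
      show "J2 \<in> {J. card J = k \<and> card (J \<inter> {..i}) \<noteq> card (I \<inter> {..i})}"
        if "J1 \<in> {J. card J = k \<and> card (J \<inter> {..i}) \<noteq> card (I \<inter> {..i})}" "compound_gen T J1 J2 \<noteq> 0"
        for J1 J2
        using compound_gen_preserves_card[OF _ n zero _ that(2)] that(1) T(1) zero sym[of i j]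
        by (simp add: gl_nonneg_def)
      show "sdet (entries (mexp (complexify T) 0 ** g)) J1 = 0"
        if "J1 \<in> {J. card J = k \<and> card (J \<inter> {..i}) \<noteq> card (I \<inter> {..i})}" for J1
        using g(2)[of "sorted_list_of_set J1"] that cIJ by (auto simp: mexp_0)
    qed simp
    then have "left_minor J h = 0" using c by (simp add: T(2) left_minor_eq_sdet)
    then show False using h(1) by (auto simp: unitary_pos_def dest: spec[of _ J])
  qed
  have "T \<in> gl_pos"
    using T(1) pos sym unfolding gl_pos_def gl_nonneg_def by (auto simp: order.strict_iff_order)
  then show ?thesis using T(2) by blast
qed

theorem corollary5p19:
  fixes lam :: "real^'n::{finite,linorder}"
    and N :: "complex^'n::{finite,linorder}^'n::{finite,linorder}"
  assumes "\<forall>i j. i \<le> j \<longrightarrow> lam $ j \<le> lam $ i"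
    and "3 \<le> card (range (\<lambda>i. lam $ i))"
    and "N \<in> unitary_algebra"
  shows "(weakly_preserves_positivity lam (kaehler_gradient_flow_line lam N)
            \<longleftrightarrow> cscale \<i> N \<in> complexify ` gl_nonneg)
       \<and> (strictly_preserves_positivity lam (kaehler_gradient_flow_line lam N)
            \<longleftrightarrow> cscale \<i> N \<in> complexify ` gl_pos)"
  using weakly_preserves_positivityD[OF assms] strictly_preserves_positivityD[OF assms]
    weakly_preserves_positivityI[OF assms(1,3)] strictly_preserves_positivityI[OF assms(1,3)]
  by blast

end
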